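(* Let $p,q,n,K\ge 1$ be integers, $d=pq$, and let $\mathbf X,\mathbf X_1,\dots,\mathbf X_n$ be i.i.d. centered random vectors in $\mathbb R^d$ with invertible covariance matrix $\Sigma=\mathbb E\,\mathbf X\mathbf X^\top$. Suppose that $$\Sigma=\sum_{j=1}^K\Phi_j\otimes\Psi_j,$$ where $\Phi_j\in\mathbb R^{p\times p}$ and $\Psi_j\in\mathbb R^{q\times q}$ are nonzero symmetric positive semidefinite matrices, and that there exists $\omega>0$ such that $$\log\mathbb E\exp\left\{(\Sigma^{-1/2}\mathbf X)^\top V(\Sigma^{-1/2}\mathbf X)-\mathrm{Tr}(V)\right\}\le\omega^2\|V\|_{\mathrm F}^2\quad\text{for all }V\in\mathbb R^{d\times d}\text{ with }\|V\|_{\mathrm F}\le 1/\omega .$$ Fix any $\delta\in(0,1)$ satisfying $$\frac1{2n}\left(\max_{1\le j\le K}\mathtt r(\Phi_j)^2+\max_{1\le j\le K}\mathtt r(\Psi_j)^2\right)+\frac{\log(4/\delta)}n\le 1,$$ and take any $\lambda\in\mathbb R$ such that $$\lambda\ge 2\omega\left(\sum_{j=1}^K\|\Phi_j\|\|\Psi_j\|\right)\sqrt{\frac{13}{2n}\left(\max_{1\le j\le K}\mathtt r(\Phi_j)^2+\max_{1\le j\le K}\mathtt r(\Psi_j)^2\right)+\frac{13\log(4/\delta)}n}.$$ Let $\widehat\Sigma=\frac1n\sum_{i=1}^n\mathbf X_i\mathbf X_i^\top$ and let $$\widetilde\Sigma=\mathcal R^{-1}(\widetilde R),\qquad \widetilde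 R\in\operatorname*{argmin}_{R\in\mathbb R^{p^2\times q^2}}\left\{\left\|R-\mathcal R(\widehat\Sigma)\right\|_{\mathrm F}^2+\lambda\|R\|_*\right\}.$$ Then, with probability at least $1-\delta$, $$\left\|\widetilde\Sigma-\Sigma\right\|_{\mathrm F}^2<\frac{3\lambda^2K}{2}.$$
   Context: $\|\cdot\|$, $\|\cdot\|_*$, $\|\cdot\|_{\mathrm F}$ denote the operator, nuclear and Frobenius norms of a matrix; $\otimes$ is the Kronecker product ($A\otimes B$ is the block matrix with $(i,j)$ block $a_{ij}B$). For a nonzero symmetric positive semidefinite matrix $M$, $\mathtt r(M)=\mathrm{Tr}(M)/\|M\|$ is its effective rank. For a matrix $U$, $\mathbf{vec}(U)$ is the vector obtained by stacking the columns of $U$. Rearrangement operator: for $M\in\mathbb R^{pq\times pq}$ partitioned into $p\times p$ blocks $M(i,j)\in\mathbb R^{q\times q}$, $i,j\in\{1,\dots,p\}$, the matrix $\mathcal R(M)\in\mathbb R^{p^2\times q^2}$ is defined by: its $((j-1)p+i)$-th row is $\mathbf{vec}(M(i,j))^\top$. The map $\mathcal R:\mathbb R^{pq\times pq}\to\mathbb R^{p^2\times q^2}$ is a linear isometry for the Frobenius norms, hence has an inverse $\mathcal R^{-1}$. *)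

theory Defs
  imports "HOL-Probability.Probability"
begin

text \<open>
  Matrices with \<open>m\<close> rows and \<open>n\<close> columns have type \<open>real^'n^'m\<close>. Composite dimensions are
  indexed by pairs in lexicographic position: index \<open>(i - 1) * q + k\<close> in \<open>{1..p * q}\<close> becomes the
  pair \<open>(i, k)\<close> of type \<open>'p \<times> 'q\<close>.
\<close>

definition op_norm :: "real^'n^'m \<Rightarrow> real" where
  "op_norm A = onorm ((*v) A)"

definition frobenius_norm :: "real^'n^'m \<Rightarrow> real" where
  "frobenius_norm A = sqrt (\<Sum>i\<in>UNIV. \<Sum>j\<in>UNIV. (A $ i $ j)\<^sup>2)"

definition psd :: "real^'n^'n \<Rightarrow> bool" where
  "psd A \<longleftrightarrow> transpose A = A \<and> (\<forall>x. 0 \<le> x \<bullet> (A *v x))"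

text \<open>Meaningful only for positive semidefinite arguments, where the root exists and is unique.\<close>

definition psd_sqrt :: "real^'n^'n \<Rightarrow> real^'n^'n" where
  "psd_sqrt A = (THE S. psd S \<and> S ** S = A)"

definition inv_sqrt :: "real^'n^'n \<Rightarrow> real^'n^'n" where
  "inv_sqrt A = matrix_inv (psd_sqrt A)"

text \<open>The sum of the singular values, as the trace of \<open>(A\<^sup>T A)\<close> to the power \<open>1/2\<close>.\<close>

definition nuclear_norm :: "real^'n^'m \<Rightarrow> real" where
  "nuclear_norm A = trace (psd_sqrt (transpose A ** A))"

definition effective_rank :: "real^'n^'n \<Rightarrow> real" where
  "effective_rank A = trace A / op_norm A"

definition outer :: "real^'m \<Rightarrow> real^'n \<Rightarrow> real^'n^'m" where
  "outer x y = (\<chi> i j. x $ i * y $ j)"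

definition kronecker :: "real^'p^'p \<Rightarrow> real^'q^'q \<Rightarrow> real^('p \<times> 'q)^('p \<times> 'q)" where
  "kronecker A B = (\<chi> a b. A $ fst a $ fst b * B $ snd a $ snd b)"

definition block :: "real^('p::finite \<times> 'q::finite)^('p \<times> 'q) \<Rightarrow> 'p \<Rightarrow> 'p \<Rightarrow> real^'q^'q" where
  "block M i j = (\<chi> k l. M $ (i, k) $ (j, l))"

text \<open>Stacking columns puts the entry in row \<open>k\<close> and column \<open>l\<close> at position \<open>(l, k)\<close>.\<close>

definition vec_of_matrix :: "real^'n::finite^'m::finite \<Rightarrow> real^('n \<times> 'm)" where
  "vec_of_matrix U = (\<chi> a. U $ snd a $ fst a)"

text \<open>Row \<open>(j - 1) * p + i\<close>, that is, row \<open>(j, i)\<close>, is the vectorization of block \<open>(i, j)\<close>.\<close>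

definition rearrange :: "real^('p::finite \<times> 'q::finite)^('p \<times> 'q) \<Rightarrow> real^('q \<times> 'q)^('p \<times> 'p)" where
  "rearrange M = (\<chi> a. vec_of_matrix (block M (snd a) (fst a)))"

definition sample_cov :: "nat \<Rightarrow> (nat \<Rightarrow> real^'n) \<Rightarrow> real^'n^'n" where
  "sample_cov n x = (1 / real n) *\<^sub>R (\<Sum>i=1..n. outer (x i) (x i))"

lemma frobenius_norm_eq_norm: "frobenius_norm A = norm A"
  by (simp add: frobenius_norm_def norm_vec_def L2_set_def sum_nonneg)

lemma rearrange_nth: "rearrange M $ (j, i) $ (l, k) = M $ (i, k) $ (j, l)"
  by (simp add: rearrange_def vec_of_matrix_def block_def)

lemma bij_rearrange: "bij rearrange"
proof (rule o_bij)
  define S :: "real^('q::finite \<times> 'q)^('p::finite \<times> 'p) \<Rightarrow> real^('p \<times> 'q)^('p \<times> 'q)"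
    where "S R = (\<chi> a b. R $ (fst b, fst a) $ (snd b, snd a))" for R
  show "S \<circ> rearrange = id"
    by (auto simp: fun_eq_iff vec_eq_iff S_def rearrange_nth)
  show "rearrange \<circ> S = id"
    by (auto simp: fun_eq_iff vec_eq_iff S_def rearrange_nth)
qed

lemma frobenius_norm_rearrange: "frobenius_norm (rearrange M) = frobenius_norm M"
proof -
  have "(\<Sum>a\<in>UNIV. \<Sum>b\<in>UNIV. (rearrange M $ a $ b)\<^sup>2)
      = (\<Sum>((j, i), (l, k))\<in>UNIV. (M $ (i, k) $ (j, l))\<^sup>2)"
    unfolding sum.cartesian_product UNIV_Times_UNIV
    by (rule sum.cong) (auto simp: rearrange_nth)
  also have "\<dots> = (\<Sum>(a, b)\<in>UNIV. (M $ a $ b)\<^sup>2)"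
    by (rule sum.reindex_bij_witness[where i = "\<lambda>((i, k), (j, l)). ((j, i), (l, k))"
          and j = "\<lambda>((j, i), (l, k)). ((i, k), (j, l))"]) auto
  finally show ?thesis
    unfolding frobenius_norm_def sum.cartesian_product UNIV_Times_UNIV by simp
qed

end

theory Submission imports Defs begin

text \<open>
  Write \<open>x\<close>, \<open>y\<close> for the maximal squared effective ranks of the \<open>\<Phi> j\<close> and \<open>\<Psi> j\<close>, \<open>s\<close> for
  \<open>\<Sum>j. op_norm (\<Phi> j) * op_norm (\<Psi> j)\<close> and \<open>T = (x + y) / 2 + ln (4 / \<delta>)\<close>.

  Comparing the estimator with the true matrix, whose rearrangement has rank at most \<open>K\<close>, through a
  subgradient of the nuclear norm gives the bound with \<open>((1 + sqrt 2) / 2)\<^sup>2 < 3 / 2\<close> in place of \<open>3 / 2\<close>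
  as soon as the rearranged error \<open>\<Delta>\<close> of the sample covariance has operator norm at most \<open>lam / 2\<close>.
  The event in question is measurable since the minimiser is a nonexpansive function of the data.

  The operator norm is the supremum of \<open>kronecker U V \<bullet> \<Delta>\<close> over unit matrices, and is controlled by a
  PAC-Bayes argument with Gaussian smoothing. Exponential moments are only available for test matrices
  of norm at most \<open>1 / \<omega>\<close>. Instead of truncating the Gaussian noise, the random test matrix \<open>Y\<close> is
  normalised to \<open>sgn Y\<close> in the exponent and the posterior is weighted by \<open>norm Y\<close>, which restores
  linearity; the price is the derivative of the expected norm of \<open>Y\<close> under a shift, and it is paid by
  the term \<open>ln 4\<close>. Two smoothings are needed to reach the constant 13:
  if \<open>(1 + 1 / sqrt x) * (1 + 1 / sqrt y) > 9 / 4\<close>, independent noise on all entries of the Kronecker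
  product, for which the expected square of \<open>norm Y\<close> is at most \<open>3 * s\<^sup>2\<close>; otherwise independent noise on
  the two factors. The latter alone would give \<open>4 * s\<^sup>2\<close>, but as \<open>\<Delta>\<close> comes from a symmetric matrix, \<open>Y\<close>
  may be symmetrised, which lowers this to \<open>25 / 8 * s\<^sup>2\<close>, below the admissible \<open>13 / 4 * s\<^sup>2\<close>.
\<close>

section \<open>Square roots of positive semidefinite matrices\<close>

text \<open>The maximum of \<open>x \<bullet> f x\<close> over the unit sphere of \<open>S\<close>
  is attained at an eigenvector, and the orthogonal complement of that vector within
  \<open>S\<close> is again invariant, so induction on the dimension applies. The invariant subspace
  \<open>S\<close> is there for this induction.\<close>

lemma selfadjoint_eigenbasis:
  fixes f :: "'a::euclidean_space \<Rightarrow> 'a"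
  assumes "linear f" and sa: "\<And>x y. f x \<bullet> y = x \<bullet> f y"
    and "subspace S" and "f ` S \<subseteq> S"
  shows "\<exists>B. B \<subseteq> S \<and> finite B \<and> pairwise orthogonal B \<and> (\<forall>b\<in>B. norm b = 1) \<and> span B = S
    \<and> (\<forall>b\<in>B. f b = (b \<bullet> f b) *\<^sub>R b)"
  using assms(3,4)
proof (induction "dim S" arbitrary: S rule: less_induct)
  case less
  interpret f: linear f by fact
  show ?case
  proof (cases "S = {0}")
    case True
    then show ?thesis by (intro exI[of _ "{}"]) auto
  next
    case False
    then obtain x0 where x0: "x0 \<in> S" "x0 \<noteq> 0"
      using less.prems subspace_0 by blast
    define C where "C = sphere 0 1 \<inter> S"
    have "compact C"
      unfolding C_def by (intro compact_Int_closed closed_subspace less.prems compact_sphere)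
    moreover have "(1 / norm x0) *\<^sub>R x0 \<in> C"
      using x0 less.prems by (auto simp: C_def subspace_scale)
    moreover have "continuous_on C (\<lambda>x. x \<bullet> f x)"
      by (intro continuous_intros linear_continuous_on linear_conv_bounded_linear[THEN iffD1] assms)
    ultimately obtain e where e: "e \<in> C" "\<And>x. x \<in> C \<Longrightarrow> x \<bullet> f x \<le> e \<bullet> f e"
      using continuous_attains_sup[of C "\<lambda>x. x \<bullet> f x"] by blast
    define m where "m = e \<bullet> f e"
    have eS: "e \<in> S" and en: "norm e = 1" using e by (auto simp: C_def)
    have le: "x \<bullet> f x \<le> m * (x \<bullet> x)" if "x \<in> S" for x
    proof (cases "x = 0")
      case False
      have "(1 / norm x) *\<^sub>R x \<in> C" using that False less.prems by (auto simp: C_def subspace_scale)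
      from e(2)[OF this] have "(1 / norm x)\<^sup>2 * (x \<bullet> f x) \<le> m"
        by (simp add: m_def f.scale power2_eq_square)
      then show ?thesis using False by (simp add: field_simps dot_square_norm)
    qed (simp add: f.zero)
    define v where "v = f e - m *\<^sub>R e"
    have vS: "v \<in> S"
      using less.prems eS unfolding v_def by (auto intro!: subspace_diff subspace_scale)
    have ee: "e \<bullet> e = 1" using en by (simp add: dot_square_norm)
    have ve: "v \<bullet> e = 0" using ee by (simp add: v_def m_def inner_diff_left inner_commute[of "f e" e])
    have vfe: "v \<bullet> f e = v \<bullet> v"
    proof -
      have "v \<bullet> f e = v \<bullet> (v + m *\<^sub>R e)" by (simp add: v_def)
      then show ?thesis using ve by (simp add: inner_add_right)
    qed
    \<comment> \<open>First variation at the maximiser: moving from \<open>e\<close> in direction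
      \<open>v\<close> changes the quotient by a term linear in \<open>t\<close> with coefficient
      \<open>2 * (v \<bullet> v)\<close>, and everything else is quadratic in \<open>t\<close>. A
      small positive \<open>t\<close> then rules out \<open>v \<noteq> 0\<close>.\<close>
    have main: "2 * t * (v \<bullet> v) \<le> t\<^sup>2 * (m * (v \<bullet> v) - v \<bullet> f v)" for t
    proof -
      have "e + t *\<^sub>R v \<in> S" using eS vS less.prems by (auto intro!: subspace_add subspace_scale)
      from le[OF this] show ?thesis
        using ve ee vfe sa[of e v] inner_commute[of "f e" v] inner_commute[of e v] m_def
        by (simp add: f.add f.scale inner_add_left inner_add_right power2_eq_square algebra_simps)
    qed
    have "v = 0"
    proof (rule ccontr)
      assume "v \<noteq> 0"
      then have vv: "v \<bullet> v > 0" by simp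
      define q where "q = \<bar>m * (v \<bullet> v) - v \<bullet> f v\<bar> + 1"
      define t where "t = (v \<bullet> v) / q"
      have q: "q > 0" by (simp add: q_def)
      have t: "t > 0" using vv q by (simp add: t_def)
      have "2 * t * (v \<bullet> v) \<le> t\<^sup>2 * q"
        using main[of t] by (rule order_trans) (auto simp: q_def intro!: mult_left_mono)
      also have "\<dots> = t * (v \<bullet> v)" using q by (simp add: t_def power2_eq_square)
      finally show False using t vv by simp
    qed
    then have fe: "f e = m *\<^sub>R e" by (simp add: v_def)
    define S' where "S' = S \<inter> {x. e \<bullet> x = 0}"
    have sub: "subspace S'" unfolding S'_def by (intro subspace_inter less.prems subspace_hyperplane)
    have "e \<bullet> f x = m * (e \<bullet> x)" for x using sa[of e x] fe by simp
    then have inv: "f ` S' \<subseteq> S'" using less.prems by (auto simp: S'_def)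
    have "e \<notin> S'" using ee by (simp add: S'_def)
    then have "S' \<noteq> S" "S' \<subseteq> S" using eS by (blast, simp add: S'_def)
    then have "S' \<subset> S" by blast
    then have "dim S' < dim S"
      using dim_psubset sub less.prems(1) by (metis span_eq_iff)
    from less.hyps[OF this sub inv] obtain B where B: "B \<subseteq> S'" "finite B" "pairwise orthogonal B"
      "\<forall>b\<in>B. norm b = 1" "span B = S'" "\<forall>b\<in>B. f b = (b \<bullet> f b) *\<^sub>R b" by blast
    have "span (insert e B) = S"
    proof
      show "span (insert e B) \<subseteq> S"
        using B(1) eS less.prems(1) by (intro span_minimal) (auto simp: S'_def)
      show "S \<subseteq> span (insert e B)"
      proof
        fix x assume x: "x \<in> S"
        have "x - (e \<bullet> x) *\<^sub>R e \<in> S'"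
          using x eS less.prems(1) ee by (auto simp: S'_def inner_diff_right intro!: subspace_diff subspace_scale)
        then show "x \<in> span (insert e B)" using B(5) by (auto simp: span_breakdown_eq)
      qed
    qed
    moreover have "pairwise orthogonal (insert e B)"
      using B(1,3) by (auto simp: pairwise_insert orthogonal_def S'_def inner_commute)
    ultimately show ?thesis
      using B eS en fe ee by (intro exI[of _ "insert e B"]) (auto simp: S'_def)
  qed
qed

definition orthonormal_basis :: "'a::euclidean_space set \<Rightarrow> bool" where
  "orthonormal_basis B \<longleftrightarrow> finite B \<and> pairwise orthogonal B \<and> (\<forall>b\<in>B. norm b = 1) \<and> span B = UNIV"

lemma orthonormal_basis_inner:
  "orthonormal_basis B \<Longrightarrow> a \<in> B \<Longrightarrow> b \<in> B \<Longrightarrow> a \<bullet> b = (if a = b then 1 else 0)"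
  by (auto simp: orthonormal_basis_def pairwise_def orthogonal_def dot_square_norm)

lemma orthonormal_basis_sum:
  "orthonormal_basis B \<Longrightarrow> (\<Sum>b\<in>B. (x \<bullet> b) *\<^sub>R b) = x"
  using orthonormal_basis_expand[of B x] by (auto simp: orthonormal_basis_def)

lemma orthonormal_basis_parseval:
  assumes "orthonormal_basis B"
  shows "x \<bullet> y = (\<Sum>b\<in>B. (x \<bullet> b) * (y \<bullet> b))"
proof -
  have "(\<Sum>b\<in>B. (x \<bullet> b) * (y \<bullet> b)) = (\<Sum>b\<in>B. (x \<bullet> b) *\<^sub>R b) \<bullet> y"
    by (simp add: inner_sum_left inner_commute[of y])
  then show ?thesis by (simp add: orthonormal_basis_sum[OF assms])
qed

text \<open>The inner product of the matrix type is the Frobenius one. Parseval's identity in each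
  row allows it to be computed in any orthonormal basis, for instance one of singular
  vectors.\<close>

lemma orthonormal_basis_matrix_inner:
  fixes A C :: "real^'n^'m"
  assumes "orthonormal_basis B"
  shows "A \<bullet> C = (\<Sum>b\<in>B. (A *v b) \<bullet> (C *v b))"
proof -
  have "A \<bullet> C = (\<Sum>i\<in>UNIV. \<Sum>b\<in>B. (A $ i \<bullet> b) * (C $ i \<bullet> b))"
    unfolding inner_vec_def[of A] orthonormal_basis_parseval[OF assms, symmetric] ..
  also have "\<dots> = (\<Sum>b\<in>B. \<Sum>i\<in>UNIV. (A $ i \<bullet> b) * (C $ i \<bullet> b))" by (rule sum.swap)
  finally show ?thesis by (simp add: inner_vec_def[of "_ *v _"] matrix_vector_mul_component)
qed

lemma trace_eq_inner: "trace A = A \<bullet> mat 1"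
proof -
  have "(\<Sum>j\<in>UNIV. A $ i $ j * (if i = j then 1 else 0)) = A $ i $ i" for i
    by (subst sum.remove[of _ i]) auto
  then show ?thesis by (simp add: trace_def inner_vec_def mat_def)
qed

lemma orthonormal_basis_trace:
  fixes A :: "real^'n^'n"
  assumes "orthonormal_basis B"
  shows "trace A = (\<Sum>b\<in>B. b \<bullet> (A *v b))"
  by (simp add: trace_eq_inner orthonormal_basis_matrix_inner[OF assms] inner_commute)

lemma orthonormal_basis_matrix_eqI:
  fixes A C :: "real^'n^'m"
  assumes "orthonormal_basis B" "\<And>b. b \<in> B \<Longrightarrow> A *v b = C *v b"
  shows "A = C"
proof -
  have "A *v x = C *v x" for x
    using linear_eq_on[of "(*v) A" "(*v) C" x B] assms by (auto simp: orthonormal_basis_def)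
  then show ?thesis by (simp add: matrix_eq)
qed

lemma dot_matrix_vector_mul_symmetric:
  fixes A :: "real^'n^'n"
  shows "transpose A = A \<Longrightarrow> (A *v x) \<bullet> y = x \<bullet> (A *v y)"
  by (metis dot_lmul_matrix vector_transpose_matrix inner_commute)

lemma psd_eigenbasis:
  fixes A :: "real^'n^'n"
  assumes "psd A"
  obtains B where "orthonormal_basis B" "\<And>b. b \<in> B \<Longrightarrow> A *v b = (b \<bullet> (A *v b)) *\<^sub>R b"
    "\<And>b. 0 \<le> b \<bullet> (A *v b)"
proof -
  have "transpose A = A" and pos: "\<And>b. 0 \<le> b \<bullet> (A *v b)" using assms by (auto simp: psd_def)
  then have "\<And>x y. (A *v x) \<bullet> y = x \<bullet> (A *v y)" by (simp add: dot_matrix_vector_mul_symmetric)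
  from selfadjoint_eigenbasis[OF matrix_vector_mul_linear this, of UNIV] pos that show ?thesis
    by (auto simp: orthonormal_basis_def)
qed

lemma outer_mult_vec: "outer x y *v z = (y \<bullet> z) *\<^sub>R x"
  by (simp add: vec_eq_iff outer_def matrix_vector_mult_def inner_vec_def sum_distrib_left mult_ac)

lemma sum_matrix_vector_mult: "(\<Sum>i\<in>I. A i) *v x = (\<Sum>i\<in>I. A i *v x)"
  by (induction I rule: infinite_finite_induct) (auto simp: matrix_vector_mult_add_rdistrib)

lemma psd_sqrt_ex:
  fixes A :: "real^'n^'n"
  assumes "psd A"
  shows "\<exists>S. psd S \<and> S ** S = A"
proof -
  obtain B where B: "orthonormal_basis B" "\<And>b. b \<in> B \<Longrightarrow> A *v b = (b \<bullet> (A *v b)) *\<^sub>R b"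
    "\<And>b. 0 \<le> b \<bullet> (A *v b)" using psd_eigenbasis[OF assms] by blast
  define c where "c b = sqrt (b \<bullet> (A *v b))" for b
  define S where "S = (\<Sum>b\<in>B. c b *\<^sub>R outer b b)"
  have S: "S *v x = (\<Sum>b\<in>B. (c b * (b \<bullet> x)) *\<^sub>R b)" for x
    by (simp add: S_def sum_matrix_vector_mult scaleR_matrix_vector_assoc[symmetric] outer_mult_vec)
  have Sb: "S *v b = c b *\<^sub>R b" if "b \<in> B" for b
  proof -
    have "S *v b = (\<Sum>b'\<in>B. if b' = b then c b *\<^sub>R b else 0)"
      unfolding S using that by (intro sum.cong) (auto simp: orthonormal_basis_inner[OF B(1)])
    then show ?thesis using that B(1) by (simp add: orthonormal_basis_def)
  qed
  have "transpose S = S"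
    by (simp add: S_def vec_eq_iff transpose_def outer_def sum_component mult_ac)
  moreover have "0 \<le> x \<bullet> (S *v x)" for x
    using B(3) unfolding S inner_sum_right
    by (intro sum_nonneg) (auto simp: c_def inner_commute mult.assoc)
  moreover have "S ** S = A"
    using B(3) by (intro orthonormal_basis_matrix_eqI[OF B(1)])
     (simp add: matrix_vector_mul_assoc[symmetric] Sb B(2)[symmetric] vec.scale matrix_vector_mult_scaleR c_def)
  ultimately show ?thesis by (auto simp: psd_def)
qed

text \<open>For an eigenvector \<open>b\<close> of \<open>S\<close> with eigenvalue
  \<open>s\<close>, the vector \<open>w = T *v b - s *\<^sub>R b\<close> satisfies
  \<open>T *v w = - s *\<^sub>R w\<close>. Positivity of \<open>T\<close> excludes
  \<open>w \<noteq> 0\<close> if \<open>s > 0\<close>; if \<open>s = 0\<close>, then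
  \<open>T *v (T *v b) = 0\<close> already forces \<open>T *v b = 0\<close>.\<close>

lemma psd_sqrt_unique:
  fixes S T :: "real^'n^'n"
  assumes S: "psd S" and T: "psd T" and eq: "S ** S = T ** T"
  shows "S = T"
proof -
  obtain B where B: "orthonormal_basis B" "\<And>b. b \<in> B \<Longrightarrow> S *v b = (b \<bullet> (S *v b)) *\<^sub>R b"
    "\<And>b. 0 \<le> b \<bullet> (S *v b)" using psd_eigenbasis[OF S] by blast
  show ?thesis
  proof (rule orthonormal_basis_matrix_eqI[OF B(1)])
    fix b assume b: "b \<in> B"
    define s where "s = b \<bullet> (S *v b)"
    have Sb: "S *v b = s *\<^sub>R b" "0 \<le> s" using B b by (auto simp: s_def)
    have TT: "T *v (T *v b) = (s * s) *\<^sub>R b"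
      using arg_cong[OF eq, of "\<lambda>M. M *v b"]
      by (simp add: matrix_vector_mul_assoc[symmetric] Sb(1) matrix_vector_mult_scaleR)
    define w where "w = T *v b - s *\<^sub>R b"
    have "T *v w = - s *\<^sub>R w"
      by (simp add: w_def matrix_vector_mult_diff_distrib matrix_vector_mult_scaleR TT algebra_simps)
    moreover have "0 \<le> w \<bullet> (T *v w)" using T by (simp add: psd_def)
    ultimately have sw: "s * (w \<bullet> w) \<le> 0" by simp
    have "w = 0"
    proof (cases "s = 0")
      case True
      have "(T *v b) \<bullet> (T *v b) = b \<bullet> (T *v (T *v b))"
        using T by (intro dot_matrix_vector_mul_symmetric) (auto simp: psd_def)
      then show ?thesis using TT True by (simp add: w_def)
    next
      case False
      then show ?thesis using sw Sb(2) by (metis inner_ge_zero inner_eq_zero_iff mult_pos_pos order_le_less not_le)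
    qed
    then show "S *v b = T *v b" by (simp add: w_def Sb)
  qed
qed

lemma psd_sqrt:
  assumes "psd A" shows "psd (psd_sqrt A)" "psd_sqrt A ** psd_sqrt A = A"
proof -
  obtain S where S: "psd S" "S ** S = A" using psd_sqrt_ex[OF assms] by blast
  have "psd (psd_sqrt A) \<and> psd_sqrt A ** psd_sqrt A = A"
    unfolding psd_sqrt_def by (rule theI[of _ S]) (use S psd_sqrt_unique in \<open>auto\<close>)
  then show "psd (psd_sqrt A)" "psd_sqrt A ** psd_sqrt A = A" by auto
qed

lemma psd_sqrt_eqI: "psd S \<Longrightarrow> S ** S = A \<Longrightarrow> psd_sqrt A = S"
  unfolding psd_sqrt_def by (rule the_equality) (auto intro: psd_sqrt_unique)

section \<open>Duality of the nuclear norm\<close>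

lemma norm_matrix_vector_le_op_norm: "norm (A *v x) \<le> op_norm A * norm x"
  unfolding op_norm_def by (rule onorm) simp

lemma op_norm_nonneg: "0 \<le> op_norm A"
  unfolding op_norm_def by (rule onorm_pos_le) simp

lemma op_norm_leI: "(\<And>x. norm (A *v x) \<le> c * norm x) \<Longrightarrow> op_norm A \<le> c"
  unfolding op_norm_def by (rule onorm_le)

lemma inner_transpose: "transpose A \<bullet> transpose B = A \<bullet> (B :: real^'n^'m)"
  unfolding inner_vec_def transpose_def by (simp add: inner_vec_def) (rule sum.swap)

lemma norm_transpose: "norm (transpose A) = norm (A :: real^'n^'m)"
  by (simp add: norm_eq_sqrt_inner inner_transpose)

lemma orthonormal_basis_Basis: "orthonormal_basis Basis"
  by (auto simp: orthonormal_basis_def pairwise_def orthogonal_def inner_not_same_Basis)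

lemma dot_matrix_vector_mul_transpose:
  fixes A :: "real^'n^'m"
  shows "(A *v x) \<bullet> y = x \<bullet> (transpose A *v y)"
  by (metis dot_lmul_matrix inner_commute transpose_matrix_vector)

lemma inner_matrix_mul_left:
  fixes A :: "real^'n^'m" and X :: "real^'k^'n"
  shows "(A ** X) \<bullet> Y = X \<bullet> (transpose A ** Y)"
  by (simp add: orthonormal_basis_matrix_inner[OF orthonormal_basis_Basis] dot_matrix_vector_mul_transpose
      matrix_vector_mul_assoc[symmetric])

lemma inner_matrix_mul_right:
  fixes A :: "real^'n^'m" and X :: "real^'m^'k"
  shows "(X ** A) \<bullet> Y = X \<bullet> (Y ** transpose A)"
  using inner_matrix_mul_left[of "transpose A" "transpose X" "transpose Y"]
  by (metis inner_transpose matrix_transpose_mul transpose_transpose)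

lemma norm_transpose_mult_vec: "norm (transpose A *v x) \<le> op_norm A * norm x"
proof (cases "transpose A *v x = 0")
  case False
  have "norm (transpose A *v x) * norm (transpose A *v x) = (transpose A *v x) \<bullet> (transpose A *v x)"
    by (simp add: dot_square_norm power2_eq_square)
  also have "\<dots> = x \<bullet> (A *v (transpose A *v x))"
    using dot_matrix_vector_mul_transpose[of "transpose A" x "transpose A *v x"] by (simp only: transpose_transpose)
  also have "\<dots> \<le> norm x * norm (A *v (transpose A *v x))" by (rule norm_cauchy_schwarz)
  also have "\<dots> \<le> norm x * (op_norm A * norm (transpose A *v x))"
    by (intro mult_left_mono norm_matrix_vector_le_op_norm) auto
  finally have "norm (transpose A *v x) * norm (transpose A *v x)
      \<le> (op_norm A * norm x) * norm (transpose A *v x)"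
    by (simp add: mult_ac)
  then show ?thesis using False by (metis mult_right_le_imp_le zero_less_norm_iff)
qed (simp add: op_norm_nonneg)

lemma op_norm_transpose_le: "op_norm (transpose A) \<le> op_norm A"
  by (rule op_norm_leI) (rule norm_transpose_mult_vec)

lemma psd_gram: "psd (transpose A ** A)"
  unfolding psd_def
proof (intro conjI allI)
  show "transpose (transpose A ** A) = transpose A ** A" by (simp add: matrix_transpose_mul)
  fix x
  have "x \<bullet> ((transpose A ** A) *v x) = (A *v x) \<bullet> (A *v x)"
    by (simp add: dot_matrix_vector_mul_transpose matrix_vector_mul_assoc)
  then show "0 \<le> x \<bullet> ((transpose A ** A) *v x)" by simp
qed

text \<open>The eigenvectors of the root of \<open>transpose A ** A\<close> are right singular
  vectors of \<open>A\<close>: their images are orthogonal and have the singular values as norms.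
  This takes the place of a singular value decomposition.\<close>

lemma nuclear_norm_basis:
  fixes A :: "real^'n^'m"
  obtains B where "orthonormal_basis B" "pairwise (\<lambda>b c. (A *v b) \<bullet> (A *v c) = 0) B"
    "nuclear_norm A = (\<Sum>b\<in>B. norm (A *v b))"
proof -
  define H where "H = psd_sqrt (transpose A ** A)"
  have H: "psd H" "H ** H = transpose A ** A" using psd_sqrt[OF psd_gram] by (auto simp: H_def)
  obtain B where B: "orthonormal_basis B" "\<And>b. b \<in> B \<Longrightarrow> H *v b = (b \<bullet> (H *v b)) *\<^sub>R b"
    "\<And>b. 0 \<le> b \<bullet> (H *v b)" using psd_eigenbasis[OF H(1)] by blast
  define h where "h b = b \<bullet> (H *v b)" for b
  have Hb: "H *v b = h b *\<^sub>R b" if "b \<in> B" for b using B(2)[OF that] by (simp add: h_def)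
  have AA: "(A *v b) \<bullet> (A *v c) = (if b = c then (h b)\<^sup>2 else 0)" if "b \<in> B" "c \<in> B" for b c
  proof -
    have "(A *v b) \<bullet> (A *v c) = b \<bullet> ((H ** H) *v c)"
      by (simp add: dot_matrix_vector_mul_transpose matrix_vector_mul_assoc H)
    then show ?thesis
      using that by (simp add: matrix_vector_mul_assoc[symmetric] Hb matrix_vector_mult_scaleR
          orthonormal_basis_inner[OF B(1)] power2_eq_square)
  qed
  have "norm (A *v b) = h b" if "b \<in> B" for b
    using AA[OF that that] B(3)[of b] by (simp add: norm_eq_sqrt_inner h_def)
  then have "nuclear_norm A = (\<Sum>b\<in>B. norm (A *v b))"
    by (simp add: nuclear_norm_def H_def[symmetric] orthonormal_basis_trace[OF B(1)] h_def)
  with B(1) AA show ?thesis by (intro that[of B]) (auto simp: pairwise_def)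
qed

lemma inner_le_op_norm_nuclear_norm:
  fixes A C :: "real^'n^'m"
  shows "A \<bullet> C \<le> op_norm C * nuclear_norm A"
proof -
  obtain B where B: "orthonormal_basis B" "nuclear_norm A = (\<Sum>b\<in>B. norm (A *v b))"
    using nuclear_norm_basis by blast
  have "A \<bullet> C = (\<Sum>b\<in>B. (A *v b) \<bullet> (C *v b))" by (rule orthonormal_basis_matrix_inner[OF B(1)])
  also have "\<dots> \<le> (\<Sum>b\<in>B. norm (A *v b) * op_norm C)"
  proof (rule sum_mono)
    fix b assume b: "b \<in> B"
    have "(A *v b) \<bullet> (C *v b) \<le> norm (A *v b) * norm (C *v b)" by (rule norm_cauchy_schwarz)
    also have "\<dots> \<le> norm (A *v b) * op_norm C"
      using norm_matrix_vector_le_op_norm[of C b] b B(1)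
      by (intro mult_left_mono) (auto simp: orthonormal_basis_def)
    finally show "(A *v b) \<bullet> (C *v b) \<le> norm (A *v b) * op_norm C" .
  qed
  finally show ?thesis by (simp add: B sum_distrib_left mult.commute)
qed

text \<open>\<open>G\<close> is the polar factor of \<open>A\<close>: it sends each right singular
  vector to its normalised image. Since \<open>sgn 0 = 0\<close>, the vectors in the kernel go to 0,
  so \<open>G\<close> is a partial isometry.\<close>

lemma nuclear_norm_attained:
  fixes A :: "real^'n^'m"
  obtains G where "op_norm G \<le> 1" "A \<bullet> G = nuclear_norm A"
proof -
  obtain B where B: "orthonormal_basis B" "pairwise (\<lambda>b c. (A *v b) \<bullet> (A *v c) = 0) B"
    "nuclear_norm A = (\<Sum>b\<in>B. norm (A *v b))"
    using nuclear_norm_basis by blast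
  have fin: "finite B" using B(1) by (simp add: orthonormal_basis_def)
  define G where "G = (\<Sum>b\<in>B. outer (sgn (A *v b)) b)"
  have G: "G *v x = (\<Sum>b\<in>B. (b \<bullet> x) *\<^sub>R sgn (A *v b))" for x
    by (simp add: G_def sum_matrix_vector_mult outer_mult_vec)
  have Gb: "G *v b = sgn (A *v b)" if "b \<in> B" for b
  proof -
    have "G *v b = (\<Sum>b'\<in>B. if b' = b then sgn (A *v b) else 0)"
      unfolding G using that by (intro sum.cong) (auto simp: orthonormal_basis_inner[OF B(1)])
    then show ?thesis using that fin by simp
  qed
  have "op_norm G \<le> 1"
  proof (rule op_norm_leI)
    fix x
    have "(norm (G *v x))\<^sup>2 = (\<Sum>b\<in>B. (norm ((b \<bullet> x) *\<^sub>R sgn (A *v b)))\<^sup>2)"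
      unfolding G using fin B(2)
      by (intro norm_sum_Pythagorean) (auto simp: pairwise_def orthogonal_def sgn_div_norm)
    also have "\<dots> \<le> (\<Sum>b\<in>B. (x \<bullet> b) * (x \<bullet> b))"
      by (intro sum_mono) (auto simp: norm_sgn power2_eq_square inner_commute)
    also have "\<dots> = (norm x)\<^sup>2"
      by (simp add: orthonormal_basis_parseval[OF B(1), symmetric] dot_square_norm)
    finally show "norm (G *v x) \<le> 1 * norm x" by (simp add: power2_le_iff_abs_le)
  qed
  moreover have "A \<bullet> G = nuclear_norm A"
  proof -
    have "v \<bullet> sgn v = norm v" for v :: "real^'m"
      by (cases "v = 0") (simp_all add: sgn_div_norm dot_square_norm power2_eq_square field_simps)
    then show ?thesis
      by (simp add: orthonormal_basis_matrix_inner[OF B(1)] Gb B(3))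
  qed
  ultimately show ?thesis using that by blast
qed

text \<open>By duality the nuclear norm is a maximum of linear functionals over the operator-norm
  unit ball. The \<open>G\<close> that attains it at the combination bounds both summands from
  below.\<close>

lemma nuclear_norm_convex:
  fixes A C :: "real^'n^'m"
  assumes "0 \<le> s" "0 \<le> t"
  shows "nuclear_norm (s *\<^sub>R A + t *\<^sub>R C) \<le> s * nuclear_norm A + t * nuclear_norm C"
proof -
  obtain G where G: "op_norm G \<le> 1" "(s *\<^sub>R A + t *\<^sub>R C) \<bullet> G = nuclear_norm (s *\<^sub>R A + t *\<^sub>R C)"
    using nuclear_norm_attained by blast
  have le: "D \<bullet> G \<le> nuclear_norm D" for D
  proof -
    obtain B where "nuclear_norm D = (\<Sum>b\<in>B. norm (D *v b))" using nuclear_norm_basis by blast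
    then have "0 \<le> nuclear_norm D" by (simp add: sum_nonneg)
    then show ?thesis
      using inner_le_op_norm_nuclear_norm[of D G] mult_right_mono[OF G(1), of "nuclear_norm D"] by simp
  qed
  show ?thesis
    unfolding G(2)[symmetric] using assms le[of A] le[of C]
    by (auto simp: inner_add_left intro!: add_mono mult_left_mono)
qed

lemma nuclear_norm_psd: "psd A \<Longrightarrow> nuclear_norm A = trace A"
  by (simp add: nuclear_norm_def psd_def psd_sqrt_eqI)

section \<open>Nuclear norm penalisation of a low-rank matrix\<close>

text \<open>First-order optimality: \<open>2 *\<^sub>R (C - R0)\<close> is a subgradient of the
  penalty at \<open>R0\<close>. The minimiser is compared with the points of the segment towards
  \<open>R\<close>; the difference is divided by \<open>t\<close>, and \<open>t\<close> tends to
  0.\<close>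

lemma nuclear_prox_variational:
  fixes C R0 R :: "real^'n^'m"
  assumes "is_arg_min (\<lambda>R. (norm (R - C))\<^sup>2 + lam * nuclear_norm R) (\<lambda>_. True) R0" "0 \<le> lam"
  shows "2 * ((C - R0) \<bullet> (R - R0)) \<le> lam * (nuclear_norm R - nuclear_norm R0)"
proof -
  define a where "a = lam * (nuclear_norm R - nuclear_norm R0) - 2 * ((C - R0) \<bullet> (R - R0))"
  define q where "q = (norm (R - R0))\<^sup>2"
  have sq: "(norm (x + t *\<^sub>R y))\<^sup>2 = (norm x)\<^sup>2 + 2 * t * (x \<bullet> y) + t\<^sup>2 * (norm y)\<^sup>2"
    for x y :: "real^'n^'m" and t
    unfolding power2_norm_eq_inner
    by (simp add: inner_add_left inner_add_right inner_commute[of y x] power2_eq_square distrib_left)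
  have ge: "0 \<le> a + t * q" if t: "0 < t" "t < 1" for t
  proof -
    have "(norm (R0 - C))\<^sup>2 + lam * nuclear_norm R0
       \<le> (norm (((1 - t) *\<^sub>R R0 + t *\<^sub>R R) - C))\<^sup>2 + lam * nuclear_norm ((1 - t) *\<^sub>R R0 + t *\<^sub>R R)"
      using assms(1) by (auto simp: is_arg_min_linorder)
    also have "lam * nuclear_norm ((1 - t) *\<^sub>R R0 + t *\<^sub>R R)
        \<le> lam * ((1 - t) * nuclear_norm R0 + t * nuclear_norm R)"
      using assms(2) t by (intro mult_left_mono nuclear_norm_convex) auto
    also have "((1 - t) *\<^sub>R R0 + t *\<^sub>R R) - C = (R0 - C) + t *\<^sub>R (R - R0)" by (simp add: algebra_simps)
    also have "(norm ((R0 - C) + t *\<^sub>R (R - R0)))\<^sup>2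
        = (norm (R0 - C))\<^sup>2 - 2 * t * ((C - R0) \<bullet> (R - R0)) + t\<^sup>2 * q"
      using sq[of "R0 - C" t "R - R0"] by (simp add: q_def inner_diff_left right_diff_distrib)
    finally have "0 \<le> t * (a + t * q)"
      by (simp add: a_def algebra_simps power2_eq_square)
    then show ?thesis using t by (simp add: zero_le_mult_iff)
  qed
  have "((\<lambda>t. a + t * q) \<longlongrightarrow> a + 0 * q) (at_right 0)" by (intro tendsto_intros)
  moreover have "eventually (\<lambda>t. 0 \<le> a + t * q) (at_right 0)"
    unfolding eventually_at_right[OF zero_less_one] by (intro exI[of _ 1]) (auto intro: ge)
  ultimately have "0 \<le> a + 0 * q" by (intro tendsto_lowerbound) auto
  then show ?thesis by (simp add: a_def)
qed

text \<open>Adding the two variational inequalities, each tested at the other minimiser, cancels the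
  penalty. This is what later yields measurability of the event, as the estimator is given only
  pointwise as a minimiser.\<close>

lemma nuclear_prox_nonexpansive:
  fixes C C' R R' :: "real^'n^'m"
  assumes "is_arg_min (\<lambda>R. (norm (R - C))\<^sup>2 + lam * nuclear_norm R) (\<lambda>_. True) R"
    and "is_arg_min (\<lambda>R. (norm (R - C'))\<^sup>2 + lam * nuclear_norm R) (\<lambda>_. True) R'" and "0 \<le> lam"
  shows "norm (R - R') \<le> norm (C - C')"
proof -
  have "2 * ((C - R) \<bullet> (R' - R)) + 2 * ((C' - R') \<bullet> (R - R')) \<le> 0"
    using nuclear_prox_variational[OF assms(1,3), of R'] nuclear_prox_variational[OF assms(2,3), of R]
    by (simp add: algebra_simps)
  then have "(R - R') \<bullet> (R - R') \<le> (C - C') \<bullet> (R - R')"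
    by (simp add: inner_diff_left inner_diff_right inner_commute[of R' R] inner_commute[of R' C] inner_commute[of R' C'])
  also have "\<dots> \<le> norm (C - C') * norm (R - R')" by (rule norm_cauchy_schwarz)
  finally have "norm (R - R') * norm (R - R') \<le> norm (C - C') * norm (R - R')"
    by (simp add: dot_square_norm power2_eq_square)
  then show ?thesis
    by (cases "R = R'") (simp, metis mult_right_le_imp_le right_minus_eq zero_less_norm_iff)
qed

section \<open>Orthogonal projections and the error bound for a low-rank target\<close>

definition orth_proj :: "real^'n^'n \<Rightarrow> bool" where
  "orth_proj P \<longleftrightarrow> transpose P = P \<and> P ** P = P"

lemma matrix_mul_add_left: "(A + B) ** C = A ** C + B ** (C :: real^'n^'m)"
  by (simp add: matrix_matrix_mult_def vec_eq_iff sum.distrib distrib_right)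

lemma matrix_mul_diff_left: "(A - B) ** C = A ** C - B ** (C :: real^'n^'m)"
  by (simp add: matrix_matrix_mult_def vec_eq_iff sum_subtractf left_diff_distrib)

lemma matrix_mul_diff_right: "C ** (A - B) = C ** A - C ** (B :: real^'n^'m)"
  by (simp add: matrix_matrix_mult_def vec_eq_iff sum_subtractf right_diff_distrib)

lemma sum_matrix_mul_left: "(\<Sum>j\<in>J. A j) ** B = (\<Sum>j\<in>J. A j ** (B :: real^'n^'m))"
  by (induction J rule: infinite_finite_induct) (auto simp: matrix_mul_add_left)

lemma sum_matrix_mul_right: "B ** (\<Sum>j\<in>J. A j) = (\<Sum>j\<in>J. B ** (A j :: real^'n^'m))"
  by (induction J rule: infinite_finite_induct) (auto simp: matrix_add_ldistrib)

lemma scaleR_matrix_mul_left: "(c *\<^sub>R A) ** B = c *\<^sub>R (A ** (B :: real^'n^'m))"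
  by (simp add: vec_eq_iff matrix_matrix_mult_def sum_distrib_left mult_ac)

lemma scaleR_matrix_mul_right: "A ** (c *\<^sub>R B) = c *\<^sub>R (A ** (B :: real^'n^'m))"
  by (simp add: vec_eq_iff matrix_matrix_mult_def sum_distrib_left mult_ac)

lemma matrix_mul_outer:
  fixes A :: "real^'m^'k"
  shows "A ** outer x y = outer (A *v x) y"
  by (simp add: matrix_matrix_mult_def outer_def matrix_vector_mult_def vec_eq_iff sum_distrib_left mult_ac)

lemma outer_matrix_mul:
  fixes A :: "real^'k^'n"
  shows "outer x y ** A = outer x (transpose A *v y)"
  by (simp add: matrix_matrix_mult_def outer_def matrix_vector_mult_def vec_eq_iff sum_distrib_left
      transpose_def mult_ac)

lemma transpose_diff: "transpose (A - B) = transpose A - transpose (B :: real^'n^'m)"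
  by (simp add: transpose_def vec_eq_iff)

lemma orth_proj_compl: "orth_proj P \<Longrightarrow> orth_proj (mat 1 - P)"
  by (simp add: orth_proj_def transpose_diff matrix_mul_diff_left matrix_mul_diff_right)

lemma orth_proj_pythagoras:
  fixes P :: "real^'n^'n" and X :: "real^'m^'n"
  assumes "orth_proj P"
  shows "(norm (P ** X + (mat 1 - P) ** Y))\<^sup>2 = (norm (P ** X))\<^sup>2 + (norm ((mat 1 - P) ** Y))\<^sup>2"
proof -
  have "(P ** X) \<bullet> ((mat 1 - P) ** Y) = X \<bullet> ((P ** (mat 1 - P)) ** Y)"
    using assms by (simp add: inner_matrix_mul_left orth_proj_def matrix_mul_assoc)
  also have "\<dots> = 0" using assms by (simp add: matrix_mul_diff_right orth_proj_def)
  finally have 0: "(P ** X) \<bullet> ((mat 1 - P) ** Y) = 0" .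
  show ?thesis unfolding power2_norm_eq_inner inner_add_left inner_add_right
    using 0 inner_commute[of "P ** X" "(mat 1 - P) ** Y"] by linarith
qed

lemma orth_proj_vec_pythagoras:
  fixes P :: "real^'n^'n"
  assumes "orth_proj P"
  shows "(norm (P *v x + (mat 1 - P) *v y))\<^sup>2 = (norm (P *v x))\<^sup>2 + (norm ((mat 1 - P) *v y))\<^sup>2"
proof -
  have "(P *v x) \<bullet> ((mat 1 - P) *v y) = x \<bullet> ((P ** (mat 1 - P)) *v y)"
    using assms by (simp add: dot_matrix_vector_mul_transpose orth_proj_def matrix_vector_mul_assoc)
  also have "\<dots> = 0" using assms by (simp add: matrix_mul_diff_right orth_proj_def)
  finally have 0: "(P *v x) \<bullet> ((mat 1 - P) *v y) = 0" .
  show ?thesis unfolding power2_norm_eq_inner inner_add_left inner_add_right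
    using 0 inner_commute[of "P *v x" "(mat 1 - P) *v y"] by linarith
qed

lemma orth_proj_norm_split:
  fixes P :: "real^'n^'n"
  assumes "orth_proj P"
  shows "(norm x)\<^sup>2 = (norm (P *v x))\<^sup>2 + (norm ((mat 1 - P) *v x))\<^sup>2"
proof -
  have "P *v x + (mat 1 - P) *v x = x" by (simp add: matrix_vector_mult_diff_rdistrib)
  then show ?thesis using orth_proj_vec_pythagoras[OF assms, of x x] by simp
qed

lemma orth_proj_norm_le:
  fixes P :: "real^'n^'n"
  assumes "orth_proj P"
  shows "norm (P *v x) \<le> norm x"
  using orth_proj_norm_split[OF assms, of x] by - (rule power2_le_imp_le, simp_all)

lemma orth_proj_norm_mult_le:
  fixes P :: "real^'n^'n" and X :: "real^'m^'n"
  assumes "orth_proj P"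
  shows "norm (P ** X) \<le> norm X"
proof -
  have "P ** X + (mat 1 - P) ** X = X" by (simp add: matrix_mul_diff_left)
  then have "(norm X)\<^sup>2 = (norm (P ** X))\<^sup>2 + (norm ((mat 1 - P) ** X))\<^sup>2"
    using orth_proj_pythagoras[OF assms, of X X] by simp
  then show ?thesis by - (rule power2_le_imp_le, simp_all)
qed

lemma orth_proj_norm_mult_right_le:
  fixes P :: "real^'n^'n" and X :: "real^'n^'m"
  assumes "orth_proj P"
  shows "norm (X ** P) \<le> norm X"
proof -
  have "transpose (X ** P) = P ** transpose X" using assms by (simp add: matrix_transpose_mul orth_proj_def)
  then show ?thesis
    using orth_proj_norm_mult_le[OF assms, of "transpose X"] norm_transpose[of "X ** P"] norm_transpose[of X]
    by simp
qed

lemma inner_outer_left: "outer x y \<bullet> A = x \<bullet> (A *v y)"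
  by (simp add: inner_vec_def outer_def matrix_vector_mult_def sum_distrib_left mult_ac)

text \<open>The squared Frobenius norm of \<open>P ** E\<close> is the sum of the squared norms of
  \<open>transpose E *v b\<close> over an orthonormal basis of the span, and such a basis has at
  most \<open>K\<close> elements.\<close>

lemma orth_proj_onto_span:
  fixes f :: "nat \<Rightarrow> real^'n"
  obtains P where "orth_proj P" "\<And>j. j \<in> {1..K} \<Longrightarrow> P *v f j = f j"
    "\<And>E :: real^'m^'n. (norm (P ** E))\<^sup>2 \<le> real K * (op_norm E)\<^sup>2"
proof -
  obtain B where "B \<subseteq> span (f ` {1..K})" and B: "pairwise orthogonal B" "\<And>x. x \<in> B \<Longrightarrow> norm x = 1" "independent B"
    "card B = dim (span (f ` {1..K}))" "span B = span (f ` {1..K})"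
    by (rule orthonormal_basis_subspace[OF subspace_span[of "f ` {1..K}"]]) (rule that, assumption+)
  have fin: "finite B" using B(3) by (rule independent_imp_finite)
  have "card B \<le> card (f ` {1..K})" using B(4) by (simp add: dim_le_card')
  also have "\<dots> \<le> K" using card_image_le[of "{1..K}" f] by simp
  finally have cardB: "card B \<le> K" .
  define P where "P = (\<Sum>b\<in>B. outer b b)"
  have Px: "P *v x = (\<Sum>b\<in>B. (x \<bullet> b) *\<^sub>R b)" for x
    by (simp add: P_def sum_matrix_vector_mult outer_mult_vec inner_commute)
  have Pid: "P *v x = x" if "x \<in> span B" for x
    unfolding Px using orthonormal_basis_expand[OF B(1,2) that fin] by simp
  have "transpose P = P" by (simp add: P_def vec_eq_iff transpose_def outer_def sum_component mult_ac)
  moreover have "P ** P = P"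
  proof -
    have "P *v x \<in> span B" for x unfolding Px by (intro span_sum span_scale span_base)
    then have "P *v (P *v x) = P *v x" for x by (rule Pid)
    then show ?thesis by (simp add: matrix_eq matrix_vector_mul_assoc)
  qed
  ultimately have proj: "orth_proj P" by (simp add: orth_proj_def)
  have PK: "(norm (P ** E))\<^sup>2 \<le> real K * (op_norm E)\<^sup>2" for E :: "real^'m^'n"
  proof -
    have PE: "P ** (P ** E) = P ** E" using proj by (simp add: orth_proj_def matrix_mul_assoc)
    have "(norm (P ** E))\<^sup>2 = (P ** E) \<bullet> E"
      unfolding power2_norm_eq_inner inner_matrix_mul_left[of P E "P ** E"]
      using proj PE by (simp add: orth_proj_def inner_commute)
    also have "\<dots> = (\<Sum>b\<in>B. outer b b \<bullet> (E ** transpose E))"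
      unfolding inner_matrix_mul_right[of P E E] by (simp add: P_def inner_sum_left)
    also have "\<dots> \<le> (\<Sum>b\<in>B. (op_norm E)\<^sup>2)"
    proof (rule sum_mono)
      fix b assume b: "b \<in> B"
      have "outer b b \<bullet> (E ** transpose E) = b \<bullet> (E *v (transpose E *v b))"
        by (simp only: inner_outer_left matrix_vector_mul_assoc)
      also have "\<dots> = (norm (transpose E *v b))\<^sup>2"
        unfolding power2_norm_eq_inner
        using dot_matrix_vector_mul_transpose[of "transpose E" b "transpose E *v b"]
        by (simp only: transpose_transpose)
      also have "\<dots> \<le> (op_norm E)\<^sup>2"
        using norm_transpose_mult_vec[of E b] B(2)[OF b] by (intro power_mono) auto
      finally show "outer b b \<bullet> (E ** transpose E) \<le> (op_norm E)\<^sup>2" .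
    qed
    also have "\<dots> \<le> real K * (op_norm E)\<^sup>2"
      using cardB by (simp add: mult_right_mono)
    finally show ?thesis .
  qed
  have Pf: "P *v f j = f j" if "j \<in> {1..K}" for j
    using that by (intro Pid) (auto simp: B(5) intro: span_base)
  show ?thesis by (rule that[OF proj Pf PK])
qed

text \<open>The error \<open>D\<close> is split by the spans of the \<open>f j\<close> and the
  \<open>g j\<close>. On the part \<open>Dp\<close> outside both spans the penalty dominates the
  noise, since \<open>op_norm E\<close> is at most \<open>lam / 2\<close>. On the rest the noise and
  the subgradient of the penalty are estimated in Frobenius norm; they contribute
  \<open>sqrt 2\<close> and \<open>1\<close> to the factor \<open>1 + sqrt 2\<close>.\<close>

lemma nuclear_prox_low_rank_bound:
  fixes C Ch R0 :: "real^'n^'m" and f :: "nat \<Rightarrow> real^'m" and g :: "nat \<Rightarrow> real^'n"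
  assumes amin: "is_arg_min (\<lambda>R. (norm (R - Ch))\<^sup>2 + lam * nuclear_norm R) (\<lambda>_. True) R0"
    and "0 \<le> lam" and C: "C = (\<Sum>j=1..K. outer (f j) (g j))" and E: "op_norm (Ch - C) \<le> lam / 2"
  shows "norm (R0 - C) \<le> (1 + sqrt 2) / 2 * lam * sqrt (real K)"
proof -
  obtain P where P: "orth_proj P" "\<And>j. j \<in> {1..K} \<Longrightarrow> P *v f j = f j"
    "\<And>E :: real^'n^'m. (norm (P ** E))\<^sup>2 \<le> real K * (op_norm E)\<^sup>2"
    using orth_proj_onto_span[of K f, where 'm = 'n] by blast
  obtain Q where Q: "orth_proj Q" "\<And>j. j \<in> {1..K} \<Longrightarrow> Q *v g j = g j"
    "\<And>E :: real^'m^'n. (norm (Q ** E))\<^sup>2 \<le> real K * (op_norm E)\<^sup>2"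
    using orth_proj_onto_span[of K g, where 'm = 'm] by blast
  define P' where "P' = mat 1 - P"
  define Q' where "Q' = mat 1 - Q"
  have P': "orth_proj P'" and Q': "orth_proj Q'" using orth_proj_compl P(1) Q(1) by (auto simp: P'_def Q'_def)
  note tr = P(1)[unfolded orth_proj_def] Q(1)[unfolded orth_proj_def]
    P'[unfolded orth_proj_def] Q'[unfolded orth_proj_def]
  define D where "D = R0 - C"
  define E where "E = Ch - C"
  have PC: "P ** C = C" unfolding C sum_matrix_mul_right matrix_mul_outer using P(2) by simp
  have CQ: "C ** Q = C" unfolding C sum_matrix_mul_left outer_matrix_mul using Q(2) tr by simp
  have P'C: "P' ** C = 0" using PC by (simp add: P'_def matrix_mul_diff_left)

  obtain G where G: "op_norm G \<le> 1" "C \<bullet> G = nuclear_norm C" using nuclear_norm_attained by blast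
  define Dp where "Dp = P' ** D ** Q'"
  obtain H where H: "op_norm H \<le> 1" "Dp \<bullet> H = nuclear_norm Dp" using nuclear_norm_attained by blast
  \<comment> \<open>\<open>G1\<close> acts between the spans and \<open>H1\<close> between their
    complements. The sum is a subgradient of the nuclear norm at \<open>C\<close>, and its pairing
    with \<open>D\<close> contains all of \<open>nuclear_norm Dp\<close>.\<close>
  define G1 where "G1 = P ** G ** Q"
  define H1 where "H1 = P' ** H ** Q'"
  have inner_sandwich: "(A ** X ** B) \<bullet> Y = X \<bullet> (A ** Y ** B)"
    if "transpose A = A" "transpose B = B" for A :: "real^'m^'m" and B :: "real^'n^'n" and X Y
    using that inner_matrix_mul_right[of "A ** X" B Y] inner_matrix_mul_left[of A X "Y ** B"]
    by (simp add: matrix_mul_assoc)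
  have CG1: "C \<bullet> G1 = nuclear_norm C"
    using tr inner_sandwich[of P Q C G] by (simp add: G1_def PC CQ G)
  have CH1: "C \<bullet> H1 = 0" using tr inner_sandwich[of P' Q' C H] by (simp add: H1_def P'C)
  have DH1: "D \<bullet> H1 = nuclear_norm Dp"
    using tr inner_sandwich[of P' Q' D H] by (simp add: H1_def H Dp_def[symmetric])
  \<comment> \<open>The two summands have orthogonal ranges and act on orthogonal components of
    \<open>x\<close>, so their squared norms add up without loss.\<close>
  have "op_norm (G1 + H1) \<le> 1"
  proof (rule op_norm_leI)
    fix x
    have le1: "norm (A *v y) \<le> norm y" if "op_norm A \<le> 1" for A :: "real^'n^'m" and y
      using norm_matrix_vector_le_op_norm[of A y] mult_right_mono[OF that, of "norm y"] by simp
    have "(norm ((G1 + H1) *v x))\<^sup>2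
        = (norm (P *v (G *v (Q *v x)) + (mat 1 - P) *v (H *v (Q' *v x))))\<^sup>2"
      by (simp add: G1_def H1_def P'_def[symmetric] matrix_vector_mult_add_rdistrib
          matrix_vector_mul_assoc matrix_mul_assoc)
    also have "\<dots> = (norm (P *v (G *v (Q *v x))))\<^sup>2 + (norm (P' *v (H *v (Q' *v x))))\<^sup>2"
      unfolding P'_def by (rule orth_proj_vec_pythagoras[OF P(1)])
    also have "\<dots> \<le> (norm (Q *v x))\<^sup>2 + (norm (Q' *v x))\<^sup>2"
      by (intro add_mono power_mono order_trans[OF orth_proj_norm_le le1] P(1) P' G H) auto
    also have "\<dots> = (norm x)\<^sup>2" using orth_proj_norm_split[OF Q(1), of x] by (simp add: Q'_def)
    finally show "norm ((G1 + H1) *v x) \<le> 1 * norm x" by (simp add: power2_le_iff_abs_le)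
  qed
  moreover have nn: "0 \<le> nuclear_norm A" for A :: "real^'n^'m"
  proof -
    obtain B where "nuclear_norm A = (\<Sum>b\<in>B. norm (A *v b))" using nuclear_norm_basis by blast
    then show ?thesis by (simp add: sum_nonneg)
  qed
  ultimately have "R0 \<bullet> (G1 + H1) \<le> 1 * nuclear_norm R0"
    by (intro order_trans[OF inner_le_op_norm_nuclear_norm] mult_right_mono)
  moreover have "R0 \<bullet> (G1 + H1) = C \<bullet> G1 + C \<bullet> H1 + D \<bullet> G1 + D \<bullet> H1"
    by (simp add: D_def inner_diff_left inner_add_right)
  ultimately have low: "nuclear_norm C + D \<bullet> G1 + nuclear_norm Dp \<le> nuclear_norm R0"
    by (simp add: CG1 CH1 DH1)
  have "2 * ((Ch - R0) \<bullet> (C - R0)) \<le> lam * (nuclear_norm C - nuclear_norm R0)"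
    by (rule nuclear_prox_variational[OF amin \<open>0 \<le> lam\<close>])
  also have "\<dots> \<le> lam * (- (D \<bullet> G1) - nuclear_norm Dp)"
    using low \<open>0 \<le> lam\<close> by (intro mult_left_mono) auto
  also have "(Ch - R0) \<bullet> (C - R0) = D \<bullet> D - D \<bullet> E"
  proof -
    have "Ch - R0 = E - D" "C - R0 = - D" by (auto simp: D_def E_def)
    then show ?thesis by (simp add: inner_diff_left inner_commute[of E D])
  qed
  finally have 1: "2 * (D \<bullet> D) \<le> 2 * (D \<bullet> E) - lam * (D \<bullet> G1) - lam * nuclear_norm Dp"
    by (simp add: algebra_simps)
  have opE: "op_norm E \<le> lam / 2" using assms(4) by (simp add: E_def)
  \<comment> \<open>\<open>F\<close> is \<open>E\<close> without its outer block
    \<open>P' ** E ** Q'\<close>. Written as these two terms it is a sum of orthogonal matrices,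
    each bounded through a projection of rank at most \<open>K\<close>; this gives
    \<open>sqrt 2 / 2\<close> where the triangle inequality would give 1.\<close>
  define F where "F = P ** E + P' ** (E ** Q)"
  have "D \<bullet> E = D \<bullet> F + Dp \<bullet> E"
  proof -
    have "P' ** E ** Q' = E - F"
      by (simp add: F_def P'_def Q'_def matrix_mul_diff_left matrix_mul_diff_right matrix_mul_assoc)
    moreover have "Dp \<bullet> E = D \<bullet> (P' ** E ** Q')"
      unfolding Dp_def using tr by (intro inner_sandwich) auto
    ultimately show ?thesis by (simp add: inner_diff_right)
  qed
  moreover have "Dp \<bullet> E \<le> lam / 2 * nuclear_norm Dp"
    using inner_le_op_norm_nuclear_norm[of Dp E] mult_right_mono[OF opE nn[of Dp]] by linarith
  ultimately have 2: "2 * (D \<bullet> D) \<le> 2 * (D \<bullet> F) - lam * (D \<bullet> G1)"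
    using 1 by simp
  have "(norm F)\<^sup>2 = (norm (P ** E))\<^sup>2 + (norm (P' ** (E ** Q)))\<^sup>2"
    unfolding F_def P'_def by (rule orth_proj_pythagoras[OF P(1)])
  also have "\<dots> \<le> real K * (lam / 2)\<^sup>2 + real K * (lam / 2)\<^sup>2"
  proof (rule add_mono)
    have sq: "(op_norm E)\<^sup>2 \<le> (lam / 2)\<^sup>2" using opE op_norm_nonneg by (intro power_mono) auto
    show "(norm (P ** E))\<^sup>2 \<le> real K * (lam / 2)\<^sup>2"
      by (rule order_trans[OF P(3)]) (use sq in \<open>auto intro: mult_left_mono\<close>)
    have "norm (E ** Q) = norm (Q ** transpose E)"
      using tr by (metis matrix_transpose_mul norm_transpose)
    then have "(norm (P' ** (E ** Q)))\<^sup>2 \<le> (norm (Q ** transpose E))\<^sup>2"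
      using orth_proj_norm_mult_le[OF P', of "E ** Q"] by (intro power_mono) auto
    also have "\<dots> \<le> real K * (op_norm (transpose E))\<^sup>2" by (rule Q(3))
    also have "\<dots> \<le> real K * (lam / 2)\<^sup>2"
      using op_norm_transpose_le[of E] opE op_norm_nonneg[of "transpose E"]
      by (intro mult_left_mono power_mono) auto
    finally show "(norm (P' ** (E ** Q)))\<^sup>2 \<le> real K * (lam / 2)\<^sup>2" .
  qed
  also have "\<dots> = (sqrt 2 / 2 * lam * sqrt (real K))\<^sup>2" by (simp add: power_mult_distrib power_divide)
  finally have F: "norm F \<le> sqrt 2 / 2 * lam * sqrt (real K)"
    using \<open>0 \<le> lam\<close> by - (rule power2_le_imp_le, auto)
  have "(norm G1)\<^sup>2 \<le> (norm (P ** G))\<^sup>2"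
    unfolding G1_def using orth_proj_norm_mult_right_le[OF Q(1), of "P ** G"] by (intro power_mono) auto
  also have "\<dots> \<le> real K * (op_norm G)\<^sup>2" by (rule P(3))
  also have "\<dots> \<le> real K * 1\<^sup>2" using G op_norm_nonneg[of G] by (intro mult_left_mono power_mono) auto
  also have "\<dots> = (sqrt (real K))\<^sup>2" by simp
  finally have G1: "norm G1 \<le> sqrt (real K)" by - (rule power2_le_imp_le, auto)
  have "norm D * norm D * 2 \<le> norm D * ((1 + sqrt 2) * lam * sqrt (real K))"
  proof -
    have "D \<bullet> F \<le> norm D * (sqrt 2 / 2 * lam * sqrt (real K))"
      by (rule order_trans[OF norm_cauchy_schwarz mult_left_mono[OF F norm_ge_zero]])
    moreover have "- (D \<bullet> G1) \<le> norm D * sqrt (real K)"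
      using norm_cauchy_schwarz[of "- D" G1] mult_left_mono[OF G1, of "norm D"] by simp
    then have "lam * (- (D \<bullet> G1)) \<le> lam * (norm D * sqrt (real K))"
      using \<open>0 \<le> lam\<close> by (rule mult_left_mono)
    ultimately have "2 * (D \<bullet> D) \<le> 2 * (norm D * (sqrt 2 / 2 * lam * sqrt (real K))) + lam * (norm D * sqrt (real K))"
      using 2 by simp
    then show ?thesis by (simp add: dot_square_norm power2_eq_square algebra_simps)
  qed
  then have "norm D * 2 \<le> (1 + sqrt 2) * lam * sqrt (real K)"
    using \<open>0 \<le> lam\<close> by (cases "D = 0") (auto simp: mult.assoc)
  then show ?thesis by (simp add: D_def)
qed

section \<open>The standard Gaussian measure\<close>

definition gauss_density :: "'a::euclidean_space \<Rightarrow> real" where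
  "gauss_density x = (1 / sqrt (2 * pi)) ^ DIM('a) * exp (- (norm x)\<^sup>2 / 2)"

definition gauss :: "'a::euclidean_space measure" where
  "gauss = density lborel (\<lambda>x. ennreal (gauss_density x))"

lemma gauss_density_nonneg: "0 \<le> gauss_density x"
  by (simp add: gauss_density_def)

lemma borel_measurable_gauss_density[measurable]: "gauss_density \<in> borel_measurable borel"
  unfolding gauss_density_def by measurable

lemma sets_gauss[simp, measurable_cong]: "sets gauss = sets borel"
  by (simp add: gauss_def)

lemma space_gauss[simp]: "space gauss = UNIV"
  by (simp add: gauss_def)

lemma norm_square_Basis: "(norm x)\<^sup>2 = (\<Sum>b\<in>Basis. (x \<bullet> b)\<^sup>2)"
  unfolding power2_norm_eq_inner by (subst euclidean_inner) (simp add: power2_eq_square)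

lemma gauss_density_prod:
  fixes x :: "'a::euclidean_space"
  shows "gauss_density x = (\<Prod>b\<in>Basis. std_normal_density (x \<bullet> b))"
proof -
  show ?thesis
    by (simp add: norm_square_Basis[of x] gauss_density_def std_normal_density_def prod.distrib exp_sum[symmetric]
        sum_negf[symmetric] sum_divide_distrib prod_dividef power_divide)
qed

lemma prob_space_gauss: "prob_space (gauss :: 'a::euclidean_space measure)"
proof
  have 1: "(\<integral>\<^sup>+x. ennreal (std_normal_density x) \<partial>lborel) = 1"
    using prob_space.emeasure_space_1[OF prob_space_normal_density[of 1 0]]
    by (simp add: emeasure_density)
  have "emeasure (gauss :: 'a measure) (space gauss) = (\<integral>\<^sup>+x. ennreal (gauss_density (x :: 'a)) \<partial>lborel)"
    by (simp add: gauss_def emeasure_density)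
  also have "\<dots> = (\<integral>\<^sup>+x. (\<Prod>b\<in>Basis. ennreal (std_normal_density ((x :: 'a) \<bullet> b))) \<partial>lborel)"
    by (simp add: gauss_density_prod prod_ennreal)
  also have "\<dots> = 1" by (subst nn_integral_lborel_prod) (simp_all add: 1)
  finally show "emeasure (gauss :: 'a measure) (space gauss) = 1" .
qed

interpretation gauss: prob_space gauss by (rule prob_space_gauss)

lemma emeasure_gauss_UNIV[simp]: "emeasure gauss UNIV = 1"
  using gauss.emeasure_space_1 by simp

lemma measure_gauss_UNIV[simp]: "measure gauss UNIV = 1"
  using gauss.prob_space by simp

lemma nn_integral_gauss:
  "h \<in> borel_measurable borel \<Longrightarrow> (\<integral>\<^sup>+x. h x \<partial>gauss) = (\<integral>\<^sup>+x. ennreal (gauss_density x) * h x \<partial>lborel)"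
  by (simp add: gauss_def nn_integral_density)

text \<open>The Cameron-Martin formula: completing the square in the density. In this form it holds
  for every nonnegative measurable function, without integrability.\<close>

lemma nn_integral_gauss_shift:
  fixes h :: "'a::euclidean_space \<Rightarrow> ennreal"
  assumes [measurable]: "h \<in> borel_measurable borel"
  shows "(\<integral>\<^sup>+x. h x \<partial>gauss) = (\<integral>\<^sup>+z. h (u + z) * ennreal (exp (- (u \<bullet> z) - (norm u)\<^sup>2 / 2)) \<partial>gauss)"
proof -
  have d: "gauss_density (u + z) = gauss_density z * exp (- (u \<bullet> z) - (norm u)\<^sup>2 / 2)" for z :: 'a
  proof -
    have "(norm (u + z))\<^sup>2 = (norm z)\<^sup>2 + 2 * (u \<bullet> z) + (norm u)\<^sup>2"
      unfolding power2_norm_eq_inner by (simp add: inner_add_left inner_add_right inner_commute[of z u])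
    then show ?thesis
      by (simp add: gauss_density_def mult_exp_exp field_simps)
  qed
  have "(\<integral>\<^sup>+x. h x \<partial>gauss) = (\<integral>\<^sup>+x. ennreal (gauss_density x) * h x \<partial>distr lborel borel ((+) u))"
    by (simp add: nn_integral_gauss lborel_distr_plus)
  also have "\<dots> = (\<integral>\<^sup>+z. ennreal (gauss_density (u + z)) * h (u + z) \<partial>lborel)"
    by (subst nn_integral_distr) auto
  also have "\<dots> = (\<integral>\<^sup>+z. h (u + z) * ennreal (exp (- (u \<bullet> z) - (norm u)\<^sup>2 / 2)) \<partial>gauss)"
    by (subst nn_integral_gauss) (auto simp: d ennreal_mult gauss_density_nonneg mult_ac intro!: nn_integral_cong)
  finally show ?thesis .
qed

lemma distr_gauss_uminus: "distr gauss borel uminus = (gauss :: 'a::euclidean_space measure)"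
proof -
  have l: "distr lborel borel uminus = (lborel :: 'a measure)"
    by (subst (2) lborel_affine[of "-1" 0]) (auto simp: density_1 cong: distr_cong)
  have "distr (gauss :: 'a measure) borel uminus = density (distr lborel borel uminus) (\<lambda>x. ennreal (gauss_density x))"
    unfolding gauss_def
    by (subst density_distr) (auto simp: gauss_density_def)
  then show ?thesis by (simp add: l gauss_def)
qed

text \<open>The Cameron-Martin formula for the constant 1 and the shift \<open>- a\<close>, with the
  constant factor moved to the other side.\<close>

lemma nn_integral_gauss_exp: "(\<integral>\<^sup>+z. ennreal (exp (a \<bullet> z)) \<partial>gauss) = ennreal (exp ((norm a)\<^sup>2 / 2))"
proof -
  have "1 = (\<integral>\<^sup>+z. 1 * ennreal (exp (- ((-a) \<bullet> z) - (norm (-a))\<^sup>2 / 2)) \<partial>gauss)"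
    using nn_integral_gauss_shift[of "\<lambda>_. 1" "-a"] by simp
  also have "\<dots> = (\<integral>\<^sup>+z. ennreal (exp (- (norm a)\<^sup>2 / 2)) * ennreal (exp (a \<bullet> z)) \<partial>gauss)"
    by (simp add: ennreal_mult[symmetric] mult_exp_exp)
  also have "\<dots> = ennreal (exp (- (norm a)\<^sup>2 / 2)) * (\<integral>\<^sup>+z. ennreal (exp (a \<bullet> z)) \<partial>gauss)"
    by (rule nn_integral_cmult) simp
  finally have "ennreal (exp ((norm a)\<^sup>2 / 2)) * 1
      = ennreal (exp ((norm a)\<^sup>2 / 2)) * (ennreal (exp (- (norm a)\<^sup>2 / 2)) * (\<integral>\<^sup>+z. ennreal (exp (a \<bullet> z)) \<partial>gauss))"
    by simp
  then show ?thesis by (simp add: mult.assoc[symmetric] ennreal_mult[symmetric] mult_exp_exp)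
qed

lemma exp_half_diff_square: "(exp (x / 2) - exp (- (x / 2)))\<^sup>2 = exp x + exp (- x) - (2 :: real)"
proof -
  have "exp (x / 2) * exp (- (x / 2)) = 1" "(exp (x / 2))\<^sup>2 = exp x" "(exp (- (x / 2)))\<^sup>2 = exp (- x)"
    by (simp_all add: mult_exp_exp power2_eq_square)
  then show ?thesis by (simp add: power2_diff)
qed

text \<open>\<open>exp w + exp (- w) - 2\<close> is the square of
  \<open>exp (w / 2) - exp (- (w / 2))\<close>, that is of twice the hyperbolic sine of
  \<open>w / 2\<close>, which dominates \<open>w\<close> in absolute value.\<close>

lemma exp_plus_exp_minus_ge: "2 + w\<^sup>2 \<le> exp w + exp (- w :: real)"
proof -
  have key: "2 * v \<le> exp v - exp (- v)" if "0 \<le> v" for v :: real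
  proof -
    let ?f = "\<lambda>v :: real. exp v - exp (- v) - 2 * v"
    have "?f 0 \<le> ?f v"
    proof (rule DERIV_nonneg_imp_nondecreasing[of 0 v ?f])
      fix x :: real
      have "0 \<le> exp x + exp (- x) - 2"
        using exp_half_diff_square[of x] zero_le_power2[of "exp (x / 2) - exp (- (x / 2))"] by linarith
      moreover have "(?f has_real_derivative exp x + exp (- x) - 2) (at x)"
        by (auto intro!: derivative_eq_intros)
      ultimately show "\<exists>y. (?f has_real_derivative y) (at x) \<and> 0 \<le> y" by blast
    qed (rule that)
    then show ?thesis by simp
  qed
  have "w\<^sup>2 = (2 * (\<bar>w\<bar> / 2))\<^sup>2" by simp
  also have "\<dots> \<le> (exp (\<bar>w\<bar> / 2) - exp (- (\<bar>w\<bar> / 2)))\<^sup>2"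
    using key[of "\<bar>w\<bar> / 2"] by (intro power_mono) auto
  also have "\<dots> = exp \<bar>w\<bar> + exp (- \<bar>w\<bar>) - 2" by (rule exp_half_diff_square)
  also have "exp \<bar>w\<bar> + exp (- \<bar>w\<bar>) = exp w + exp (- w)" by (auto simp: abs_if)
  finally show ?thesis by simp
qed

text \<open>The second moment is extracted from the moment generating function: averaging
  \<open>exp w + exp (- w) \<ge> 2 + w^2\<close> with \<open>w = s * (a \<bullet> z)\<close> bounds
  it for each \<open>s\<close>, and \<open>s\<close> tends to 0. The case \<open>s = 1\<close> first
  shows that it is finite.\<close>

lemma nn_integral_gauss_square_le: "(\<integral>\<^sup>+z. ennreal ((a \<bullet> z)\<^sup>2) \<partial>gauss) \<le> ennreal ((norm a)\<^sup>2)"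
proof -
  define I where "I = (\<integral>\<^sup>+z. ennreal ((a \<bullet> z)\<^sup>2) \<partial>gauss)"
  have le: "2 + ennreal (s\<^sup>2) * I \<le> ennreal (2 * exp (s\<^sup>2 * (norm a)\<^sup>2 / 2))" for s
  proof -
    have "2 + ennreal (s\<^sup>2) * I = (\<integral>\<^sup>+z. 2 + ennreal (s\<^sup>2) * ennreal ((a \<bullet> z)\<^sup>2) \<partial>gauss)"
      unfolding I_def by (simp add: nn_integral_add nn_integral_cmult)
    also have "\<dots> = (\<integral>\<^sup>+z. ennreal (2 + (s * (a \<bullet> z))\<^sup>2) \<partial>gauss)"
      by (simp add: ennreal_mult power_mult_distrib)
    also have "\<dots> \<le> (\<integral>\<^sup>+z. ennreal (exp ((s *\<^sub>R a) \<bullet> z)) + ennreal (exp ((- s *\<^sub>R a) \<bullet> z)) \<partial>gauss)"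
      using exp_plus_exp_minus_ge by (intro nn_integral_mono) (simp add: ennreal_plus[symmetric] del: ennreal_plus)
    also have "\<dots> = ennreal (exp ((norm (s *\<^sub>R a))\<^sup>2 / 2)) + ennreal (exp ((norm (- s *\<^sub>R a))\<^sup>2 / 2))"
      by (subst nn_integral_add) (simp_all only: nn_integral_gauss_exp, auto)
    also have "\<dots> = ennreal (2 * exp (s\<^sup>2 * (norm a)\<^sup>2 / 2))"
      by (simp add: ennreal_plus[symmetric] power_mult_distrib del: ennreal_plus)
    finally show ?thesis .
  qed
  have "I < \<infinity>"
  proof -
    have "I \<le> 2 + ennreal (1\<^sup>2) * I" by simp
    also have "\<dots> < \<infinity>" using le[of 1] by (metis ennreal_less_top infinity_ennreal_def order_le_less_trans)
    finally show ?thesis .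
  qed
  then obtain i where i: "I = ennreal i" "0 \<le> i" by (cases I) auto
  define k where "k = (norm a)\<^sup>2 / 2"
  have ev: "2 + s\<^sup>2 * i \<le> 2 * exp (s\<^sup>2 * k)" for s
  proof -
    have "ennreal (2 + s\<^sup>2 * i) \<le> ennreal (2 * exp (s\<^sup>2 * (norm a)\<^sup>2 / 2))"
      using le[of s] i by (simp add: ennreal_mult[symmetric])
    then have "2 + s\<^sup>2 * i \<le> 2 * exp (s\<^sup>2 * (norm a)\<^sup>2 / 2)"
      by (subst (asm) ennreal_le_iff) simp_all
    then show ?thesis by (simp add: k_def)
  qed
  \<comment> \<open>Both sides of \<open>ev\<close> equal 2 at \<open>s = 0\<close>; comparing right
    derivatives in the variable \<open>t = s^2\<close> gives the claim.\<close>
  have "i \<le> 2 * k"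
  proof (rule ccontr)
    assume "\<not> i \<le> 2 * k"
    then have gt: "2 * k < i" by simp
    have "((\<lambda>t. (exp (t * k) - exp (0 * k)) / (t - 0)) \<longlongrightarrow> k) (at 0)"
    proof -
      have "((\<lambda>t. exp (t * k)) has_real_derivative k) (at 0)" by (auto intro!: derivative_eq_intros)
      then show ?thesis by (simp add: has_field_derivative_iff)
    qed
    then have "((\<lambda>t. (exp (t * k) - 1) / t) \<longlongrightarrow> k) (at_right 0)"
      by (auto intro: filterlim_at_split[THEN iffD1, THEN conjunct2])
    moreover have "eventually (\<lambda>t. i / 2 \<le> (exp (t * k) - 1) / t) (at_right (0::real))"
      unfolding eventually_at_right[OF zero_less_one]
    proof (intro exI[of _ 1] conjI allI impI)
      fix t :: real assume t: "0 < t" "t < 1"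
      then show "i / 2 \<le> (exp (t * k) - 1) / t" using ev[of "sqrt t"] by (simp add: field_simps)
    qed simp
    ultimately have "i / 2 \<le> k" by (intro tendsto_lowerbound) auto
    with gt show False by simp
  qed
  then show ?thesis unfolding I_def[symmetric] i by (simp add: k_def ennreal_leI)
qed

lemma integrable_gauss_inner_square: "integrable gauss (\<lambda>z. (a \<bullet> z)\<^sup>2)"
  and integral_gauss_inner_square_le: "(\<integral>z. (a \<bullet> z)\<^sup>2 \<partial>gauss) \<le> (norm a)\<^sup>2"
proof -
  show "integrable gauss (\<lambda>z. (a \<bullet> z)\<^sup>2)"
    using nn_integral_gauss_square_le[of a]
    by (intro integrableI_bounded) (auto intro: order_le_less_trans)
  then have "ennreal (\<integral>z. (a \<bullet> z)\<^sup>2 \<partial>gauss) \<le> ennreal ((norm a)\<^sup>2)"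
    using nn_integral_gauss_square_le[of a] by (subst nn_integral_eq_integral[symmetric]) auto
  then show "(\<integral>z. (a \<bullet> z)\<^sup>2 \<partial>gauss) \<le> (norm a)\<^sup>2" by simp
qed

lemma integrable_gauss_inner: "integrable gauss (\<lambda>z. a \<bullet> z)"
proof (rule Bochner_Integration.integrable_bound)
  show "integrable gauss (\<lambda>z. 1 + (a \<bullet> z)\<^sup>2)" by (intro Bochner_Integration.integrable_add integrable_gauss_inner_square) simp
  have "\<bar>t\<bar> \<le> 1 + t\<^sup>2" for t :: real using sum_power2_ge_zero[of "\<bar>t\<bar> - 1" 0] by (simp add: power2_diff)
  then show "AE z in gauss. norm (a \<bullet> z) \<le> norm (1 + (a \<bullet> z)\<^sup>2)" by (simp add: abs_of_nonneg)
qed simp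

lemma integral_gauss_inner: "(\<integral>z. a \<bullet> z \<partial>gauss) = 0"
proof -
  have "(\<integral>z. a \<bullet> z \<partial>gauss) = (\<integral>z. a \<bullet> z \<partial>distr gauss borel uminus)" by (simp add: distr_gauss_uminus)
  also have "\<dots> = (\<integral>z. a \<bullet> (- z) \<partial>gauss)" by (subst integral_distr) auto
  finally show ?thesis by simp
qed

text \<open>After expanding the square the cross term has mean zero, and the quadratic part
  contributes the squared Hilbert-Schmidt norm of \<open>L\<close>, which is the same for
  \<open>L\<close> and its adjoint.\<close>

lemma integrable_gauss_linear_square:
    fixes L :: "'a::euclidean_space \<Rightarrow> 'c::euclidean_space"
    assumes "linear L"
    shows "integrable gauss (\<lambda>z. (norm (w + L z))\<^sup>2)"
  and integral_gauss_linear_square_le: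
    "(\<integral>z. (norm (w + L z))\<^sup>2 \<partial>gauss) \<le> (norm w)\<^sup>2 + (\<Sum>i\<in>Basis. (norm (L i))\<^sup>2)"
proof -
  have adj: "L z \<bullet> k = adjoint L k \<bullet> z" for z k
    by (metis adjoint_works[OF assms] inner_commute)
  have eq: "(norm (w + L z))\<^sup>2 = (norm w)\<^sup>2 + 2 * (adjoint L w \<bullet> z) + (\<Sum>k\<in>Basis. (adjoint L k \<bullet> z)\<^sup>2)" for z
  proof -
    have "(norm (w + L z))\<^sup>2 = (norm w)\<^sup>2 + 2 * (L z \<bullet> w) + (norm (L z))\<^sup>2"
      unfolding power2_norm_eq_inner by (simp add: inner_add_left inner_add_right inner_commute[of w "L z"])
    then show ?thesis by (simp add: norm_square_Basis[of "L z"] adj)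
  qed
  show "integrable gauss (\<lambda>z. (norm (w + L z))\<^sup>2)"
    unfolding eq by (intro Bochner_Integration.integrable_add Bochner_Integration.integrable_sum
        integrable_mult_right integrable_gauss_inner integrable_gauss_inner_square) simp
  have "(\<integral>z. (norm (w + L z))\<^sup>2 \<partial>gauss) = (norm w)\<^sup>2 + (\<Sum>k\<in>Basis. \<integral>z. (adjoint L k \<bullet> z)\<^sup>2 \<partial>gauss)"
    unfolding eq
    by (simp add: integrable_gauss_inner integrable_gauss_inner_square integral_gauss_inner)
  also have "\<dots> \<le> (norm w)\<^sup>2 + (\<Sum>k\<in>Basis. (norm (adjoint L k))\<^sup>2)"
    by (intro add_left_mono sum_mono integral_gauss_inner_square_le)
  also have "(\<Sum>k\<in>Basis. (norm (adjoint L k))\<^sup>2) = (\<Sum>k\<in>Basis. \<Sum>i\<in>Basis. (L i \<bullet> k)\<^sup>2)"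
    by (simp add: norm_square_Basis[of "adjoint L _"] adj)
  also have "\<dots> = (\<Sum>i\<in>Basis. (norm (L i))\<^sup>2)" by (subst sum.swap) (simp add: norm_square_Basis[of "L _"])
  finally show "(\<integral>z. (norm (w + L z))\<^sup>2 \<partial>gauss) \<le> (norm w)\<^sup>2 + (\<Sum>i\<in>Basis. (norm (L i))\<^sup>2)" .
qed

lemma integral_gauss_affine:
  fixes L :: "'a::euclidean_space \<Rightarrow> 'c::euclidean_space"
  assumes "linear L"
  shows "integrable gauss (\<lambda>z. (w + L z) \<bullet> D)" "(\<integral>z. (w + L z) \<bullet> D \<partial>gauss) = w \<bullet> D"
proof -
  have adj: "L z \<bullet> D = adjoint L D \<bullet> z" for z
    by (metis adjoint_works[OF assms] inner_commute)
  show "integrable gauss (\<lambda>z. (w + L z) \<bullet> D)" "(\<integral>z. (w + L z) \<bullet> D \<partial>gauss) = w \<bullet> D"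
    by (simp_all add: inner_add_left adj integrable_gauss_inner integral_gauss_inner)
qed

lemma nn_integral_gauss_linear_square_le:
  fixes L :: "'a::euclidean_space \<Rightarrow> 'c::euclidean_space"
  assumes "linear L"
  shows "(\<integral>\<^sup>+z. ennreal ((norm (w + L z))\<^sup>2) \<partial>gauss) \<le> ennreal ((norm w)\<^sup>2 + (\<Sum>i\<in>Basis. (norm (L i))\<^sup>2))"
  using integral_gauss_linear_square_le[OF assms, of w] integrable_gauss_linear_square[OF assms, of w]
  by (subst nn_integral_eq_integral) (auto intro: ennreal_leI)

lemma gauss_prod: "(gauss :: ('a::euclidean_space \<times> 'b::euclidean_space) measure) = gauss \<Otimes>\<^sub>M gauss"
proof -
  have "(gauss :: 'a measure) \<Otimes>\<^sub>M (gauss :: 'b measure) = density (lborel \<Otimes>\<^sub>M lborel)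
      (\<lambda>(x, y). ennreal (gauss_density x) * ennreal (gauss_density y))"
    unfolding gauss_def
    by (rule pair_measure_density)
      (auto simp: lborel.sigma_finite_measure_axioms gauss_def[symmetric] gauss.sigma_finite_measure_axioms)
  also have "(\<lambda>(x :: 'a, y :: 'b). ennreal (gauss_density x) * ennreal (gauss_density y)) = (\<lambda>p. ennreal (gauss_density p))"
    by (auto simp: fun_eq_iff gauss_density_def norm_Pair ennreal_mult[symmetric] power_add exp_add[symmetric]
        add_divide_distrib mult_exp_exp)
  finally show ?thesis by (simp add: lborel_prod gauss_def)
qed

section \<open>Self-normalised PAC-Bayes bounds\<close>

lemma integrable_mult_of_squares:
  fixes f g :: "'a \<Rightarrow> real"
  assumes "f \<in> borel_measurable M" "g \<in> borel_measurable M"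
    and "integrable M (\<lambda>x. (f x)\<^sup>2)" "integrable M (\<lambda>x. (g x)\<^sup>2)"
  shows "integrable M (\<lambda>x. f x * g x)"
proof (rule Bochner_Integration.integrable_bound)
  show "integrable M (\<lambda>x. (f x)\<^sup>2 + (g x)\<^sup>2)" using assms by simp
  have "\<bar>s * t\<bar> \<le> s\<^sup>2 + t\<^sup>2" for s t :: real
  proof -
    have "2 * (\<bar>s\<bar> * \<bar>t\<bar>) \<le> s\<^sup>2 + t\<^sup>2"
      using sum_power2_ge_zero[of "\<bar>s\<bar> - \<bar>t\<bar>" 0] by (simp add: power2_diff mult.assoc)
    moreover have "0 \<le> \<bar>s\<bar> * \<bar>t\<bar>" by simp
    ultimately show ?thesis unfolding abs_mult by linarith
  qed
  then show "AE x in M. norm (f x * g x) \<le> norm ((f x)\<^sup>2 + (g x)\<^sup>2)" by (simp add: abs_of_nonneg)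
qed (use assms in measurable)

text \<open>Jensen's inequality, from integrating \<open>2 * b * f \<le> b^2 + f^2\<close> and
  taking for \<open>b\<close> the mean of \<open>f\<close>.\<close>

lemma (in prob_space) integral_le_of_square_le:
  fixes f :: "'a \<Rightarrow> real"
  assumes "f \<in> borel_measurable M" "integrable M (\<lambda>x. (f x)\<^sup>2)"
    and "(\<integral>x. (f x)\<^sup>2 \<partial>M) \<le> c\<^sup>2" "0 \<le> c"
  shows "(\<integral>x. f x \<partial>M) \<le> c"
proof -
  have "integrable M (\<lambda>x. f x * 1)" using assms by (intro integrable_mult_of_squares) auto
  then have i1: "integrable M f" by simp
  have "2 * b * (\<integral>x. f x \<partial>M) \<le> b\<^sup>2 + c\<^sup>2" for b
  proof -
    have "2 * b * (\<integral>x. f x \<partial>M) = (\<integral>x. 2 * b * f x \<partial>M)" by simp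
    also have "\<dots> \<le> (\<integral>x. b\<^sup>2 + (f x)\<^sup>2 \<partial>M)"
      using sum_power2_ge_zero[of "b - f _" 0] i1 assms(2)
      by (intro integral_mono) (auto simp: power2_diff algebra_simps)
    also have "\<dots> \<le> b\<^sup>2 + c\<^sup>2" using assms by (simp add: prob_space)
    finally show ?thesis .
  qed
  from this[of "\<integral>x. f x \<partial>M"] have "(\<integral>x. f x \<partial>M)\<^sup>2 \<le> c\<^sup>2"
    by (simp add: power2_eq_square)
  then show ?thesis using assms(4) by (rule power2_le_imp_le)
qed

text \<open>Young's inequality between \<open>exp\<close> and its conjugate
  \<open>f * ln f - f\<close>, followed by \<open>ln f \<le> f - 1\<close>. The second step replaces
  the entropy of the posterior weight by its second moment, which is computable.\<close>

lemma pac_bayes_pointwise: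
  fixes f w :: real
  assumes "0 \<le> f"
  shows "f * w \<le> exp w + f\<^sup>2 - 2 * f"
proof (cases "f = 0")
  case False
  then have f: "0 < f" using assms by simp
  have "f * (1 + (w - ln f)) \<le> f * exp (w - ln f)"
    using f by (intro mult_left_mono exp_ge_add_one_self) auto
  also have "\<dots> = exp w" using f by (simp add: exp_diff)
  finally have "f * w \<le> exp w + f * ln f - f" by (simp add: algebra_simps)
  also have "f * ln f \<le> f * (f - 1)" using f ln_le_minus_one[OF f] by (intro mult_left_mono) auto
  finally show ?thesis by (simp add: algebra_simps power2_eq_square)
qed simp

text \<open>With the unnormalised posterior weight \<open>f = norm Y / c\<close>, the entropy term is at most
  \<open>2 - 2 * \<integral>f\<close>, so the bound increases with \<open>\<integral>f \<le> 1\<close> and no lower bound on \<open>norm Y\<close> is needed.\<close>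

lemma pac_bayes_gauss:
  fixes Y :: "'b::euclidean_space \<Rightarrow> 'c::euclidean_space"
  assumes [measurable]: "Y \<in> borel_measurable borel"
    and Z: "(\<integral>\<^sup>+\<theta>. ennreal (exp (l * (sgn (Y \<theta>) \<bullet> D) - N)) \<partial>gauss) \<le> ennreal (exp Lg)"
    and int2: "integrable gauss (\<lambda>z. (norm (Y (u + z)))\<^sup>2)" "(\<integral>z. (norm (Y (u + z)))\<^sup>2 \<partial>gauss) \<le> c\<^sup>2"
    and "0 < c"
    and mean: "(\<integral>z. Y (u + z) \<bullet> D \<partial>gauss) = Y0 \<bullet> D"
    and shift: "(\<integral>z. norm (Y (u + z)) * (u \<bullet> z) \<partial>gauss) \<le> \<tau>"
    and pos: "2 \<le> N + (norm u)\<^sup>2 / 2 + Lg"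
  shows "l * (Y0 \<bullet> D) \<le> c * (N + (norm u)\<^sup>2 / 2 + Lg) + \<tau>"
proof -
  \<comment> \<open>\<open>h\<close> joins the exponent of \<open>Z\<close> at the shifted point
    with the logarithm of the Cameron-Martin density, so \<open>exp (h z)\<close> has the integral
    that \<open>Z\<close> bounds.\<close>
  define h where "h z = l * (sgn (Y (u + z)) \<bullet> D) - N - u \<bullet> z - (norm u)\<^sup>2 / 2" for z
  define n where "n z = norm (Y (u + z))" for z
  have n0: "0 \<le> n z" for z by (simp add: n_def)
  have [measurable]: "h \<in> borel_measurable borel" "n \<in> borel_measurable borel"
    unfolding h_def n_def sgn_div_norm by measurable
  have Zs: "(\<integral>\<^sup>+z. ennreal (exp (h z)) \<partial>gauss) \<le> ennreal (exp Lg)"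
  proof -
    have "(\<integral>\<^sup>+\<theta>. ennreal (exp (l * (sgn (Y \<theta>) \<bullet> D) - N)) \<partial>gauss) = (\<integral>\<^sup>+z. ennreal (exp (h z)) \<partial>gauss)"
      by (subst nn_integral_gauss_shift[of _ u])
        (auto simp: sgn_div_norm h_def ennreal_mult[symmetric] mult_exp_exp algebra_simps intro!: nn_integral_cong)
    with Z show ?thesis by simp
  qed
  have ieh: "integrable gauss (\<lambda>z. exp (h z))"
    using Zs by (intro integrableI_bounded) (auto intro: order_le_less_trans)
  have "ennreal (\<integral>z. exp (h z) \<partial>gauss) \<le> ennreal (exp Lg)"
    using Zs by (subst nn_integral_eq_integral[symmetric]) (auto intro: ieh)
  then have eh: "(\<integral>z. exp (h z) \<partial>gauss) \<le> exp Lg" by simp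
  have in2: "integrable gauss (\<lambda>z. (n z)\<^sup>2)" using int2 by (simp add: n_def)
  have in1: "integrable gauss n"
    using integrable_mult_of_squares[of n gauss "\<lambda>_. 1"] in2 by simp
  have inu: "integrable gauss (\<lambda>z. n z * (u \<bullet> z))"
    using in2 integrable_gauss_inner_square[of u] by (intro integrable_mult_of_squares) auto
  have iYD: "integrable gauss (\<lambda>z. Y (u + z) \<bullet> D)"
  proof (rule Bochner_Integration.integrable_bound)
    show "integrable gauss (\<lambda>z. n z * norm D)" using in1 by simp
    show "AE z in gauss. norm (Y (u + z) \<bullet> D) \<le> norm (n z * norm D)"
      using Cauchy_Schwarz_ineq2 by (auto simp: n_def)
  qed simp
  \<comment> \<open>The weight undoes the normalisation: \<open>n z\<close> times
    \<open>sgn (Y (u + z))\<close> is \<open>Y (u + z)\<close>, whose pairing with \<open>D\<close>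
    has the expectation given by \<open>mean\<close>.\<close>
  have nh: "n z * h z = l * (Y (u + z) \<bullet> D) - (N + (norm u)\<^sup>2 / 2) * n z - n z * (u \<bullet> z)" for z
  proof -
    have "n z *\<^sub>R sgn (Y (u + z)) = Y (u + z)" by (cases "Y (u + z) = 0") (simp_all add: n_def sgn_div_norm)
    then have "n z * (sgn (Y (u + z)) \<bullet> D) = Y (u + z) \<bullet> D" by (metis inner_scaleR_left)
    then show ?thesis by (simp add: h_def algebra_simps)
  qed
  define m where "m = (\<integral>z. n z \<partial>gauss)"
  have le: "n z / c * (h z - Lg) \<le> exp (h z) * exp (- Lg) + (n z)\<^sup>2 / c\<^sup>2 - 2 / c * n z" for z
    using pac_bayes_pointwise[of "n z / c" "h z - Lg"] n0[of z] \<open>0 < c\<close>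
    by (simp add: exp_diff exp_minus field_simps power_divide)
  have "(\<integral>z. n z * h z \<partial>gauss) = l * (Y0 \<bullet> D) - (N + (norm u)\<^sup>2 / 2) * m - (\<integral>z. n z * (u \<bullet> z) \<partial>gauss)"
    unfolding nh using in1 inu iYD by (simp add: mean m_def)
  moreover have inh: "integrable gauss (\<lambda>z. n z * h z)" unfolding nh using in1 inu iYD by simp
  ultimately have "l * (Y0 \<bullet> D) - (N + (norm u)\<^sup>2 / 2) * m - \<tau> - Lg * m
      \<le> (\<integral>z. n z * h z \<partial>gauss) - Lg * m"
    using shift by (simp add: n_def)
  also have "\<dots> = c * (\<integral>z. n z / c * (h z - Lg) \<partial>gauss)"
    using inh in1 \<open>0 < c\<close> by (simp add: m_def right_diff_distrib diff_divide_distrib)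
  also have "\<dots> \<le> c * (\<integral>z. exp (h z) * exp (- Lg) + (n z)\<^sup>2 / c\<^sup>2 - 2 / c * n z \<partial>gauss)"
    using \<open>0 < c\<close> inh in1 in2 ieh
    by (intro mult_left_mono integral_mono le) (auto simp: right_diff_distrib diff_divide_distrib)
  also have "\<dots> = c * ((\<integral>z. exp (h z) \<partial>gauss) * exp (- Lg) + (\<integral>z. (n z)\<^sup>2 \<partial>gauss) / c\<^sup>2 - 2 / c * m)"
    using in1 in2 ieh by (simp add: m_def)
  also have "\<dots> \<le> c * (exp Lg * exp (- Lg) + c\<^sup>2 / c\<^sup>2 - 2 / c * m)"
    using \<open>0 < c\<close> eh int2(2)
    by (intro mult_left_mono diff_mono add_mono mult_right_mono divide_right_mono) (auto simp: n_def)
  also have "\<dots> = 2 * c - 2 * m" using \<open>0 < c\<close> by (simp add: mult_exp_exp field_simps)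
  finally have A: "l * (Y0 \<bullet> D) \<le> (N + (norm u)\<^sup>2 / 2 + Lg - 2) * m + 2 * c + \<tau>" by (simp add: algebra_simps)
  \<comment> \<open>The assumption \<open>pos\<close> makes the coefficient of \<open>m\<close> in
    \<open>A\<close> nonnegative, so \<open>m\<close> may be replaced by \<open>c\<close>; the terms
    \<open>2 * c\<close> then cancel.\<close>
  have "m \<le> c"
    unfolding m_def by (rule gauss.integral_le_of_square_le) (use in2 int2(2) \<open>0 < c\<close> in \<open>auto simp: n_def\<close>)
  then have "(N + (norm u)\<^sup>2 / 2 + Lg - 2) * m \<le> (N + (norm u)\<^sup>2 / 2 + Lg - 2) * c"
    using pos by (intro mult_left_mono) auto
  with A show ?thesis by (simp add: algebra_simps)
qed

text \<open>Gaussian integration by parts: the left-hand side is the derivative at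
  \<open>s = 0\<close> of the mean of \<open>norm Y\<close> at the shift
  \<open>u + s *\<^sub>R u\<close>. As only an upper bound is wanted,
  \<open>exp v \<ge> 1 + v\<close> in the Cameron-Martin density replaces differentiation under the
  integral.\<close>

lemma gauss_shift_derivative:
  fixes Y :: "'b::euclidean_space \<Rightarrow> 'c::euclidean_space"
  assumes [measurable]: "Y \<in> borel_measurable borel"
    and int2: "integrable gauss (\<lambda>z. (norm (Y (u + z)))\<^sup>2)"
    and int1: "\<And>s. 0 < s \<Longrightarrow> s < 1 \<Longrightarrow> integrable gauss (\<lambda>z. norm (Y (u + s *\<^sub>R u + z)))"
    and le: "\<And>s. 0 < s \<Longrightarrow> s < 1 \<Longrightarrow>
      (\<integral>z. norm (Y (u + s *\<^sub>R u + z)) \<partial>gauss) \<le> (\<integral>z. norm (Y (u + z)) \<partial>gauss) + s * \<tau> + s\<^sup>2 * C"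
  shows "(\<integral>z. norm (Y (u + z)) * (u \<bullet> z) \<partial>gauss) \<le> \<tau>"
proof -
  define n where "n z = norm (Y (u + z))" for z
  have n0: "0 \<le> n z" for z by (simp add: n_def)
  have [measurable]: "n \<in> borel_measurable borel" unfolding n_def by measurable
  have in2: "integrable gauss (\<lambda>z. (n z)\<^sup>2)" using int2 by (simp add: n_def)
  have in1: "integrable gauss n"
    using integrable_mult_of_squares[of n gauss "\<lambda>_. 1"] in2 by simp
  have inu: "integrable gauss (\<lambda>z. n z * (u \<bullet> z))"
    using in2 integrable_gauss_inner_square[of u] by (intro integrable_mult_of_squares) auto
  define m where "m = (\<integral>z. n z \<partial>gauss)"
  define J where "J = (\<integral>z. n z * (u \<bullet> z) \<partial>gauss)"
  define C' where "C' = C + m * (norm u)\<^sup>2 / 2"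
  have J: "J \<le> \<tau> + s * C'" if s: "0 < s" "s < 1" for s
  proof -
    define e where "e z = exp (s * (u \<bullet> z) - s\<^sup>2 * (norm u)\<^sup>2 / 2)" for z
    have [measurable]: "e \<in> borel_measurable borel" unfolding e_def by measurable
    have "(\<integral>\<^sup>+z. ennreal (norm (Y (u + s *\<^sub>R u + z))) \<partial>gauss) = (\<integral>\<^sup>+z. ennreal (n z * e z) \<partial>gauss)"
      by (subst nn_integral_gauss_shift[of _ "- s *\<^sub>R u"])
        (auto simp: n_def e_def ennreal_mult[symmetric] power_mult_distrib algebra_simps intro!: nn_integral_cong)
    moreover have "(\<integral>\<^sup>+z. ennreal (norm (Y (u + s *\<^sub>R u + z))) \<partial>gauss) = ennreal (\<integral>z. norm (Y (u + s *\<^sub>R u + z)) \<partial>gauss)"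
      by (rule nn_integral_eq_integral[OF int1[OF s]]) simp
    ultimately have eq: "(\<integral>\<^sup>+z. ennreal (n z * e z) \<partial>gauss) = ennreal (\<integral>z. norm (Y (u + s *\<^sub>R u + z)) \<partial>gauss)"
      by simp
    have ine: "integrable gauss (\<lambda>z. n z * e z)"
      using eq n0 by (intro integrableI_bounded) (auto simp: e_def)
    have "ennreal (\<integral>z. n z * e z \<partial>gauss) = ennreal (\<integral>z. norm (Y (u + s *\<^sub>R u + z)) \<partial>gauss)"
      unfolding eq[symmetric] by (rule nn_integral_eq_integral[OF ine, symmetric]) (auto simp: n0 e_def)
    then have eq': "(\<integral>z. n z * e z \<partial>gauss) = (\<integral>z. norm (Y (u + s *\<^sub>R u + z)) \<partial>gauss)"
      by (subst (asm) ennreal_inj) (auto simp: n0 e_def intro!: integral_nonneg_AE)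
    have "m + s * J - s\<^sup>2 * (norm u)\<^sup>2 / 2 * m = (\<integral>z. n z + s * (n z * (u \<bullet> z)) - s\<^sup>2 * (norm u)\<^sup>2 / 2 * n z \<partial>gauss)"
      using in1 inu by (simp add: m_def J_def)
    also have "\<dots> \<le> (\<integral>z. n z * e z \<partial>gauss)"
    proof (rule integral_mono)
      fix z
      have "n z * (1 + (s * (u \<bullet> z) - s\<^sup>2 * (norm u)\<^sup>2 / 2)) \<le> n z * e z"
        unfolding e_def by (intro mult_left_mono exp_ge_add_one_self n0)
      then show "n z + s * (n z * (u \<bullet> z)) - s\<^sup>2 * (norm u)\<^sup>2 / 2 * n z \<le> n z * e z"
        by (simp add: algebra_simps)
    qed (use in1 inu ine in auto)
    also have "\<dots> \<le> m + s * \<tau> + s\<^sup>2 * C" unfolding eq' using le[OF s] by (simp add: m_def n_def)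
    finally have "s * J \<le> s * (\<tau> + s * C')" by (simp add: C'_def algebra_simps power2_eq_square)
    then show ?thesis using s by simp
  qed
  have "((\<lambda>s. \<tau> + s * C') \<longlongrightarrow> \<tau> + 0 * C') (at_right 0)" by (intro tendsto_intros)
  moreover have "eventually (\<lambda>s. J \<le> \<tau> + s * C') (at_right 0)"
    unfolding eventually_at_right[OF zero_less_one] by (intro exI[of _ 1]) (auto intro: J)
  ultimately have "J \<le> \<tau> + 0 * C'" by (intro tendsto_lowerbound) auto
  then show ?thesis by (simp add: J_def n_def)
qed

text \<open>For linear \<open>T\<close> a change of the shift by \<open>s *\<^sub>R u\<close> moves
  \<open>T\<close> by \<open>s *\<^sub>R T u\<close>, so by the triangle inequality the derivative
  term is at most \<open>norm (T u)\<close>.\<close>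

lemma pac_bayes_linear:
  fixes T :: "'b::euclidean_space \<Rightarrow> 'c::euclidean_space"
  assumes T: "linear T"
    and Z: "(\<integral>\<^sup>+\<theta>. ennreal (exp (l * (sgn (T \<theta>) \<bullet> D) - N)) \<partial>gauss) \<le> ennreal (exp Lg)"
    and c: "(norm (T u))\<^sup>2 + (\<Sum>i\<in>Basis. (norm (T i))\<^sup>2) \<le> c\<^sup>2" "0 < c"
    and pos: "2 \<le> N + (norm u)\<^sup>2 / 2 + Lg"
  shows "l * (T u \<bullet> D) \<le> c * (N + (norm u)\<^sup>2 / 2 + Lg) + norm (T u)"
proof (rule pac_bayes_gauss[OF _ Z _ _ \<open>0 < c\<close> _ _ pos])
  have [measurable]: "T \<in> borel_measurable borel"
    using T by (intro borel_measurable_continuous_onI linear_continuous_on) (simp add: linear_conv_bounded_linear)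
  then show "T \<in> borel_measurable borel" .
  have Tadd: "T (u + z) = T u + T z" for z by (rule linear_add[OF T])
  show i2: "integrable gauss (\<lambda>z. (norm (T (u + z)))\<^sup>2)"
    unfolding Tadd by (rule integrable_gauss_linear_square[OF T])
  show "(\<integral>z. (norm (T (u + z)))\<^sup>2 \<partial>gauss) \<le> c\<^sup>2"
    unfolding Tadd by (rule order_trans[OF integral_gauss_linear_square_le[OF T] c(1)])
  show "(\<integral>z. T (u + z) \<bullet> D \<partial>gauss) = T u \<bullet> D"
    unfolding Tadd by (rule integral_gauss_affine[OF T])
  have i1: "integrable gauss (\<lambda>z. norm (T (w + z)))" for w
    using integrable_mult_of_squares[of "\<lambda>z. norm (T (w + z))" gauss "\<lambda>_. 1"]
      integrable_gauss_linear_square[OF T, of "T w"] by (simp add: linear_add[OF T])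
  show "(\<integral>z. norm (T (u + z)) * (u \<bullet> z) \<partial>gauss) \<le> norm (T u)"
  proof (rule gauss_shift_derivative[OF _ i2, where C = 0])
    fix s :: real assume s: "0 < s" "s < 1"
    show "integrable gauss (\<lambda>z. norm (T (u + s *\<^sub>R u + z)))" by (rule i1)
    have "(\<integral>z. norm (T (u + s *\<^sub>R u + z)) \<partial>gauss) \<le> (\<integral>z. norm (T (u + z)) + s * norm (T u) \<partial>gauss)"
    proof (rule integral_mono)
      fix z
      have "T (u + s *\<^sub>R u + z) = T (u + z) + s *\<^sub>R T u"
        by (simp add: linear_add[OF T] linear_scale[OF T])
      then show "norm (T (u + s *\<^sub>R u + z)) \<le> norm (T (u + z)) + s * norm (T u)"
        using norm_triangle_ineq[of "T (u + z)" "s *\<^sub>R T u"] s by simp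
    qed (use i1 in auto)
    then show "(\<integral>z. norm (T (u + s *\<^sub>R u + z)) \<partial>gauss)
        \<le> (\<integral>z. norm (T (u + z)) \<partial>gauss) + s * norm (T u) + s\<^sup>2 * 0"
      using i1 by simp
  qed simp
qed

section \<open>Independent Gaussian noise in both arguments of a bilinear map\<close>

lemma nn_integral_gauss_prod:
  assumes [measurable]: "f \<in> borel_measurable (borel :: ('a::euclidean_space \<times> 'b::euclidean_space) measure)"
  shows "(\<integral>\<^sup>+z. f z \<partial>gauss) = (\<integral>\<^sup>+x. \<integral>\<^sup>+y. f (x, y) \<partial>gauss \<partial>gauss)"
proof -
  have "f \<in> borel_measurable ((gauss :: 'a measure) \<Otimes>\<^sub>M (gauss :: 'b measure))"
    unfolding gauss_prod[symmetric] by measurable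
  then show ?thesis by (simp add: gauss_prod gauss.nn_integral_fst)
qed

text \<open>The bound for linear maps is applied twice, first integrating over the second argument
  and then over the first. The four terms of \<open>B\<close> correspond to choosing mean or noise
  in each argument.\<close>

lemma
  fixes T :: "'a::euclidean_space \<Rightarrow> 'b::euclidean_space \<Rightarrow> 'c::euclidean_space" and U V D
  assumes T: "bilinear T"
  defines "B \<equiv> (norm (T U V))\<^sup>2 + (\<Sum>j\<in>Basis. (norm (T U j))\<^sup>2)
    + ((\<Sum>i\<in>Basis. (norm (T i V))\<^sup>2) + (\<Sum>j\<in>Basis. \<Sum>i\<in>Basis. (norm (T i j))\<^sup>2))"
  shows integrable_gauss_bilinear_square: "integrable gauss (\<lambda>z. (norm (T (U + fst z) (V + snd z)))\<^sup>2)"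
    and integral_gauss_bilinear_square_le: "(\<integral>z. (norm (T (U + fst z) (V + snd z)))\<^sup>2 \<partial>gauss) \<le> B"
    and integral_gauss_bilinear: "(\<integral>z. T (U + fst z) (V + snd z) \<bullet> D \<partial>gauss) = T U V \<bullet> D"
proof -
  have bb: "bounded_bilinear T" using T by (simp add: bilinear_conv_bounded_bilinear)
  have [measurable]: "(\<lambda>z. T (U + fst z) (V + snd z)) \<in> borel_measurable borel"
    by (intro borel_measurable_continuous_onI bounded_bilinear.continuous_on[OF bb] continuous_intros)
  have l1: "linear (T x)" for x using T by (simp add: bilinear_def)
  have l2: "linear (\<lambda>x. T x y)" for y using T by (simp add: bilinear_def)
  have B0: "0 \<le> B" unfolding B_def by (intro add_nonneg_nonneg sum_nonneg) auto
  have nn: "(\<integral>\<^sup>+z. ennreal ((norm (T (U + fst z) (V + snd z)))\<^sup>2) \<partial>gauss) \<le> ennreal B"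
  proof -
    have "(\<integral>\<^sup>+z. ennreal ((norm (T (U + fst z) (V + snd z)))\<^sup>2) \<partial>gauss)
        = (\<integral>\<^sup>+x. \<integral>\<^sup>+y. ennreal ((norm (T (U + x) V + T (U + x) y))\<^sup>2) \<partial>gauss \<partial>gauss)"
      by (subst nn_integral_gauss_prod, measurable) (simp add: linear_add[OF l1])
    also have "\<dots> \<le> (\<integral>\<^sup>+x. ennreal ((norm (T (U + x) V))\<^sup>2 + (\<Sum>j\<in>Basis. (norm (T (U + x) j))\<^sup>2)) \<partial>gauss)"
      by (intro nn_integral_mono nn_integral_gauss_linear_square_le l1)
    also have "\<dots> = (\<integral>\<^sup>+x. ennreal ((norm (T U V + T x V))\<^sup>2) + (\<Sum>j\<in>Basis. ennreal ((norm (T U j + T x j))\<^sup>2)) \<partial>gauss)"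
      by (simp add: linear_add[OF l2] sum_ennreal sum_nonneg)
    also have "\<dots> = (\<integral>\<^sup>+x. ennreal ((norm (T U V + T x V))\<^sup>2) \<partial>gauss)
        + (\<Sum>j\<in>Basis. \<integral>\<^sup>+x. ennreal ((norm (T U j + T x j))\<^sup>2) \<partial>gauss)"
    proof -
      have [measurable]: "(\<lambda>x. T x y) \<in> borel_measurable borel" for y
        using l2 by (intro borel_measurable_continuous_onI linear_continuous_on) (simp add: linear_conv_bounded_linear)
      show ?thesis by (subst nn_integral_add, measurable) (subst nn_integral_sum, measurable)
    qed
    also have "\<dots> \<le> ennreal ((norm (T U V))\<^sup>2 + (\<Sum>i\<in>Basis. (norm (T i V))\<^sup>2))
        + (\<Sum>j\<in>Basis. ennreal ((norm (T U j))\<^sup>2 + (\<Sum>i\<in>Basis. (norm (T i j))\<^sup>2)))"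
      by (intro add_mono sum_mono nn_integral_gauss_linear_square_le l2)
    also have "\<dots> = ennreal B"
      unfolding B_def by (subst sum_ennreal)
        (auto simp: sum_nonneg sum.distrib ennreal_plus[symmetric] algebra_simps simp del: ennreal_plus
          intro!: add_nonneg_nonneg sum_nonneg arg_cong[of _ _ ennreal])
    finally show ?thesis .
  qed
  show i2: "integrable gauss (\<lambda>z. (norm (T (U + fst z) (V + snd z)))\<^sup>2)"
    using nn by (intro integrableI_bounded) (auto intro: order_le_less_trans)
  have "ennreal (\<integral>z. (norm (T (U + fst z) (V + snd z)))\<^sup>2 \<partial>gauss) \<le> ennreal B"
    using nn i2 by (subst nn_integral_eq_integral[symmetric]) auto
  then show "(\<integral>z. (norm (T (U + fst z) (V + snd z)))\<^sup>2 \<partial>gauss) \<le> B" using B0 by simp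
  have i1: "integrable gauss (\<lambda>z. norm (T (U + fst z) (V + snd z)))"
    using integrable_mult_of_squares[of "\<lambda>z. norm (T (U + fst z) (V + snd z))" gauss "\<lambda>_. 1"] i2 by simp
  have iD: "integrable gauss (\<lambda>z. T (U + fst z) (V + snd z) \<bullet> D)"
  proof (rule Bochner_Integration.integrable_bound)
    show "integrable gauss (\<lambda>z. norm (T (U + fst z) (V + snd z)) * norm D)" using i1 by simp
    show "AE z in gauss. norm (T (U + fst z) (V + snd z) \<bullet> D) \<le> norm (norm (T (U + fst z) (V + snd z)) * norm D)"
      using Cauchy_Schwarz_ineq2 by auto
  qed simp
  interpret P: pair_sigma_finite "gauss :: 'a measure" "gauss :: 'b measure" ..
  have "(\<integral>z. T (U + fst z) (V + snd z) \<bullet> D \<partial>gauss) = (\<integral>x. \<integral>y. T (U + x) (V + y) \<bullet> D \<partial>gauss \<partial>gauss)"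
    using P.integral_fst'[of "\<lambda>z. T (U + fst z) (V + snd z) \<bullet> D"] iD by (simp add: gauss_prod)
  also have "\<dots> = (\<integral>x. (T U V + T x V) \<bullet> D \<partial>gauss)"
    by (simp only: linear_add[OF l1] integral_gauss_affine(2)[OF l1]) (simp only: linear_add[OF l2])
  also have "\<dots> = T U V \<bullet> D" by (rule integral_gauss_affine[OF l2])
  finally show "(\<integral>z. T (U + fst z) (V + snd z) \<bullet> D \<partial>gauss) = T U V \<bullet> D" .
qed

lemma sum_Basis_prod:
  fixes f :: "'a::euclidean_space \<times> 'b::euclidean_space \<Rightarrow> real"
  shows "(\<Sum>i\<in>Basis. f i) = (\<Sum>i\<in>Basis. f (i, 0)) + (\<Sum>j\<in>Basis. f (0, j))"
proof -
  have "(\<lambda>u. (u, 0)) ` (Basis :: 'a set) \<inter> Pair 0 ` (Basis :: 'b set) = {}" by auto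
  then show ?thesis
    unfolding Basis_prod_def by (subst sum.union_disjoint) (auto simp: sum.reindex inj_on_def)
qed

text \<open>Scaling both shifts by \<open>1 + s\<close> changes \<open>Y\<close> to first order by
  \<open>T U (V + snd z) + T (U + fst z) V\<close>. The numbers \<open>a\<close> and
  \<open>b\<close> bound the mean norms of these two terms; the quadratic remainder
  \<open>norm (T U V)\<close> disappears in the derivative.\<close>

lemma pac_bayes_bilinear:
  fixes T :: "'a::euclidean_space \<Rightarrow> 'b::euclidean_space \<Rightarrow> 'c::euclidean_space"
  assumes T: "bilinear T"
    and Z: "(\<integral>\<^sup>+\<theta>. ennreal (exp (l * (sgn (T (fst \<theta>) (snd \<theta>)) \<bullet> D) - N)) \<partial>gauss) \<le> ennreal (exp Lg)"
    and c: "(norm (T U V))\<^sup>2 + (\<Sum>j\<in>Basis. (norm (T U j))\<^sup>2)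
      + ((\<Sum>i\<in>Basis. (norm (T i V))\<^sup>2) + (\<Sum>j\<in>Basis. \<Sum>i\<in>Basis. (norm (T i j))\<^sup>2)) \<le> c\<^sup>2" "0 < c"
    and a: "(norm (T U V))\<^sup>2 + (\<Sum>j\<in>Basis. (norm (T U j))\<^sup>2) \<le> a\<^sup>2" "0 \<le> a"
    and b: "(norm (T U V))\<^sup>2 + (\<Sum>i\<in>Basis. (norm (T i V))\<^sup>2) \<le> b\<^sup>2" "0 \<le> b"
    and pos: "2 \<le> N + ((norm U)\<^sup>2 + (norm V)\<^sup>2) / 2 + Lg"
  shows "l * (T U V \<bullet> D) \<le> c * (N + ((norm U)\<^sup>2 + (norm V)\<^sup>2) / 2 + Lg) + (a + b)"
proof -
  have bb: "bounded_bilinear T" using T by (simp add: bilinear_conv_bounded_bilinear)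
  have l1: "linear (T x)" for x using T by (simp add: bilinear_def)
  have l2: "linear (\<lambda>x. T x y)" for y using T by (simp add: bilinear_def)
  define Y where "Y z = T (fst z) (snd z)" for z
  have Ym[measurable]: "Y \<in> borel_measurable borel"
    unfolding Y_def by (intro borel_measurable_continuous_onI bounded_bilinear.continuous_on[OF bb] continuous_intros)
  have Yz: "Y ((U', V') + z) = T (U' + fst z) (V' + snd z)" for U' V' z by (simp add: Y_def)
  have i2: "integrable gauss (\<lambda>z. (norm (Y (w + z)))\<^sup>2)" for w
    unfolding Yz[of "fst w" "snd w", simplified] by (rule integrable_gauss_bilinear_square[OF T])
  have i1: "integrable gauss (\<lambda>z. norm (Y (w + z)))" for w
    using integrable_mult_of_squares[of "\<lambda>z. norm (Y (w + z))" gauss "\<lambda>_. 1"] i2 by simp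
  have nrm: "(norm (U, V))\<^sup>2 = (norm U)\<^sup>2 + (norm V)\<^sup>2" by (simp add: norm_Pair)
  have lin: "integrable gauss (\<lambda>z. norm (w + L z)) \<and> (\<integral>z. norm (w + L z) \<partial>gauss) \<le> k"
    if L: "linear L" and k: "(norm w)\<^sup>2 + (\<Sum>i\<in>Basis. (norm (L i))\<^sup>2) \<le> k\<^sup>2" "0 \<le> k"
    for L :: "'a \<times> 'b \<Rightarrow> 'c" and w k
  proof
    have [measurable]: "L \<in> borel_measurable borel"
      using L by (intro borel_measurable_continuous_onI linear_continuous_on) (simp add: linear_conv_bounded_linear)
    show "integrable gauss (\<lambda>z. norm (w + L z))"
      using integrable_mult_of_squares[of "\<lambda>z. norm (w + L z)" gauss "\<lambda>_. 1"]
        integrable_gauss_linear_square[OF L, of w] by simp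
    show "(\<integral>z. norm (w + L z) \<partial>gauss) \<le> k"
      by (rule gauss.integral_le_of_square_le)
        (use integrable_gauss_linear_square[OF L, of w] order_trans[OF integral_gauss_linear_square_le[OF L, of w] k(1)] k(2)
          in auto)
  qed
  have lU: "linear (\<lambda>z :: 'a \<times> 'b. T U (snd z))"
    using linear_compose[OF linear_snd l1[of U]] by (simp add: o_def)
  have lV: "linear (\<lambda>z :: 'a \<times> 'b. T (fst z) V)"
    using linear_compose[OF linear_fst l2[of V]] by (simp add: o_def)
  have A: "integrable gauss (\<lambda>z :: 'a \<times> 'b. norm (T U (V + snd z)))"
      "(\<integral>z. norm (T U (V + snd z)) \<partial>(gauss :: ('a \<times> 'b) measure)) \<le> a"
    using lin[OF lU, of "T U V" a] a by (simp_all add: sum_Basis_prod linear_0[OF l1] linear_add[OF l1])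
  have B: "integrable gauss (\<lambda>z :: 'a \<times> 'b. norm (T (U + fst z) V))"
      "(\<integral>z. norm (T (U + fst z) V) \<partial>(gauss :: ('a \<times> 'b) measure)) \<le> b"
    using lin[OF lV, of "T U V" b] b by (simp_all add: sum_Basis_prod linear_0[OF l2] linear_add[OF l2])
  have "l * (T U V \<bullet> D) \<le> c * (N + (norm (U, V))\<^sup>2 / 2 + Lg) + (a + b)"
  proof (rule pac_bayes_gauss[OF Ym _ i2 _ \<open>0 < c\<close>])
    show "(\<integral>\<^sup>+\<theta>. ennreal (exp (l * (sgn (Y \<theta>) \<bullet> D) - N)) \<partial>gauss) \<le> ennreal (exp Lg)"
      using Z by (simp add: Y_def)
    show "(\<integral>z. (norm (Y ((U, V) + z)))\<^sup>2 \<partial>gauss) \<le> c\<^sup>2"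
      unfolding Yz by (rule order_trans[OF integral_gauss_bilinear_square_le[OF T] c(1)])
    show "(\<integral>z. Y ((U, V) + z) \<bullet> D \<partial>gauss) = T U V \<bullet> D"
      unfolding Yz by (rule integral_gauss_bilinear[OF T])
    show "2 \<le> N + (norm (U, V))\<^sup>2 / 2 + Lg" using pos by (simp add: nrm)
    show "(\<integral>z. norm (Y ((U, V) + z)) * ((U, V) \<bullet> z) \<partial>gauss) \<le> a + b"
    proof (rule gauss_shift_derivative[OF Ym i2 i1, where C = "norm (T U V)"])
      fix s :: real assume s: "0 < s" "s < 1"
      let ?A = "\<lambda>z :: 'a \<times> 'b. norm (T U (V + snd z))" and ?B = "\<lambda>z :: 'a \<times> 'b. norm (T (U + fst z) V)"
      have "(\<integral>z. norm (Y ((U, V) + s *\<^sub>R (U, V) + z)) \<partial>gauss)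
          \<le> (\<integral>z. norm (Y ((U, V) + z)) + s * ?A z + s * ?B z + s\<^sup>2 * norm (T U V) \<partial>gauss)"
      proof (rule integral_mono)
        fix z :: "'a \<times> 'b"
        have "Y ((U, V) + s *\<^sub>R (U, V) + z) = Y ((U, V) + z) + s *\<^sub>R T U (V + snd z) + s *\<^sub>R T (U + fst z) V
            + s\<^sup>2 *\<^sub>R T U V"
          by (simp add: Y_def linear_add[OF l1] linear_add[OF l2] linear_scale[OF l1] linear_scale[OF l2]
              power2_eq_square algebra_simps)
        also have "norm \<dots> \<le> norm (Y ((U, V) + z)) + norm (s *\<^sub>R T U (V + snd z)) + norm (s *\<^sub>R T (U + fst z) V)
            + norm (s\<^sup>2 *\<^sub>R T U V)"
          by (intro norm_triangle_le add_mono order_refl)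
        finally show "norm (Y ((U, V) + s *\<^sub>R (U, V) + z))
            \<le> norm (Y ((U, V) + z)) + s * ?A z + s * ?B z + s\<^sup>2 * norm (T U V)"
          using s by simp
      qed (use i1 A B in auto)
      also have "\<dots> = (\<integral>z. norm (Y ((U, V) + z)) \<partial>gauss) + s * (\<integral>z. ?A z \<partial>gauss) + s * (\<integral>z. ?B z \<partial>gauss)
          + s\<^sup>2 * norm (T U V)"
        using i1 A(1) B(1) by simp
      also have "\<dots> \<le> (\<integral>z. norm (Y ((U, V) + z)) \<partial>gauss) + s * (a + b) + s\<^sup>2 * norm (T U V)"
        using A(2) B(2) s by (simp add: distrib_left add_mono mult_left_mono)
      finally show "(\<integral>z. norm (Y ((U, V) + s *\<^sub>R (U, V) + z)) \<partial>gauss)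
          \<le> (\<integral>z. norm (Y ((U, V) + z)) \<partial>gauss) + s * (a + b) + s\<^sup>2 * norm (T U V)" .
    qed
  qed
  then show ?thesis by (simp add: nrm)
qed

section \<open>Kronecker products\<close>

lemma sum_UNIV_prod: "(\<Sum>a\<in>UNIV. f a) = (\<Sum>i\<in>UNIV. \<Sum>k\<in>UNIV. f (i :: 'p::finite, k :: 'q::finite))"
  by (simp add: sum.cartesian_product UNIV_Times_UNIV[symmetric] del: UNIV_Times_UNIV)

lemma kronecker_mult: "kronecker A B ** kronecker C E = kronecker (A ** C) (B ** E)"
  by (simp add: vec_eq_iff kronecker_def matrix_matrix_mult_def sum_UNIV_prod sum_product mult_ac)

lemma inner_kronecker: "kronecker A B \<bullet> kronecker C E = (A \<bullet> C) * (B \<bullet> E)"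
proof -
  have "kronecker A B \<bullet> kronecker C E = (\<Sum>i\<in>UNIV. \<Sum>k\<in>UNIV. \<Sum>j\<in>UNIV. \<Sum>l\<in>UNIV.
      (A $ i $ j * C $ i $ j) * (B $ k $ l * E $ k $ l))"
    by (simp add: inner_vec_def kronecker_def sum_UNIV_prod mult_ac)
  also have "\<dots> = (\<Sum>i\<in>UNIV. \<Sum>k\<in>UNIV. (\<Sum>j\<in>UNIV. A $ i $ j * C $ i $ j) * (\<Sum>l\<in>UNIV. B $ k $ l * E $ k $ l))"
    by (simp only: sum_product)
  also have "\<dots> = (A \<bullet> C) * (B \<bullet> E)"
    by (simp add: inner_vec_def sum_product)
  finally show ?thesis .
qed

lemma transpose_kronecker: "transpose (kronecker A B) = kronecker (transpose A) (transpose B)"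
  by (simp add: vec_eq_iff kronecker_def transpose_def)

lemma trace_kronecker: "trace (kronecker A B) = trace A * trace B"
  by (simp add: trace_def kronecker_def sum_UNIV_prod sum_product)

lemma bilinear_kronecker: "bilinear kronecker"
  unfolding bilinear_def
  by (auto intro!: linearI simp: vec_eq_iff kronecker_def algebra_simps)

section \<open>Sums over matrix units and trace inequalities\<close>

lemma sum_Basis_matrix: "(\<Sum>E\<in>Basis. f E) = (\<Sum>i\<in>UNIV. \<Sum>j\<in>UNIV. f (axis i (axis j 1) :: real^'n^'m))"
proof -
  have inj: "inj (\<lambda>(i, j). axis i (axis j 1) :: real^'n^'m)"
    by (auto simp: inj_def axis_eq_axis)
  have "(Basis :: (real^'n^'m) set) = range (\<lambda>(i, j). axis i (axis j 1))"
    by (auto simp: Basis_vec_def)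
  then have "bij_betw (\<lambda>(i, j). axis i (axis j 1)) UNIV (Basis :: (real^'n^'m) set)"
    using inj by (simp add: bij_betw_def)
  from sum.reindex_bij_betw[OF this, of f]
  have "(\<Sum>E\<in>Basis. f E) = (\<Sum>p\<in>UNIV. f (case p of (i, j) \<Rightarrow> axis i (axis j 1)))" by simp
  also have "\<dots> = (\<Sum>i\<in>UNIV. \<Sum>j\<in>UNIV. f (axis i (axis j 1)))"
    by (simp add: sum.cartesian_product UNIV_Times_UNIV[symmetric] del: UNIV_Times_UNIV) (simp add: case_prod_beta)
  finally show ?thesis .
qed

lemma axis_axis_nth: "(axis i (axis j 1) :: real^'n^'m) $ a $ b = (if a = i \<and> b = j then 1 else 0)"
  by (simp add: axis_def)

lemma mult_axis_mult:
  "(A ** (axis i (axis j 1) :: real^'n^'m) ** B) $ a $ b = A $ a $ i * B $ j $ b"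
proof -
  have *: "(A ** (axis i (axis j 1) :: real^'n^'m)) $ a $ l = (if l = j then A $ a $ i else 0)" for l
    by (simp add: matrix_matrix_mult_def axis_axis_nth if_distrib cong: if_cong)
  have "(A ** (axis i (axis j 1) :: real^'n^'m) ** B) $ a $ b
      = (\<Sum>l\<in>UNIV. (A ** (axis i (axis j 1) :: real^'n^'m)) $ a $ l * B $ l $ b)"
    by (simp add: matrix_matrix_mult_def)
  also have "\<dots> = A $ a $ i * B $ j $ b"
    by (simp add: * if_distrib[of "\<lambda>x. x * _"] cong: if_cong)
  finally show ?thesis .
qed

lemma inner_axis_axis: "(axis i (axis j 1) :: real^'n^'m) \<bullet> A = A $ i $ j"
  by (simp add: inner_axis')

lemma transpose_axis_axis: "transpose (axis i (axis j 1) :: real^'n^'m) = axis j (axis i 1)"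
  by (simp add: vec_eq_iff transpose_def axis_axis_nth)

lemma sum_Basis_sandwich: "(\<Sum>E\<in>Basis. E \<bullet> (A ** E ** B)) = trace A * trace (B :: real^'n^'n)"
  by (simp add: sum_Basis_matrix inner_axis_axis mult_axis_mult trace_def sum_product)

text \<open>Transposing the outer matrix unit pairs entries of \<open>A\<close> with entries of
  \<open>B\<close>, so the product of traces becomes an inner product. It is the smaller of the two
  for matrices of large effective rank, which is the gain from symmetrising.\<close>

lemma sum_Basis_sandwich_transpose:
  fixes A B :: "real^'n^'n"
  shows "(\<Sum>E\<in>Basis. transpose E \<bullet> (A ** E ** B)) = A \<bullet> B"
proof -
  have "(\<Sum>E\<in>Basis. transpose E \<bullet> (A ** E ** B)) = (\<Sum>i\<in>UNIV. \<Sum>j\<in>UNIV. A $ j $ i * B $ j $ i)"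
    by (simp add: sum_Basis_matrix transpose_axis_axis inner_axis_axis mult_axis_mult)
  also have "\<dots> = A \<bullet> B" by (subst sum.swap) (simp add: inner_vec_def)
  finally show ?thesis .
qed

lemma norm_matrix_mul_le:
  fixes A :: "real^'n^'m" and B :: "real^'k^'n"
  shows "norm (A ** B) \<le> op_norm A * norm B"
proof -
  have "(norm (A ** B))\<^sup>2 = (\<Sum>b\<in>Basis. (norm (A *v (B *v b)))\<^sup>2)"
    by (simp add: power2_norm_eq_inner orthonormal_basis_matrix_inner[OF orthonormal_basis_Basis]
        matrix_vector_mul_assoc)
  also have "\<dots> \<le> (\<Sum>b\<in>Basis. (op_norm A * norm (B *v b))\<^sup>2)"
    by (intro sum_mono power_mono norm_matrix_vector_le_op_norm) simp
  also have "\<dots> = (op_norm A * norm B)\<^sup>2"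
    by (simp add: power_mult_distrib power2_norm_eq_inner orthonormal_basis_matrix_inner[OF orthonormal_basis_Basis]
        sum_distrib_left)
  finally show ?thesis
    by (rule power2_le_imp_le) (simp add: op_norm_nonneg)
qed

lemma norm_matrix_mul_right_le:
  fixes A :: "real^'n^'m" and B :: "real^'k^'n"
  shows "norm (A ** B) \<le> norm A * op_norm B"
proof -
  have "norm (A ** B) = norm (transpose B ** transpose A)"
    by (metis matrix_transpose_mul norm_transpose)
  also have "\<dots> \<le> op_norm (transpose B) * norm (transpose A)" by (rule norm_matrix_mul_le)
  also have "\<dots> \<le> op_norm B * norm A"
    by (simp add: norm_transpose mult_right_mono op_norm_transpose_le)
  finally show ?thesis by (simp add: mult.commute)
qed

lemma inner_sandwich_le:
  fixes A B :: "real^'n^'n"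
  shows "\<bar>X \<bullet> (A ** Y ** B)\<bar> \<le> op_norm A * op_norm B * (norm X * norm Y)"
proof -
  have "\<bar>X \<bullet> (A ** Y ** B)\<bar> \<le> norm X * norm (A ** Y ** B)" by (rule Cauchy_Schwarz_ineq2)
  also have "\<dots> \<le> norm X * ((op_norm A * norm Y) * op_norm B)"
    by (intro mult_left_mono order_trans[OF norm_matrix_mul_right_le] mult_right_mono norm_matrix_mul_le
        op_norm_nonneg) simp
  finally show ?thesis by (simp add: mult_ac)
qed

lemma op_norm_minus: "op_norm (- A) = op_norm A"
proof -
  have "(*v) (- A) = (\<lambda>x. - (A *v x))"
    by (auto simp: fun_eq_iff vec_eq_iff matrix_vector_mult_def sum_negf)
  then show ?thesis by (simp add: op_norm_def onorm_neg)
qed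

lemma inner_psd_le:
  assumes "psd A" shows "\<bar>A \<bullet> B\<bar> \<le> op_norm B * trace A"
  using inner_le_op_norm_nuclear_norm[of A B] inner_le_op_norm_nuclear_norm[of A "- B"] assms
  by (auto simp: nuclear_norm_psd op_norm_minus abs_le_iff)

lemma op_norm_pos: "A \<noteq> 0 \<Longrightarrow> 0 < op_norm A"
proof (rule ccontr)
  assume "A \<noteq> 0" "\<not> 0 < op_norm A"
  then have "op_norm A = 0" using op_norm_nonneg[of A] by simp
  then have "A *v x = 0" for x using norm_matrix_vector_le_op_norm[of A x] by simp
  then show False using \<open>A \<noteq> 0\<close> by (simp add: matrix_eq)
qed

lemma op_norm_le_norm: "op_norm A \<le> norm A"
proof (rule op_norm_leI)
  fix x
  have "(norm (A *v x))\<^sup>2 = (\<Sum>i\<in>UNIV. (A $ i \<bullet> x)\<^sup>2)"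
    unfolding power2_norm_eq_inner inner_vec_def[of "A *v x"]
    by (simp add: matrix_vector_mul_component power2_eq_square)
  also have "\<dots> \<le> (\<Sum>i\<in>UNIV. (norm (A $ i))\<^sup>2 * (norm x)\<^sup>2)"
    by (intro sum_mono) (metis Cauchy_Schwarz_ineq2 abs_ge_zero power2_abs power_mono power_mult_distrib)
  also have "\<dots> = (norm A)\<^sup>2 * (norm x)\<^sup>2"
    unfolding power2_norm_eq_inner[of A] inner_vec_def[of A] sum_distrib_right
    by (simp add: power2_norm_eq_inner)
  also have "\<dots> = (norm A * norm x)\<^sup>2" by (rule power_mult_distrib[symmetric])
  finally show "norm (A *v x) \<le> norm A * norm x" by (rule power2_le_imp_le) simp
qed

text \<open>The square of \<open>op_norm A\<close> is at most \<open>A \<bullet> A\<close>, which is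
  at most \<open>op_norm A * trace A\<close> by duality; one factor cancels.\<close>

lemma op_norm_le_trace:
  assumes "psd A" shows "op_norm A \<le> trace A"
proof (cases "A = 0")
  case False
  have "op_norm A * op_norm A \<le> norm A * norm A"
    by (intro mult_mono op_norm_le_norm op_norm_nonneg norm_ge_zero)
  also have "\<dots> = A \<bullet> A" by (simp add: dot_square_norm power2_eq_square)
  also have "\<dots> \<le> op_norm A * trace A" using inner_psd_le[OF assms, of A] by (simp add: abs_le_iff)
  finally show ?thesis using op_norm_pos[OF False] by simp
qed (use op_norm_le_norm[of A] in \<open>simp add: trace_def\<close>)

lemma effective_rank_ge_1: "psd A \<Longrightarrow> A \<noteq> 0 \<Longrightarrow> 1 \<le> effective_rank A"
  using op_norm_le_trace[of A] op_norm_pos[of A] by (simp add: effective_rank_def)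

lemma psd_trace_nonneg: "psd A \<Longrightarrow> 0 \<le> trace A"
  using op_norm_le_trace[of A] op_norm_nonneg[of A] by linarith

lemma inner_sandwich_unit_le:
  fixes A B :: "real^'n^'n"
  assumes "norm U = 1"
  shows "\<bar>U \<bullet> (A ** U ** B)\<bar> \<le> op_norm A * op_norm B"
    and "\<bar>transpose U \<bullet> (A ** U ** B)\<bar> \<le> op_norm A * op_norm B"
  using inner_sandwich_le[of U A U B] inner_sandwich_le[of "transpose U" A U B]
  by (simp_all add: norm_transpose assms)

text \<open>With \<open>r\<close> a bound on the effective ranks, the plain sum costs both traces
  and hence \<open>r^2\<close>, whereas the transposed sum costs only one trace and one operator
  norm, hence \<open>r\<close>.\<close>

lemma sandwich_Basis:
  fixes A B :: "real^'n^'n"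
  assumes "psd A" "psd B" "trace A \<le> op_norm A * r" "trace B \<le> op_norm B * r" "0 \<le> r"
  shows "\<bar>\<Sum>E\<in>Basis. E \<bullet> (A ** E ** B)\<bar> \<le> op_norm A * op_norm B * r\<^sup>2"
    and "\<bar>\<Sum>E\<in>Basis. transpose E \<bullet> (A ** E ** B)\<bar> \<le> op_norm A * op_norm B * r"
proof -
  have "trace A * trace B \<le> (op_norm A * r) * (op_norm B * r)"
    using assms by (intro mult_mono psd_trace_nonneg mult_nonneg_nonneg op_norm_nonneg) auto
  then show "\<bar>\<Sum>E\<in>Basis. E \<bullet> (A ** E ** B)\<bar> \<le> op_norm A * op_norm B * r\<^sup>2"
    unfolding sum_Basis_sandwich using assms
    by (simp add: abs_of_nonneg psd_trace_nonneg power2_eq_square mult_ac)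
  have "\<bar>A \<bullet> B\<bar> \<le> op_norm B * trace A" by (rule inner_psd_le) fact
  also have "\<dots> \<le> op_norm B * (op_norm A * r)" by (intro mult_left_mono assms op_norm_nonneg)
  finally show "\<bar>\<Sum>E\<in>Basis. transpose E \<bullet> (A ** E ** B)\<bar> \<le> op_norm A * op_norm B * r"
    unfolding sum_Basis_sandwich_transpose by (simp add: mult_ac)
qed

text \<open>For double sums over pairs of Kronecker terms: \<open>w\<close> and \<open>v\<close>
  will be the operator norms of the factors, so that the bound is \<open>s^2\<close> times the
  remaining factors.\<close>

lemma weighted_sum_le:
  fixes w v :: "nat \<Rightarrow> real"
  assumes "\<And>j. j \<in> J \<Longrightarrow> 0 \<le> w j" "\<And>j. j \<in> J \<Longrightarrow> 0 \<le> v j" "0 \<le> x" "0 \<le> y"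
    and F: "\<And>j k. j \<in> J \<Longrightarrow> k \<in> J \<Longrightarrow> \<bar>F j k\<bar> \<le> w j * w k * x"
    and G: "\<And>j k. j \<in> J \<Longrightarrow> k \<in> J \<Longrightarrow> \<bar>G j k\<bar> \<le> v j * v k * y"
  shows "(\<Sum>j\<in>J. \<Sum>k\<in>J. F j k * G j k) \<le> (\<Sum>j\<in>J. w j * v j)\<^sup>2 * (x * y)"
proof -
  have "(\<Sum>j\<in>J. \<Sum>k\<in>J. F j k * G j k) \<le> (\<Sum>j\<in>J. \<Sum>k\<in>J. (w j * w k * x) * (v j * v k * y))"
  proof (intro sum_mono)
    fix j k assume "j \<in> J" "k \<in> J"
    have "F j k * G j k \<le> \<bar>F j k\<bar> * \<bar>G j k\<bar>" by (metis abs_ge_self abs_mult)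
    also have "\<dots> \<le> (w j * w k * x) * (v j * v k * y)"
      using assms \<open>j \<in> J\<close> \<open>k \<in> J\<close> by (intro mult_mono) auto
    finally show "F j k * G j k \<le> (w j * w k * x) * (v j * v k * y)" .
  qed
  also have "\<dots> = (\<Sum>j\<in>J. w j * v j)\<^sup>2 * (x * y)"
    by (simp add: power2_eq_square sum_product sum_distrib_right sum_distrib_left mult_ac)
  finally show ?thesis .
qed

section \<open>Test matrices for a covariance that is a sum of Kronecker products\<close>

lemma linear_sandwich: "linear (\<lambda>W. A ** W ** (B :: real^'n^'m))"
  by (intro linearI) (simp_all add: matrix_add_ldistrib matrix_mul_add_left scaleR_matrix_mul_left scaleR_matrix_mul_right)

text \<open>This eliminates the root: norms of transformed test matrices depend on the covariance
  alone, whose Kronecker structure is known.\<close>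

lemma norm_sandwich_square:
  fixes S :: "real^'n^'n"
  assumes "transpose S = S" "S ** S = Sg"
  shows "(norm (S ** W ** S))\<^sup>2 = W \<bullet> (Sg ** W ** Sg)"
proof -
  have "(norm (S ** W ** S))\<^sup>2 = W \<bullet> (S ** ((S ** W ** S) ** S))"
    unfolding power2_norm_eq_inner inner_matrix_mul_right[of "S ** W" S] inner_matrix_mul_left[of S W]
    using assms by simp
  also have "S ** ((S ** W ** S) ** S) = (S ** S) ** W ** (S ** S)" by (simp add: matrix_mul_assoc)
  finally show ?thesis by (simp add: assms)
qed

text \<open>\<open>trPhi\<close> and \<open>trPsi\<close> bound the effective ranks by
  \<open>sqrt x\<close> and \<open>sqrt y\<close>, with the denominators multiplied out.
  \<open>S\<close> stands for the square root of the covariance.\<close>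

locale kronecker_cov =
  fixes Sg :: "real^('p::finite \<times> 'q::finite)^('p \<times> 'q)" and S :: "real^('p \<times> 'q)^('p \<times> 'q)"
    and \<Phi> :: "nat \<Rightarrow> real^'p^'p" and \<Psi> :: "nat \<Rightarrow> real^'q^'q" and K :: nat and x y :: real
  assumes S: "transpose S = S" "S ** S = Sg"
    and kron: "Sg = (\<Sum>j=1..K. kronecker (\<Phi> j) (\<Psi> j))"
    and Phi: "\<And>j. j \<in> {1..K} \<Longrightarrow> psd (\<Phi> j)" and Psi: "\<And>j. j \<in> {1..K} \<Longrightarrow> psd (\<Psi> j)"
    and trPhi: "\<And>j. j \<in> {1..K} \<Longrightarrow> trace (\<Phi> j) \<le> op_norm (\<Phi> j) * sqrt x"
    and trPsi: "\<And>j. j \<in> {1..K} \<Longrightarrow> trace (\<Psi> j) \<le> op_norm (\<Psi> j) * sqrt y"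
    and x: "1 \<le> x" and y: "1 \<le> y"
begin

definition s where "s = (\<Sum>j=1..K. op_norm (\<Phi> j) * op_norm (\<Psi> j))"

text \<open>Transports a test matrix for the error of the sample covariance to one for the whitened
  data, for which exponential moments are available.\<close>

definition tens :: "real^('p \<times> 'q)^('p \<times> 'q) \<Rightarrow> real^('p \<times> 'q)^('p \<times> 'q)" where
  "tens W = S ** W ** S"

text \<open>Symmetrising leaves the pairing with a symmetric error unchanged but reduces the
  norm.\<close>

definition symk :: "real^'p^'p \<Rightarrow> real^'q^'q \<Rightarrow> real^('p \<times> 'q)^('p \<times> 'q)" where
  "symk A B = tens ((1/2) *\<^sub>R (kronecker A B + transpose (kronecker A B)))"

lemma s_nonneg: "0 \<le> s" unfolding s_def by (intro sum_nonneg mult_nonneg_nonneg op_norm_nonneg)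

lemma transpose_Sg: "transpose Sg = Sg" using S by (metis matrix_transpose_mul)

lemma linear_tens: "linear tens" unfolding tens_def by (rule linear_sandwich)

lemma inner_kronecker_cov:
  "kronecker A B \<bullet> (Sg ** kronecker C E ** Sg)
    = (\<Sum>j=1..K. \<Sum>k=1..K. (A \<bullet> (\<Phi> j ** C ** \<Phi> k)) * (B \<bullet> (\<Psi> j ** E ** \<Psi> k)))"
proof -
  have "Sg ** kronecker C E ** Sg = (\<Sum>j=1..K. \<Sum>k=1..K. kronecker (\<Phi> j ** C ** \<Phi> k) (\<Psi> j ** E ** \<Psi> k))"
    unfolding kron sum_matrix_mul_left sum_matrix_mul_right kronecker_mult by (rule sum.swap)
  then show ?thesis by (simp add: inner_sum_right inner_kronecker)
qed

lemma norm_tens_kronecker_le: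
  assumes "norm U \<le> 1" "norm V \<le> 1" shows "norm (tens (kronecker U V)) \<le> s"
proof -
  have le: "norm X * norm X \<le> 1" if "norm X \<le> 1" for X :: "'c::real_normed_vector"
    using that mult_mono[of "norm X" 1 "norm X" 1] by simp
  have "(norm (tens (kronecker U V)))\<^sup>2
     = (\<Sum>j=1..K. \<Sum>k=1..K. (U \<bullet> (\<Phi> j ** U ** \<Phi> k)) * (V \<bullet> (\<Psi> j ** V ** \<Psi> k)))"
    unfolding tens_def norm_sandwich_square[OF S] by (rule inner_kronecker_cov)
  also have "\<dots> \<le> (\<Sum>j=1..K. op_norm (\<Phi> j) * op_norm (\<Psi> j))\<^sup>2 * (1 * 1)"
    using assms mult_mono[of "norm U" 1 "norm U" 1] mult_mono[of "norm V" 1 "norm V" 1]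
    by (intro weighted_sum_le op_norm_nonneg order_trans[OF inner_sandwich_le] mult_left_mono mult_nonneg_nonneg) auto
  finally show ?thesis using s_nonneg unfolding s_def[symmetric] by - (rule power2_le_imp_le, auto)
qed

lemma trace_Sg: "0 \<le> trace Sg" "trace Sg \<le> s * (sqrt x * sqrt y)"
proof -
  have tr: "trace Sg = (\<Sum>j=1..K. trace (\<Phi> j) * trace (\<Psi> j))"
    unfolding kron trace_eq_inner inner_sum_left by (simp add: trace_eq_inner[symmetric] trace_kronecker)
  show "0 \<le> trace Sg" unfolding tr using Phi Psi by (intro sum_nonneg mult_nonneg_nonneg psd_trace_nonneg) auto
  have "trace Sg \<le> (\<Sum>j=1..K. (op_norm (\<Phi> j) * sqrt x) * (op_norm (\<Psi> j) * sqrt y))"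
    unfolding tr using Phi Psi x y
    by (intro sum_mono mult_mono trPhi trPsi mult_nonneg_nonneg psd_trace_nonneg op_norm_nonneg) auto
  also have "\<dots> = s * (sqrt x * sqrt y)" unfolding s_def by (simp add: sum_distrib_left sum_distrib_right mult_ac)
  finally show "trace Sg \<le> s * (sqrt x * sqrt y)" .
qed

lemma sum_tens_le: "(\<Sum>E\<in>Basis. (norm (tens E))\<^sup>2) \<le> s\<^sup>2 * (x * y)"
proof -
  have "(\<Sum>E\<in>Basis. (norm (tens E))\<^sup>2) = (trace Sg)\<^sup>2"
    unfolding tens_def norm_sandwich_square[OF S] sum_Basis_sandwich by (simp add: power2_eq_square)
  also have "\<dots> \<le> (s * (sqrt x * sqrt y))\<^sup>2" by (intro power_mono trace_Sg)
  also have "\<dots> = s\<^sup>2 * (x * y)" using x y by (simp add: power_mult_distrib)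
  finally show ?thesis .
qed

lemma bilinear_symk: "bilinear symk"
proof -
  have l1: "linear (kronecker A)" for A :: "real^'p^'p"
    by (rule bilinear_kronecker[unfolded bilinear_def, THEN conjunct1, rule_format])
  have l2: "linear (\<lambda>A. kronecker A B)" for B :: "real^'q^'q"
    by (rule bilinear_kronecker[unfolded bilinear_def, THEN conjunct2, rule_format])
  have lt: "linear (\<lambda>M :: real^('p \<times> 'q)^('p \<times> 'q). tens ((1/2) *\<^sub>R (M + transpose M)))"
    using linear_compose[OF _ linear_tens, of "\<lambda>M. (1/2) *\<^sub>R (M + transpose M)"]
    by (simp add: o_def linear_iff vec_eq_iff transpose_def algebra_simps)
  show ?thesis
    unfolding bilinear_def symk_def
    using linear_compose[OF l1 lt] linear_compose[OF l2 lt] by (auto simp: o_def)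
qed

text \<open>In the quadratic form of the symmetrised matrix the two diagonal terms agree, and so do
  the two mixed ones, because \<open>Sg\<close> is symmetric. What remains is the average of one of
  each, and transposing a Kronecker product transposes both factors.\<close>

lemma norm_symk:
  "(norm (symk A B))\<^sup>2 = (1/2) * (\<Sum>j=1..K. \<Sum>k=1..K.
      (A \<bullet> (\<Phi> j ** A ** \<Phi> k)) * (B \<bullet> (\<Psi> j ** B ** \<Psi> k))
    + (transpose A \<bullet> (\<Phi> j ** A ** \<Phi> k)) * (transpose B \<bullet> (\<Psi> j ** B ** \<Psi> k)))"
proof -
  define M where "M = kronecker A B"
  define q where "q X Y = X \<bullet> (Sg ** Y ** Sg)" for X Y
  have qt: "q (transpose X) (transpose Y) = q X Y" for X Y
  proof -
    have "Sg ** transpose Y ** Sg = transpose (Sg ** Y ** Sg)"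
      using transpose_Sg by (simp add: matrix_transpose_mul matrix_mul_assoc)
    then show ?thesis by (simp add: q_def inner_transpose)
  qed
  have "(norm (symk A B))\<^sup>2 = q ((1/2) *\<^sub>R (M + transpose M)) ((1/2) *\<^sub>R (M + transpose M))"
    unfolding symk_def tens_def M_def q_def by (rule norm_sandwich_square[OF S])
  also have "\<dots> = (1/4) * (q M M + q M (transpose M) + q (transpose M) M + q (transpose M) (transpose M))"
  proof -
    have "q (X + Y) Z = q X Z + q Y Z" "q Z (X + Y) = q Z X + q Z Y"
      "q (c *\<^sub>R X) Y = c * q X Y" "q X (c *\<^sub>R Y) = c * q X Y" for X Y Z c
      by (simp_all add: q_def matrix_add_ldistrib matrix_mul_add_left scaleR_matrix_mul_left scaleR_matrix_mul_right
          inner_add_left inner_add_right)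
    note q = this
    have "1/2 * (1/2 * (a + b) + 1/2 * (c + d)) = 1/4 * (a + c + b + d)" for a b c d :: real
      by (simp add: field_simps)
    then show ?thesis by (simp only: q)
  qed
  also have "q M (transpose M) = q (transpose M) M" using qt[of "transpose M" M] by simp
  also have "q (transpose M) (transpose M) = q M M" by (rule qt)
  finally have "(norm (symk A B))\<^sup>2 = (1/2) * (q M M + q (transpose M) M)" by simp
  then show ?thesis
    unfolding q_def M_def transpose_kronecker inner_kronecker_cov by (simp add: sum.distrib)
qed

text \<open>Stated for families so that one lemma covers a fixed matrix (a one-point index set) and
  Gaussian noise (the standard basis) in either factor. The bounds \<open>x1\<close>,
  \<open>y1\<close> belong to the plain terms and \<open>x2\<close>, \<open>y2\<close> to the
  transposed ones.\<close>

lemma sum_norm_symk_le: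
  assumes fin: "finite I" "finite L" and nn: "0 \<le> x1" "0 \<le> x2" "0 \<le> y1" "0 \<le> y2"
    and f: "\<And>j k. j \<in> {1..K} \<Longrightarrow> k \<in> {1..K} \<Longrightarrow>
        \<bar>\<Sum>i\<in>I. f i \<bullet> (\<Phi> j ** f i ** \<Phi> k)\<bar> \<le> op_norm (\<Phi> j) * op_norm (\<Phi> k) * x1"
      "\<And>j k. j \<in> {1..K} \<Longrightarrow> k \<in> {1..K} \<Longrightarrow>
        \<bar>\<Sum>i\<in>I. transpose (f i) \<bullet> (\<Phi> j ** f i ** \<Phi> k)\<bar> \<le> op_norm (\<Phi> j) * op_norm (\<Phi> k) * x2"
    and g: "\<And>j k. j \<in> {1..K} \<Longrightarrow> k \<in> {1..K} \<Longrightarrow>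
        \<bar>\<Sum>l\<in>L. g l \<bullet> (\<Psi> j ** g l ** \<Psi> k)\<bar> \<le> op_norm (\<Psi> j) * op_norm (\<Psi> k) * y1"
      "\<And>j k. j \<in> {1..K} \<Longrightarrow> k \<in> {1..K} \<Longrightarrow>
        \<bar>\<Sum>l\<in>L. transpose (g l) \<bullet> (\<Psi> j ** g l ** \<Psi> k)\<bar> \<le> op_norm (\<Psi> j) * op_norm (\<Psi> k) * y2"
  shows "(\<Sum>l\<in>L. \<Sum>i\<in>I. (norm (symk (f i) (g l)))\<^sup>2) \<le> s\<^sup>2 * ((x1 * y1 + x2 * y2) / 2)"
proof -
  let ?F = "\<lambda>j k i. f i \<bullet> (\<Phi> j ** f i ** \<Phi> k)" and ?F' = "\<lambda>j k i. transpose (f i) \<bullet> (\<Phi> j ** f i ** \<Phi> k)"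
  let ?G = "\<lambda>j k l. g l \<bullet> (\<Psi> j ** g l ** \<Psi> k)" and ?G' = "\<lambda>j k l. transpose (g l) \<bullet> (\<Psi> j ** g l ** \<Psi> k)"
  have swap: "(\<Sum>l\<in>L. \<Sum>i\<in>I. \<Sum>j=1..K. \<Sum>k=1..K. a j k i * b j k l)
      = (\<Sum>j=1..K. \<Sum>k=1..K. (\<Sum>i\<in>I. a j k i) * (\<Sum>l\<in>L. b j k l))" for a b :: "nat \<Rightarrow> nat \<Rightarrow> _ \<Rightarrow> real"
  proof -
    have "(\<Sum>l\<in>L. \<Sum>i\<in>I. \<Sum>j=1..K. \<Sum>k=1..K. a j k i * b j k l)
        = (\<Sum>l\<in>L. \<Sum>j=1..K. \<Sum>i\<in>I. \<Sum>k=1..K. a j k i * b j k l)"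
      by (rule sum.cong[OF refl], rule sum.swap)
    also have "\<dots> = (\<Sum>l\<in>L. \<Sum>j=1..K. \<Sum>k=1..K. \<Sum>i\<in>I. a j k i * b j k l)"
      by (rule sum.cong[OF refl], rule sum.cong[OF refl], rule sum.swap)
    also have "\<dots> = (\<Sum>j=1..K. \<Sum>l\<in>L. \<Sum>k=1..K. \<Sum>i\<in>I. a j k i * b j k l)" by (rule sum.swap)
    also have "\<dots> = (\<Sum>j=1..K. \<Sum>k=1..K. \<Sum>l\<in>L. \<Sum>i\<in>I. a j k i * b j k l)"
      by (rule sum.cong[OF refl], rule sum.swap)
    also have "\<dots> = (\<Sum>j=1..K. \<Sum>k=1..K. (\<Sum>i\<in>I. a j k i) * (\<Sum>l\<in>L. b j k l))"
      by (rule sum.cong[OF refl], rule sum.cong[OF refl], subst sum_product, rule sum.swap)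
    finally show ?thesis .
  qed
  have "(\<Sum>l\<in>L. \<Sum>i\<in>I. (norm (symk (f i) (g l)))\<^sup>2)
      = (1/2) * ((\<Sum>l\<in>L. \<Sum>i\<in>I. \<Sum>j=1..K. \<Sum>k=1..K. ?F j k i * ?G j k l)
        + (\<Sum>l\<in>L. \<Sum>i\<in>I. \<Sum>j=1..K. \<Sum>k=1..K. ?F' j k i * ?G' j k l))"
    unfolding norm_symk by (simp only: sum.distrib sum_distrib_left[symmetric])
  also have "\<dots> \<le> (1/2) * (s\<^sup>2 * (x1 * y1) + s\<^sup>2 * (x2 * y2))"
    unfolding swap s_def using nn f g
    by (intro mult_left_mono add_mono weighted_sum_le op_norm_nonneg) auto
  finally show ?thesis by (simp add: algebra_simps)
qed

end

lemma sgn_scaleR_pos: "0 < c \<Longrightarrow> sgn (c *\<^sub>R v) = sgn (v :: 'a::real_normed_vector)"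
  by (simp add: sgn_div_norm)

lemma norm_kronecker: "norm (kronecker A B) = norm A * norm B"
  by (simp add: norm_eq_sqrt_inner inner_kronecker real_sqrt_mult)

context kronecker_cov
begin

lemma tens_deviation_bound:
  assumes Z: "(\<integral>\<^sup>+\<theta>. ennreal (exp (l * (sgn (tens \<theta>) \<bullet> D) - N)) \<partial>gauss) \<le> ennreal (exp Lg)"
    and "0 < s" and U: "norm U = 1" and V: "norm V = 1" and "2 \<le> N" "0 \<le> Lg"
  shows "l * (tens (kronecker U V) \<bullet> D) \<le> s * (sqrt 3 * (N + x * y / 4 + Lg) + 1)"
proof -
  \<comment> \<open>The noise level is chosen so that the noise contributes \<open>2 * s^2\<close>
    to the second moment, on top of \<open>s^2\<close> from the mean. The price is the term
    \<open>(norm u)^2 / 2 = x * y / 4\<close>. Rescaling does not affect \<open>sgn\<close>, so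
    \<open>Z\<close> still applies.\<close>
  define \<sigma> where "\<sigma> = sqrt (2 / (x * y))"
  have xy: "0 < x * y" using x y by simp
  have \<sigma>: "0 < \<sigma>" "\<sigma>\<^sup>2 = 2 / (x * y)" using xy by (auto simp: \<sigma>_def)
  define T where "T \<theta> = \<sigma> *\<^sub>R tens \<theta>" for \<theta>
  define u where "u = (1 / \<sigma>) *\<^sub>R kronecker U V"
  have lT: "linear T" unfolding T_def by (intro linear_compose_scale_right linear_tens)
  have Tu: "T u = tens (kronecker U V)"
    using \<sigma> by (simp add: T_def u_def linear_scale[OF linear_tens])
  have nu: "(norm u)\<^sup>2 / 2 = x * y / 4"
    using \<sigma> xy by (simp add: u_def norm_kronecker U V power_divide)
  have nT: "norm (T u) \<le> s" unfolding Tu using norm_tens_kronecker_le[of U V] U V by simp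
  have "(\<Sum>i\<in>Basis. (norm (T i))\<^sup>2) = \<sigma>\<^sup>2 * (\<Sum>i\<in>Basis. (norm (tens i))\<^sup>2)"
    by (simp add: T_def power_mult_distrib sum_distrib_left)
  also have "\<dots> \<le> \<sigma>\<^sup>2 * (s\<^sup>2 * (x * y))" by (intro mult_left_mono sum_tens_le) simp
  also have "\<dots> = 2 * s\<^sup>2" using \<sigma> x y by simp
  finally have "(norm (T u))\<^sup>2 + (\<Sum>i\<in>Basis. (norm (T i))\<^sup>2) \<le> s\<^sup>2 + 2 * s\<^sup>2"
    using nT by (intro add_mono power_mono) auto
  also have "\<dots> = (sqrt 3 * s)\<^sup>2" by (simp add: power_mult_distrib)
  finally have c: "(norm (T u))\<^sup>2 + (\<Sum>i\<in>Basis. (norm (T i))\<^sup>2) \<le> (sqrt 3 * s)\<^sup>2" .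
  have "l * (T u \<bullet> D) \<le> sqrt 3 * s * (N + (norm u)\<^sup>2 / 2 + Lg) + norm (T u)"
  proof (rule pac_bayes_linear[OF lT _ c])
    show "(\<integral>\<^sup>+\<theta>. ennreal (exp (l * (sgn (T \<theta>) \<bullet> D) - N)) \<partial>gauss) \<le> ennreal (exp Lg)"
      unfolding T_def sgn_scaleR_pos[OF \<sigma>(1)] by (rule Z)
    show "0 < sqrt 3 * s" using \<open>0 < s\<close> by simp
    show "2 \<le> N + (norm u)\<^sup>2 / 2 + Lg" using assms by (simp add: add_increasing2)
  qed
  then show ?thesis using nT unfolding Tu nu by (simp add: algebra_simps)
qed

lemma symk_deviation_bound:
  assumes Z: "(\<integral>\<^sup>+\<theta>. ennreal (exp (l * (sgn (symk (fst \<theta>) (snd \<theta>)) \<bullet> D) - N)) \<partial>gauss) \<le> ennreal (exp Lg)"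
    and "0 < s" and U: "norm U = 1" and V: "norm V = 1" and "2 \<le> N" "0 \<le> Lg"
    and small: "(1 + 1 / sqrt x) * (1 + 1 / sqrt y) \<le> 9 / 4"
  shows "l * (symk U V \<bullet> D) \<le> s * (sqrt (25/8) * (N + (x + y) / 2 + Lg)
    + (sqrt (3/2 + 1 / sqrt y / 2) + sqrt (3/2 + 1 / sqrt x / 2)))"
proof -
  \<comment> \<open>The noise in the two factors is scaled by \<open>a\<close> and \<open>b\<close>.
    Equivalently the shifts are \<open>sqrt x *\<^sub>R U\<close> and
    \<open>sqrt y *\<^sub>R V\<close>, which cost \<open>(x + y) / 2\<close> in the
    exponent.\<close>
  define a where "a = 1 / sqrt x"
  define b where "b = 1 / sqrt y"
  have x0: "0 < x" and y0: "0 < y" using x y by auto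
  have a: "0 < a" "a * sqrt x = 1" "a\<^sup>2 * x = 1" and b: "0 < b" "b * sqrt y = 1" "b\<^sup>2 * y = 1"
    using x0 y0 by (auto simp: a_def b_def power_divide)
  define T where "T A B = (a * b) *\<^sub>R symk A B" for A B
  have l1: "linear (symk A)" for A using bilinear_symk by (simp add: bilinear_def)
  have l2: "linear (\<lambda>A. symk A B)" for B using bilinear_symk by (simp add: bilinear_def)
  have bT: "bilinear T"
    unfolding bilinear_def T_def by (intro conjI allI linear_compose_scale_right l1 l2)
  have TUV: "T (sqrt x *\<^sub>R U) (sqrt y *\<^sub>R V) = symk U V"
    using a(2) b(2) by (simp add: T_def linear_scale[OF l1] linear_scale[OF l2] mult_ac)
  have TU: "T (sqrt x *\<^sub>R U) B = b *\<^sub>R symk U B" for B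
    using a(2) by (simp add: T_def linear_scale[OF l2] mult_ac) 
  have TV: "T A (sqrt y *\<^sub>R V) = a *\<^sub>R symk A V" for A
    using b(2) by (simp add: T_def linear_scale[OF l1] mult_ac) 
  note Ph = sandwich_Basis[OF Phi Phi trPhi trPhi] and Ps = sandwich_Basis[OF Psi Psi trPsi trPsi]
  have sx: "0 \<le> sqrt x" "(sqrt x)\<^sup>2 = x" and sy: "0 \<le> sqrt y" "(sqrt y)\<^sup>2 = y" using x0 y0 by auto
  have e0: "(norm (symk U V))\<^sup>2 \<le> s\<^sup>2"
    using sum_norm_symk_le[of "{0::nat}" "{0::nat}" 1 1 1 1 "\<lambda>_. U" "\<lambda>_. V"]
      inner_sandwich_unit_le[OF U] inner_sandwich_unit_le[OF V] by simp
  have eU: "(\<Sum>j\<in>Basis. (norm (T (sqrt x *\<^sub>R U) j))\<^sup>2) \<le> s\<^sup>2 * ((1 + b) / 2)"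
  proof -
    have "(\<Sum>j\<in>Basis. (norm (T (sqrt x *\<^sub>R U) j))\<^sup>2) = b\<^sup>2 * (\<Sum>j\<in>Basis. \<Sum>i\<in>{0::nat}. (norm (symk U j))\<^sup>2)"
      by (simp add: TU power_mult_distrib sum_distrib_left)
    also have "\<dots> \<le> b\<^sup>2 * (s\<^sup>2 * ((1 * (sqrt y)\<^sup>2 + 1 * sqrt y) / 2))"
      using inner_sandwich_unit_le[OF U] Ps sy
      by (intro mult_left_mono sum_norm_symk_le) auto
    also have "\<dots> = s\<^sup>2 * ((b\<^sup>2 * y + b * (b * sqrt y)) / 2)"
      unfolding sy(2) by (simp add: algebra_simps power2_eq_square)
    finally show ?thesis by (simp add: b)
  qed
  have eV: "(\<Sum>i\<in>Basis. (norm (T i (sqrt y *\<^sub>R V)))\<^sup>2) \<le> s\<^sup>2 * ((1 + a) / 2)"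
  proof -
    have "(\<Sum>i\<in>Basis. (norm (T i (sqrt y *\<^sub>R V)))\<^sup>2) = a\<^sup>2 * (\<Sum>j\<in>{0::nat}. \<Sum>i\<in>Basis. (norm (symk i V))\<^sup>2)"
      by (simp add: TV power_mult_distrib sum_distrib_left)
    also have "\<dots> \<le> a\<^sup>2 * (s\<^sup>2 * (((sqrt x)\<^sup>2 * 1 + sqrt x * 1) / 2))"
      using inner_sandwich_unit_le[OF V] Ph sx
      by (intro mult_left_mono sum_norm_symk_le) auto
    also have "\<dots> = s\<^sup>2 * ((a\<^sup>2 * x + a * (a * sqrt x)) / 2)"
      unfolding sx(2) by (simp add: algebra_simps power2_eq_square)
    finally show ?thesis by (simp add: a)
  qed
  have eUV: "(\<Sum>j\<in>Basis. \<Sum>i\<in>Basis. (norm (T i j))\<^sup>2) \<le> s\<^sup>2 * ((1 + a * b) / 2)"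
  proof -
    have "(\<Sum>j\<in>Basis. \<Sum>i\<in>Basis. (norm (T i j))\<^sup>2) = (a * b)\<^sup>2 * (\<Sum>j\<in>Basis. \<Sum>i\<in>Basis. (norm (symk i j))\<^sup>2)"
      by (simp add: T_def power_mult_distrib sum_distrib_left)
    also have "\<dots> \<le> (a * b)\<^sup>2 * (s\<^sup>2 * (((sqrt x)\<^sup>2 * (sqrt y)\<^sup>2 + sqrt x * sqrt y) / 2))"
      using Ph Ps sx sy by (intro mult_left_mono sum_norm_symk_le) auto
    also have "\<dots> = s\<^sup>2 * (((a\<^sup>2 * x) * (b\<^sup>2 * y) + (a * b) * (a * sqrt x) * (b * sqrt y)) / 2)"
      unfolding sx(2) sy(2) by (simp add: algebra_simps power2_eq_square)
    finally show ?thesis by (simp add: a b)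
  qed
  have "l * (T (sqrt x *\<^sub>R U) (sqrt y *\<^sub>R V) \<bullet> D)
      \<le> sqrt (25/8) * s * (N + ((norm (sqrt x *\<^sub>R U))\<^sup>2 + (norm (sqrt y *\<^sub>R V))\<^sup>2) / 2 + Lg)
        + (sqrt (3/2 + b/2) * s + sqrt (3/2 + a/2) * s)"
  proof (rule pac_bayes_bilinear[OF bT])
    have "0 < a * b" using a b by simp
    then show "(\<integral>\<^sup>+\<theta>. ennreal (exp (l * (sgn (T (fst \<theta>) (snd \<theta>)) \<bullet> D) - N)) \<partial>gauss) \<le> ennreal (exp Lg)"
      unfolding T_def using Z by (simp add: sgn_scaleR_pos)
    \<comment> \<open>Mean, noise in one factor, noise in the other, noise in both. The sum
      factorises, and the assumption \<open>small\<close> turns it into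
      \<open>2 + 9 / 8 = 25 / 8\<close>.\<close>
    have "s\<^sup>2 + s\<^sup>2 * ((1 + b) / 2) + (s\<^sup>2 * ((1 + a) / 2) + s\<^sup>2 * ((1 + a * b) / 2))
        = s\<^sup>2 * (2 + ((1 + a) * (1 + b)) / 2)" by (simp add: field_simps)
    also have "\<dots> \<le> s\<^sup>2 * (25/8)" using small by (intro mult_left_mono) (auto simp: a_def b_def)
    also have "\<dots> = (sqrt (25/8) * s)\<^sup>2" by (simp add: power_mult_distrib)
    finally show "(norm (T (sqrt x *\<^sub>R U) (sqrt y *\<^sub>R V)))\<^sup>2 + (\<Sum>j\<in>Basis. (norm (T (sqrt x *\<^sub>R U) j))\<^sup>2)
      + ((\<Sum>i\<in>Basis. (norm (T i (sqrt y *\<^sub>R V)))\<^sup>2) + (\<Sum>j\<in>Basis. \<Sum>i\<in>Basis. (norm (T i j))\<^sup>2))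
      \<le> (sqrt (25/8) * s)\<^sup>2"
      using e0 eU eV eUV unfolding TUV by linarith
    show "0 < sqrt (25/8) * s" using \<open>0 < s\<close> by simp
    have "s\<^sup>2 + s\<^sup>2 * ((1 + b) / 2) = (sqrt (3/2 + b/2) * s)\<^sup>2"
      using b(1) by (simp add: power_mult_distrib field_simps)
    then show "(norm (T (sqrt x *\<^sub>R U) (sqrt y *\<^sub>R V)))\<^sup>2 + (\<Sum>j\<in>Basis. (norm (T (sqrt x *\<^sub>R U) j))\<^sup>2)
        \<le> (sqrt (3/2 + b/2) * s)\<^sup>2"
      using e0 eU unfolding TUV by linarith
    have "s\<^sup>2 + s\<^sup>2 * ((1 + a) / 2) = (sqrt (3/2 + a/2) * s)\<^sup>2"
      using a(1) by (simp add: power_mult_distrib field_simps)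
    then show "(norm (T (sqrt x *\<^sub>R U) (sqrt y *\<^sub>R V)))\<^sup>2 + (\<Sum>i\<in>Basis. (norm (T i (sqrt y *\<^sub>R V)))\<^sup>2)
        \<le> (sqrt (3/2 + a/2) * s)\<^sup>2"
      using e0 eV unfolding TUV by linarith
    show "0 \<le> sqrt (3/2 + b/2) * s" "0 \<le> sqrt (3/2 + a/2) * s" using a b s_nonneg by auto
    show "2 \<le> N + ((norm (sqrt x *\<^sub>R U))\<^sup>2 + (norm (sqrt y *\<^sub>R V))\<^sup>2) / 2 + Lg"
      using \<open>2 \<le> N\<close> \<open>0 \<le> Lg\<close> by (simp add: add_increasing2)
  qed
  then show ?thesis
    unfolding TUV using x0 y0 by (simp add: U V a_def b_def power_mult_distrib algebra_simps)
qed

end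

section \<open>The deviation event\<close>

lemma ln_4_ge: "4 / 3 \<le> ln (4 :: real)"
proof -
  have "ln (4 :: real) = 2 * ln 2" using ln_realpow[of "2 :: real" 2] by simp
  then show ?thesis using ln2_ge_two_thirds by simp
qed

text \<open>The assumption \<open>large\<close> forces \<open>1 / x + 1 / y \<ge> 1 / 2\<close>,
  that is \<open>x * y / 4 \<le> (x + y) / 2\<close>. Then the bracket is at most
  \<open>2 * T - ln 4\<close>; the part \<open>sqrt 3 * ln 4\<close> pays for the summand 1, and
  \<open>2 * sqrt 3 = sqrt 12\<close>.\<close>

lemma tens_constant_le:
  fixes x y L :: real
  assumes x: "1 \<le> x" and y: "1 \<le> y" and "0 \<le> L" and large: "9 / 4 \<le> (1 + 1 / sqrt x) * (1 + 1 / sqrt y)"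
  defines "T \<equiv> (x + y) / 2 + ln 4 + L"
  shows "sqrt 3 * (T + x * y / 4 + L) + 1 \<le> sqrt 13 * T"
proof -
  define a where "a = 1 / sqrt x"
  define b where "b = 1 / sqrt y"
  have a: "0 < a" "a\<^sup>2 = 1 / x" and b: "0 < b" "b\<^sup>2 = 1 / y" using x y by (auto simp: a_def b_def power_divide)
  have "1 / 2 \<le> a\<^sup>2 + b\<^sup>2"
  proof (rule ccontr)
    assume "\<not> 1 / 2 \<le> a\<^sup>2 + b\<^sup>2"
    then have lt: "a\<^sup>2 + b\<^sup>2 < 1 / 2" by simp
    have "(a + b)\<^sup>2 \<le> 2 * (a\<^sup>2 + b\<^sup>2)" using sum_squares_ge_zero[of "a - b" 0] by (simp add: power2_eq_square algebra_simps)
    also have "\<dots> < 1\<^sup>2" using lt by simp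
    finally have ab: "a + b < 1" by (rule power2_less_imp_less) simp
    have "4 * (a * b) \<le> 2 * (a\<^sup>2 + b\<^sup>2)" using sum_squares_ge_zero[of "a - b" 0] by (simp add: power2_eq_square algebra_simps)
    then have "a * b < 1 / 4" using lt by simp
    with ab have "(1 + a) * (1 + b) < 9 / 4" by (simp add: algebra_simps)
    with large show False by (simp add: a_def b_def)
  qed
  then have "x * y * (1 / 2) \<le> x * y * (1 / x + 1 / y)" using x y by (intro mult_left_mono) (auto simp: a b)
  also have "\<dots> = x + y" using x y by (simp add: field_simps)
  finally have xy: "x * y / 4 \<le> (x + y) / 2" by simp
  have T: "0 \<le> T" using assms ln_4_ge by (simp add: T_def)
  have s3: "3/2 \<le> sqrt 3" by (rule real_le_rsqrt) (simp add: power2_eq_square)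
  have s12: "2 * sqrt 3 \<le> sqrt 13" by (rule real_le_rsqrt) (simp add: power_mult_distrib)
  have "T = (x + y) / 2 + ln 4 + L" by (simp add: T_def)
  then have "T + x * y / 4 + L \<le> 2 * T - ln 4" using xy by argo
  then have "sqrt 3 * (T + x * y / 4 + L) + 1 \<le> sqrt 3 * (2 * T - ln 4) + 1" by simp
  also have "\<dots> \<le> sqrt 3 * (2 * T - ln 4) + sqrt 3 * ln 4"
    using mult_mono[OF s3 ln_4_ge] by simp
  also have "\<dots> = (2 * sqrt 3) * T" by (simp add: algebra_simps)
  also have "\<dots> \<le> sqrt 13 * T" by (intro mult_right_mono s12 T)
  finally show ?thesis .
qed

text \<open>The assumption \<open>small\<close> forces \<open>x * y \<ge> 16\<close>, hence
  \<open>x + y \<ge> 8\<close> and \<open>T \<ge> 16 / 3\<close>. As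
  \<open>2 * sqrt (25/8) = sqrt (25/2)\<close> is slightly below \<open>sqrt 13\<close>, a
  \<open>T\<close> of this size makes the difference, together with the saved \<open>ln 4\<close>,
  large enough for the remaining square roots.\<close>

lemma symk_constant_le:
  fixes x y L :: real
  assumes x: "1 \<le> x" and y: "1 \<le> y" and "0 \<le> L" and small: "(1 + 1 / sqrt x) * (1 + 1 / sqrt y) \<le> 9 / 4"
  defines "T \<equiv> (x + y) / 2 + ln 4 + L"
  shows "sqrt (25/8) * (T + (x + y) / 2 + L) + (sqrt (3/2 + 1 / sqrt y / 2) + sqrt (3/2 + 1 / sqrt x / 2))
    \<le> sqrt 13 * T"
proof -
  define a where "a = 1 / sqrt x"
  define b where "b = 1 / sqrt y"
  have a: "0 < a" "a\<^sup>2 = 1 / x" and b: "0 < b" "b\<^sup>2 = 1 / y" using x y by (auto simp: a_def b_def power_divide)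
  have sm: "a + b + a * b \<le> 5 / 4" using small by (simp add: a_def[symmetric] b_def[symmetric] algebra_simps)
  have ab: "a + b \<le> 5 / 4" using sm mult_pos_pos[OF a(1) b(1)] by linarith
  have "a * b \<le> 1 / 4"
  proof (rule ccontr)
    assume "\<not> a * b \<le> 1 / 4"
    then have gt: "1 / 4 < a * b" by simp
    then have "1\<^sup>2 < 4 * (a * b)" by simp
    also have "\<dots> \<le> (a + b)\<^sup>2" using sum_squares_ge_zero[of "a - b" 0] by (simp add: power2_eq_square algebra_simps)
    finally have "1 < a + b" by (rule power2_less_imp_less) (use a b in simp)
    with gt sm show False by simp
  qed
  then have "16 * (a * b)\<^sup>2 \<le> 1" using a b power_mono[of "a * b" "1/4" 2] by (simp add: power2_eq_square)
  then have "16 \<le> x * y" using x y by (simp add: power_mult_distrib a b field_simps)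
  then have "4\<^sup>2 * 4 \<le> 4 * (x * y)" by simp
  also have "\<dots> \<le> (x + y)\<^sup>2" using sum_squares_ge_zero[of "x - y" 0] by (simp add: power2_eq_square algebra_simps)
  finally have "8\<^sup>2 \<le> (x + y)\<^sup>2" by simp
  then have xy: "8 \<le> x + y" by (rule power2_le_imp_le) (use x y in simp)
  have T: "16 / 3 \<le> T" using xy ln_4_ge \<open>0 \<le> L\<close> unfolding T_def add_divide_distrib by linarith
  \<comment> \<open>The numeral is the square root of \<open>6 + 5 / 4\<close>, rounded up.\<close>
  have tau: "sqrt (3/2 + b/2) + sqrt (3/2 + a/2) \<le> 26926 / 10000"
  proof -
    let ?p = "sqrt (3/2 + b/2)" and ?q = "sqrt (3/2 + a/2)"
    have "(?p + ?q)\<^sup>2 \<le> 2 * (?p\<^sup>2 + ?q\<^sup>2)" using sum_squares_ge_zero[of "?p - ?q" 0] by (simp add: power2_eq_square algebra_simps)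
    also have "\<dots> = 6 + (a + b)" using a b by simp
    also have "\<dots> \<le> (26926 / 10000)\<^sup>2" using ab by (simp add: power2_eq_square)
    finally show ?thesis by (rule power2_le_imp_le) simp
  qed
  \<comment> \<open>Four decimals are needed: at \<open>T = 16 / 3\<close> the final inequality
    holds with a margin of less than \<open>1 / 20\<close>.\<close>
  have c1: "17677 / 10000 \<le> sqrt (25/8)" by (rule real_le_rsqrt) (simp add: power2_eq_square)
  have c2: "sqrt (25/8) \<le> 17678 / 10000" by (rule real_le_lsqrt) (simp_all add: power2_eq_square)
  have c3: "36055 / 10000 \<le> sqrt 13" by (rule real_le_rsqrt) (simp add: power2_eq_square)
  have "sqrt (25/8) * (T + (x + y) / 2 + L) = 2 * sqrt (25/8) * T - sqrt (25/8) * ln 4"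
    by (simp add: T_def algebra_simps)
  also have "\<dots> \<le> 2 * (17678 / 10000) * T - (17677 / 10000) * (4 / 3)"
    using c1 c2 T ln_4_ge by (intro diff_mono mult_right_mono mult_left_mono mult_mono) auto
  finally have "sqrt (25/8) * (T + (x + y) / 2 + L) \<le> 2 * (17678 / 10000) * T - (17677 / 10000) * (4 / 3)" .
  moreover have "(36055 / 10000) * T \<le> sqrt 13 * T" using c3 T by (intro mult_right_mono) auto
  ultimately show ?thesis using tau T unfolding a_def b_def by linarith
qed

section \<open>Exponential moments of the sample and the event on which the bound holds\<close>

lemma (in prob_space) nn_integral_exp_sum_iid_le:
  fixes X :: "'a \<Rightarrow> 'b::topological_space" and Xs :: "nat \<Rightarrow> 'a \<Rightarrow> 'b" and g :: "'b \<Rightarrow> real"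
  assumes indep: "indep_vars (\<lambda>_. borel) Xs {1..n}"
    and ident: "\<And>i. i \<in> {1..n} \<Longrightarrow> distr M borel (Xs i) = distr M borel X"
    and [measurable]: "X \<in> borel_measurable M" "g \<in> borel_measurable borel"
    and le: "(\<integral>\<^sup>+x. ennreal (exp (g (X x))) \<partial>M) \<le> ennreal (exp c)"
  shows "(\<integral>\<^sup>+x. ennreal (exp (\<Sum>i=1..n. g (Xs i x))) \<partial>M) \<le> ennreal (exp (n * c))"
proof -
  have [measurable]: "Xs i \<in> borel_measurable M" if "i \<in> {1..n}" for i
    using indep that by (auto simp: indep_vars_def)
  have one: "(\<integral>\<^sup>+x. ennreal (exp (g (Xs i x))) \<partial>M) \<le> ennreal (exp c)" if i: "i \<in> {1..n}" for i
  proof -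
    have "(\<integral>\<^sup>+x. ennreal (exp (g (Xs i x))) \<partial>M) = (\<integral>\<^sup>+z. ennreal (exp (g z)) \<partial>distr M borel (Xs i))"
      using i by (subst nn_integral_distr) auto
    also have "\<dots> = (\<integral>\<^sup>+x. ennreal (exp (g (X x))) \<partial>M)"
      unfolding ident[OF i] by (subst nn_integral_distr) auto
    finally show ?thesis using le by simp
  qed
  have "(\<integral>\<^sup>+x. ennreal (exp (\<Sum>i=1..n. g (Xs i x))) \<partial>M) = (\<integral>\<^sup>+x. (\<Prod>i\<in>{1..n}. ennreal (exp (g (Xs i x)))) \<partial>M)"
    by (simp add: exp_sum prod_ennreal)
  also have "\<dots> = (\<Prod>i\<in>{1..n}. \<integral>\<^sup>+x. ennreal (exp (g (Xs i x))) \<partial>M)"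
    by (rule indep_vars_nn_integral)
      (use indep_vars_compose2[OF indep, where Y = "\<lambda>_ z. ennreal (exp (g z))" and N = "\<lambda>_. borel"] in auto)
  also have "\<dots> \<le> (\<Prod>i\<in>{1..n}. ennreal (exp c))" by (intro prod_mono_ennreal one)
  also have "\<dots> = ennreal (exp (n * c))" by (simp add: ennreal_power exp_of_nat_mult)
  finally show ?thesis .
qed

text \<open>Because of \<open>sgn\<close>, every test matrix has norm at most
  \<open>l \<le> r\<close>, so \<open>mg\<close> applies to all of them although the Gaussian is
  unbounded. Fubini bounds the mean of the Gaussian average by 1, and Markov's inequality gives the
  event.\<close>

lemma (in prob_space) normalised_exp_event:
  fixes D :: "'a \<Rightarrow> 'c::euclidean_space" and Y :: "'b::euclidean_space \<Rightarrow> 'c"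
  assumes [measurable]: "D \<in> borel_measurable M" "Y \<in> borel_measurable borel"
    and mg: "\<And>V. norm V \<le> r \<Longrightarrow> (\<integral>\<^sup>+x. ennreal (exp (V \<bullet> D x)) \<partial>M) \<le> ennreal (exp (k * (norm V)\<^sup>2))"
    and l: "0 \<le> l" "l \<le> r" and "0 \<le> k" "0 < \<delta>"
  defines "E \<equiv> {x \<in> space M. (\<integral>\<^sup>+\<theta>. ennreal (exp (l * (sgn (Y \<theta>) \<bullet> D x) - k * l\<^sup>2)) \<partial>gauss) \<le> ennreal (1 / \<delta>)}"
  shows "E \<in> sets M" "1 - \<delta> \<le> prob E"
proof -
  define Z where "Z x = (\<integral>\<^sup>+\<theta>. ennreal (exp (l * (sgn (Y \<theta>) \<bullet> D x) - k * l\<^sup>2)) \<partial>gauss)" for x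
  have m2[measurable]: "(\<lambda>(x, \<theta>). ennreal (exp (l * (sgn (Y \<theta>) \<bullet> D x) - k * l\<^sup>2))) \<in> borel_measurable (M \<Otimes>\<^sub>M gauss)"
    unfolding sgn_div_norm by measurable
  have [measurable]: "Z \<in> borel_measurable M"
    unfolding Z_def by (rule gauss.borel_measurable_nn_integral) (rule m2)
  have E: "E = {x \<in> space M. Z x \<le> ennreal (1 / \<delta>)}" by (simp add: E_def Z_def)
  show Em[measurable]: "E \<in> sets M" unfolding E by measurable
  have "(\<integral>\<^sup>+x. Z x \<partial>M) \<le> 1"
  proof -
    interpret P: pair_sigma_finite M "gauss :: 'b measure" ..
    have "(\<integral>\<^sup>+x. Z x \<partial>M) = (\<integral>\<^sup>+\<theta>. \<integral>\<^sup>+x. ennreal (exp (l * (sgn (Y \<theta>) \<bullet> D x) - k * l\<^sup>2)) \<partial>M \<partial>gauss)"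
      unfolding Z_def by (rule P.Fubini'[OF m2, symmetric])
    also have "\<dots> \<le> (\<integral>\<^sup>+\<theta>. 1 \<partial>(gauss :: 'b measure))"
    proof (rule nn_integral_mono)
      fix \<theta> :: 'b
      define V where "V = l *\<^sub>R sgn (Y \<theta>)"
      have nV: "norm V \<le> l" using l by (simp add: V_def norm_sgn)
      have "(\<integral>\<^sup>+x. ennreal (exp (l * (sgn (Y \<theta>) \<bullet> D x) - k * l\<^sup>2)) \<partial>M)
          = (\<integral>\<^sup>+x. ennreal (exp (- k * l\<^sup>2)) * ennreal (exp (V \<bullet> D x)) \<partial>M)"
        by (simp add: V_def ennreal_mult[symmetric] mult_exp_exp)
      also have "\<dots> = ennreal (exp (- k * l\<^sup>2)) * (\<integral>\<^sup>+x. ennreal (exp (V \<bullet> D x)) \<partial>M)"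
        by (rule nn_integral_cmult) simp
      also have "\<dots> \<le> ennreal (exp (- k * l\<^sup>2)) * ennreal (exp (k * (norm V)\<^sup>2))"
        using nV l by (intro mult_left_mono mg) auto
      also have "\<dots> = ennreal (exp (k * (norm V)\<^sup>2 - k * l\<^sup>2))"
        by (simp add: ennreal_mult[symmetric] mult_exp_exp)
      also have "\<dots> \<le> ennreal 1"
        using mult_left_mono[OF power_mono[OF nV norm_ge_zero, of 2] \<open>0 \<le> k\<close>] by (intro ennreal_leI) simp
      finally show "(\<integral>\<^sup>+x. ennreal (exp (l * (sgn (Y \<theta>) \<bullet> D x) - k * l\<^sup>2)) \<partial>M) \<le> 1" by simp
    qed
    finally show ?thesis by simp
  qed
  moreover have "emeasure M {x \<in> space M. 1 \<le> ennreal \<delta> * Z x} \<le> ennreal \<delta> * (\<integral>\<^sup>+x. Z x \<partial>M)"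
    using nn_integral_Markov_inequality[of Z "space M" M "ennreal \<delta>"] by (simp cong: nn_integral_cong)
  ultimately have bad: "emeasure M {x \<in> space M. 1 \<le> ennreal \<delta> * Z x} \<le> ennreal \<delta>"
    by (metis mult_left_mono mult.right_neutral order_trans zero_le)
  have "space M - E \<subseteq> {x \<in> space M. 1 \<le> ennreal \<delta> * Z x}"
  proof
    fix x assume "x \<in> space M - E"
    then have x: "x \<in> space M" "ennreal (1 / \<delta>) \<le> Z x" by (auto simp: E)
    have "1 = ennreal \<delta> * ennreal (1 / \<delta>)" using \<open>0 < \<delta>\<close> by (simp add: ennreal_mult[symmetric])
    also have "\<dots> \<le> ennreal \<delta> * Z x" by (intro mult_left_mono x) simp
    finally show "x \<in> {x \<in> space M. 1 \<le> ennreal \<delta> * Z x}" using x by simp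
  qed
  then have "emeasure M (space M - E) \<le> ennreal \<delta>"
    by (intro order_trans[OF emeasure_mono bad]) measurable
  then have "prob (space M - E) \<le> \<delta>"
    using \<open>0 < \<delta>\<close> by (simp add: emeasure_eq_measure)
  then show "1 - \<delta> \<le> prob E" using prob_compl[OF Em] by simp
qed

section \<open>Rearrangement and measurability of the error event\<close>

lemma op_norm_rearrange_le:
  fixes A :: "real^('p::finite \<times> 'q::finite)^('p \<times> 'q)"
  assumes le: "\<And>U V. norm U = 1 \<Longrightarrow> norm V = 1 \<Longrightarrow> kronecker U V \<bullet> A \<le> c" and "0 \<le> c"
  shows "op_norm (rearrange A) \<le> c"
proof (rule op_norm_leI)
  fix v
  define w where "w = rearrange A *v v"
  show "norm (rearrange A *v v) \<le> c * norm v"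
  proof (cases "w = 0")
    case True
    then show ?thesis using \<open>0 \<le> c\<close> by (simp add: w_def)
  next
    case False
    then have v: "v \<noteq> 0" by (auto simp: w_def)
    \<comment> \<open>The unit vectors realising the norm in direction \<open>v\<close> are folded
      back into matrices, in the index order used by \<open>rearrange\<close>; their bilinear form
      then becomes a pairing with a Kronecker product.\<close>
    define U where "U = (\<chi> i j. sgn w $ (j, i))"
    define V where "V = (\<chi> k l. sgn v $ (l, k))"
    have n1: "norm (\<chi> i j. t $ (j, i)) = norm t" for t :: "real^('r::finite \<times> 'r)"
    proof -
      have "(\<Sum>i\<in>UNIV. \<Sum>j\<in>UNIV. t $ (j, i) * t $ (j, i)) = (\<Sum>j\<in>UNIV. \<Sum>i\<in>UNIV. t $ (j, i) * t $ (j, i))"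
        by (rule sum.swap)
      then show ?thesis by (simp add: norm_eq_sqrt_inner inner_vec_def sum_UNIV_prod)
    qed
    have nU: "norm U = 1" unfolding U_def n1 using False by (simp add: norm_sgn)
    have nV: "norm V = 1" unfolding V_def n1 using v by (simp add: norm_sgn)
    have "sgn w \<bullet> (rearrange A *v sgn v) = kronecker U V \<bullet> A"
    proof -
      have "sgn w \<bullet> (rearrange A *v sgn v) = (\<Sum>a\<in>UNIV. \<Sum>b\<in>UNIV. sgn w $ a * (rearrange A $ a $ b * sgn v $ b))"
        by (simp add: inner_vec_def matrix_vector_mult_def sum_distrib_left)
      also have "\<dots> = (\<Sum>((j, i), (l, k))\<in>UNIV. sgn w $ (j, i) * (A $ (i, k) $ (j, l) * sgn v $ (l, k)))"
        unfolding sum.cartesian_product UNIV_Times_UNIV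
        by (rule sum.cong) (auto simp: rearrange_nth)
      also have "\<dots> = (\<Sum>(a, b)\<in>UNIV. kronecker U V $ a $ b * A $ a $ b)"
        by (rule sum.reindex_bij_witness[where i = "\<lambda>((i, k), (j, l)). ((j, i), (l, k))"
              and j = "\<lambda>((j, i), (l, k)). ((i, k), (j, l))"]) (auto simp: kronecker_def U_def V_def)
      also have "\<dots> = kronecker U V \<bullet> A"
        by (simp add: inner_vec_def sum.cartesian_product)
      finally show ?thesis .
    qed
    then have "sgn w \<bullet> (rearrange A *v sgn v) \<le> c" using le[OF nU nV] by simp
    moreover have "rearrange A *v sgn v = (1 / norm v) *\<^sub>R w"
      by (simp add: sgn_div_norm w_def matrix_vector_mult_scaleR divide_inverse)
    moreover have "sgn w \<bullet> w = norm w"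
      using False by (simp add: sgn_div_norm dot_square_norm power2_eq_square)
    ultimately show ?thesis using v by (simp add: w_def[symmetric] field_simps)
  qed
qed

text \<open>Each Kronecker product becomes a rank-one matrix, so the rearranged covariance has rank
  at most the number of terms.\<close>

lemma rearrange_kronecker_sum:
  "rearrange (\<Sum>j\<in>J. kronecker (A j) (B j)) = (\<Sum>j\<in>J. outer (vec_of_matrix (A j)) (vec_of_matrix (B j)))"
proof -
  have "rearrange (\<Sum>j\<in>J. kronecker (A j) (B j)) $ (b, a) $ (d, c)
      = (\<Sum>j\<in>J. outer (vec_of_matrix (A j)) (vec_of_matrix (B j))) $ (b, a) $ (d, c)" for a b c d
    by (simp add: rearrange_nth sum_component kronecker_def outer_def vec_of_matrix_def)
  then show ?thesis by (simp add: vec_eq_iff)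
qed

lemma rearrange_diff: "rearrange (A - B) = rearrange A - rearrange B"
  by (simp add: vec_eq_iff rearrange_nth)

text \<open>Any point whose data lie within \<open>r - dist (R x) a\<close> of those of a good point
  \<open>x\<close> is good as well. Hence the set is the preimage under \<open>C\<close> of a union
  of open balls, and no measurability of \<open>R\<close> is required.\<close>

lemma nonexpansive_ball_measurable:
  fixes R :: "'a \<Rightarrow> 'b::metric_space" and C :: "'a \<Rightarrow> 'c::metric_space"
  assumes "C \<in> borel_measurable M"
    and le: "\<And>x x'. x \<in> space M \<Longrightarrow> x' \<in> space M \<Longrightarrow> dist (R x) (R x') \<le> dist (C x) (C x')"
  shows "{x \<in> space M. dist (R x) a < r} \<in> sets M"
proof -
  define O' where "O' = (\<Union>x\<in>{x \<in> space M. dist (R x) a < r}. ball (C x) (r - dist (R x) a))"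
  have "{x \<in> space M. dist (R x) a < r} = C -` O' \<inter> space M"
  proof (intro set_eqI iffI)
    fix x' assume "x' \<in> C -` O' \<inter> space M"
    then obtain x where x: "x \<in> space M" "dist (R x) a < r" "dist (C x) (C x') < r - dist (R x) a" "x' \<in> space M"
      by (auto simp: O'_def)
    have "dist (R x') a \<le> dist (R x) (R x') + dist (R x) a" by (metis dist_commute dist_triangle)
    also have "\<dots> < r" using le[of x x'] x by linarith
    finally show "x' \<in> {x \<in> space M. dist (R x) a < r}" using x by simp
  qed (auto simp: O'_def)
  moreover have "open O'" unfolding O'_def by (intro open_UN) auto
  ultimately show ?thesis using assms(1) by (simp add: measurable_sets)
qed

lemma bilinear_outer: "bilinear outer"
  unfolding bilinear_def by (auto intro!: linearI simp: vec_eq_iff outer_def algebra_simps)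

lemma continuous_on_outer: "continuous_on UNIV f \<Longrightarrow> continuous_on UNIV g \<Longrightarrow> continuous_on UNIV (\<lambda>v. outer (f v) (g v))"
  by (rule bounded_bilinear.continuous_on) (simp add: bilinear_conv_bounded_bilinear[symmetric] bilinear_outer)

lemma linear_rearrange: "linear rearrange"
  by (intro linearI) (auto simp: vec_eq_iff rearrange_nth)

lemma sandwich_outer:
  fixes A :: "real^'n^'n"
  assumes "transpose A = A"
  shows "A ** outer v w ** A = outer (A *v v) (A *v w)"
  unfolding matrix_mul_outer outer_matrix_mul by (simp only: assms)

lemma (in prob_space) psd_second_moment:
  assumes "integrable M (\<lambda>x. outer (X x) (X x))"
  shows "psd (\<integral>x. outer (X x) (X x) \<partial>M)"
proof -
  let ?S = "\<integral>x. outer (X x) (X x) \<partial>M"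
  have eq: "outer u v \<bullet> ?S = (\<integral>x. (u \<bullet> X x) * (v \<bullet> X x) \<partial>M)" for u v
    using assms by (subst integral_inner_right[symmetric])
      (simp_all add: inner_outer_left outer_mult_vec inner_commute mult.commute)
  have "?S $ i $ j = ?S $ j $ i" for i j
  proof -
    have "A $ i $ j = outer (axis i 1) (axis j 1) \<bullet> A" for A :: "real^'b^'b" and i j
      by (simp add: inner_outer_left inner_axis' matrix_vector_mul_component inner_axis)
    then show ?thesis by (simp only: eq) (simp add: mult.commute)
  qed
  then have "transpose ?S = ?S" by (simp add: vec_eq_iff transpose_def)
  moreover have "0 \<le> v \<bullet> (?S *v v)" for v
    unfolding inner_outer_left[symmetric] eq by (rule integral_nonneg_AE) simp
  ultimately show ?thesis by (simp add: psd_def)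
qed

lemma Max_effective_rank:
  fixes F :: "nat \<Rightarrow> real^'n^'n"
  assumes F: "\<forall>j\<in>{1..K}. psd (F j) \<and> F j \<noteq> 0" and "1 \<le> K"
  defines "m \<equiv> Max ((\<lambda>j. (effective_rank (F j))\<^sup>2) ` {1..K})"
  shows "1 \<le> m" and "\<And>j. j \<in> {1..K} \<Longrightarrow> trace (F j) \<le> op_norm (F j) * sqrt m"
proof -
  have le: "(effective_rank (F j))\<^sup>2 \<le> m" if "j \<in> {1..K}" for j
    unfolding m_def using that by (intro Max_ge) auto
  have ge: "1 \<le> effective_rank (F j)" if "j \<in> {1..K}" for j using F that effective_rank_ge_1 by blast
  have "1 \<in> {1..K}" using \<open>1 \<le> K\<close> by simp
  then show "1 \<le> m" using le[of 1] power_mono[OF ge[of 1], of 2] by simp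
  fix j assume j: "j \<in> {1..K}"
  have pos: "0 < op_norm (F j)" using F j op_norm_pos by blast
  have "effective_rank (F j) \<le> sqrt m" by (rule real_le_rsqrt[OF le[OF j]])
  then have "op_norm (F j) * effective_rank (F j) \<le> op_norm (F j) * sqrt m"
    using pos by (intro mult_left_mono) auto
  then show "trace (F j) \<le> op_norm (F j) * sqrt m" using pos by (simp add: effective_rank_def)
qed

section \<open>The risk bound for the penalised covariance estimator\<close>

theorem theorem2p5:
  fixes M :: "'a measure"
    and X :: "'a \<Rightarrow> real^('p::finite \<times> 'q::finite)"
    and Xs :: "nat \<Rightarrow> 'a \<Rightarrow> real^('p \<times> 'q)"
    and \<Sigma> :: "real^('p \<times> 'q)^('p \<times> 'q)"
    and \<Phi> :: "nat \<Rightarrow> real^'p^'p"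
    and \<Psi> :: "nat \<Rightarrow> real^'q^'q"
    and n K :: nat
    and \<omega> \<delta> lam :: real
    and R\<^sub>t :: "'a \<Rightarrow> real^('q \<times> 'q)^('p \<times> 'p)"
    and \<Sigma>\<^sub>t :: "'a \<Rightarrow> real^('p \<times> 'q)^('p \<times> 'q)"
  assumes "prob_space M"
    and "n \<ge> 1" and "K \<ge> 1"
    and indep: "prob_space.indep_vars M (\<lambda>_. borel) (\<lambda>i. if i = 0 then X else Xs i) {0..n}"
    and ident: "\<forall>i\<in>{1..n}. distr M borel (Xs i) = distr M borel X"
    and centered: "integrable M X" "(\<integral>x. X x \<partial>M) = 0"
    and cov: "integrable M (\<lambda>x. outer (X x) (X x))" "\<Sigma> = (\<integral>x. outer (X x) (X x) \<partial>M)"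
    and invertible: "invertible \<Sigma>"
    and kron: "\<Sigma> = (\<Sum>j=1..K. kronecker (\<Phi> j) (\<Psi> j))"
    and Phi: "\<forall>j\<in>{1..K}. psd (\<Phi> j) \<and> \<Phi> j \<noteq> 0"
    and Psi: "\<forall>j\<in>{1..K}. psd (\<Psi> j) \<and> \<Psi> j \<noteq> 0"
    and "\<omega> > 0"
    and mgf: "\<forall>V::real^('p \<times> 'q)^('p \<times> 'q). frobenius_norm V \<le> 1 / \<omega> \<longrightarrow>
      integrable M (\<lambda>x. exp ((inv_sqrt \<Sigma> *v X x) \<bullet> (V *v (inv_sqrt \<Sigma> *v X x)) - trace V)) \<and>
      ln (\<integral>x. exp ((inv_sqrt \<Sigma> *v X x) \<bullet> (V *v (inv_sqrt \<Sigma> *v X x)) - trace V) \<partial>M)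
        \<le> \<omega>\<^sup>2 * (frobenius_norm V)\<^sup>2"
    and "0 < \<delta>" and "\<delta> < 1"
    and delta: "1 / (2 * real n) *
        (Max ((\<lambda>j. (effective_rank (\<Phi> j))\<^sup>2) ` {1..K}) +
         Max ((\<lambda>j. (effective_rank (\<Psi> j))\<^sup>2) ` {1..K})) + ln (4 / \<delta>) / real n \<le> 1"
    and lam: "lam \<ge> 2 * \<omega> * (\<Sum>j=1..K. op_norm (\<Phi> j) * op_norm (\<Psi> j)) *
        sqrt (13 / (2 * real n) *
          (Max ((\<lambda>j. (effective_rank (\<Phi> j))\<^sup>2) ` {1..K}) +
           Max ((\<lambda>j. (effective_rank (\<Psi> j))\<^sup>2) ` {1..K})) + 13 * ln (4 / \<delta>) / real n)"
    and argmin: "\<forall>x\<in>space M. is_arg_min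
        (\<lambda>R. (frobenius_norm (R - rearrange (sample_cov n (\<lambda>i. Xs i x))))\<^sup>2 + lam * nuclear_norm R)
        (\<lambda>_. True) (R\<^sub>t x)"
    and Sigma_t: "\<forall>x\<in>space M. \<Sigma>\<^sub>t x = inv rearrange (R\<^sub>t x)"
  shows "measure M {x \<in> space M. (frobenius_norm (\<Sigma>\<^sub>t x - \<Sigma>))\<^sup>2 < 3 * lam\<^sup>2 * real K / 2}
      \<ge> 1 - \<delta>"
proof -
  interpret prob_space M by fact
  define S where "S = psd_sqrt \<Sigma>"
  have "psd \<Sigma>" unfolding cov(2) by (rule psd_second_moment[OF cov(1)])
  from psd_sqrt[OF this] have S: "psd S" "S ** S = \<Sigma>" by (auto simp: S_def)
  have St: "transpose S = S" using S by (simp add: psd_def)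
  have invS: "invertible S"
    using invertible S(2) by (metis invertible_right_inverse matrix_mul_assoc)
  \<comment> \<open>\<open>A\<close> whitens the data; \<open>SA\<close> below undoes the
    whitening.\<close>
  define A where "A = inv_sqrt \<Sigma>"
  have "S ** matrix_inv S = mat 1"
    using invS unfolding invertible_def matrix_inv_def by (rule someI2_ex) blast
  then have SA: "S *v (A *v v) = v" for v
    by (simp add: A_def inv_sqrt_def S_def[symmetric] matrix_vector_mul_assoc)

  define x where "x = Max ((\<lambda>j. (effective_rank (\<Phi> j))\<^sup>2) ` {1..K})"
  define y where "y = Max ((\<lambda>j. (effective_rank (\<Psi> j))\<^sup>2) ` {1..K})"
  interpret kc: kronecker_cov \<Sigma> S \<Phi> \<Psi> K x y
    using St S(2) kron Phi Psi Max_effective_rank[OF Phi \<open>K \<ge> 1\<close>] Max_effective_rank[OF Psi \<open>K \<ge> 1\<close>]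
    by unfold_locales (auto simp: x_def y_def)
  have s: "0 < kc.s"
    unfolding kc.s_def using Phi Psi \<open>K \<ge> 1\<close> by (intro sum_pos mult_pos_pos op_norm_pos) auto

  \<comment> \<open>The event will have level \<open>exp L = 1 / \<delta>\<close>. The number
    \<open>T\<close> is \<open>n\<close> times the left-hand side of \<open>delta\<close>; it
    contains \<open>ln 4\<close> beyond \<open>L\<close>, which covers the derivative terms.\<close>
  define L where "L = ln (1 / \<delta>)"
  define T where "T = (x + y) / 2 + ln 4 + L"
  have L: "0 \<le> L" "exp L = 1 / \<delta>" using \<open>0 < \<delta>\<close> \<open>\<delta> < 1\<close> by (auto simp: L_def)
  have ln4: "ln (4 / \<delta>) = ln 4 + L" using \<open>0 < \<delta>\<close> by (simp add: L_def ln_div)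
  have T2: "2 \<le> T"
    using kc.x kc.y L ln_4_ge unfolding T_def add_divide_distrib by linarith
  have n0: "0 < real n" using \<open>n \<ge> 1\<close> by simp
  have Tn: "T / real n = 1 / (2 * real n) * (x + y) + ln (4 / \<delta>) / real n"
    using n0 by (simp add: T_def ln4 field_simps)
  have "T / real n \<le> 1" unfolding Tn using delta unfolding x_def y_def .
  \<comment> \<open>In terms of this deviation level the hypothesis \<open>delta\<close> reads
    \<open>\<kappa> \<le> 1\<close> and the one on \<open>lam\<close> becomes
    \<open>lam'\<close>.\<close>
  define \<kappa> where "\<kappa> = sqrt (T / real n)"
  have \<kappa>: "0 < \<kappa>" "\<kappa> \<le> 1" "real n * \<kappa>\<^sup>2 = T"
    using T2 n0 \<open>T / real n \<le> 1\<close> by (auto simp: \<kappa>_def)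
  have lam': "2 * (\<omega> * kc.s * sqrt 13 * \<kappa>) \<le> lam"
  proof -
    have "13 / (2 * real n) * (x + y) + 13 * ln (4 / \<delta>) / real n = 13 * (T / real n)"
      unfolding Tn by (simp add: algebra_simps)
    moreover have "2 * \<omega> * kc.s * sqrt (13 / (2 * real n) * (x + y) + 13 * ln (4 / \<delta>) / real n) \<le> lam"
      using lam unfolding x_def y_def kc.s_def .
    moreover have "sqrt (13 * (T / real n)) = sqrt 13 * \<kappa>" by (simp only: \<kappa>_def real_sqrt_mult)
    ultimately have "2 * \<omega> * kc.s * (sqrt 13 * \<kappa>) \<le> lam" by (simp only:)
    then show ?thesis by (simp only: mult.assoc)
  qed
  have lam_pos: "0 < lam"
  proof -
    have "0 < 2 * (\<omega> * kc.s * sqrt 13 * \<kappa>)" using \<kappa> s \<open>\<omega> > 0\<close> by simp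
    then show ?thesis using lam' by linarith
  qed

  \<comment> \<open>Index 0 holds the generic copy \<open>X\<close>; the sample occupies the indices
    from 1 to \<open>n\<close>.\<close>
  have "indep_vars (\<lambda>_. borel) (\<lambda>i. if i = 0 then X else Xs i) {1..n}"
    using indep by (rule indep_vars_subset) auto
  also have "?this \<longleftrightarrow> indep_vars (\<lambda>_. borel) Xs {1..n}" by (rule indep_vars_cong) auto
  finally have ind: "indep_vars (\<lambda>_. borel) Xs {1..n}" .
  have Xs_meas[measurable]: "Xs i \<in> borel_measurable M" if "i \<in> {1..n}" for i
    using ind that by (auto simp: indep_vars_def)
  have X_meas[measurable]: "X \<in> borel_measurable M" using centered(1) by simp
  \<comment> \<open>Centred so that \<open>V \<bullet> D \<theta>\<close> is the sum over the sample
    of the exponents in \<open>mgf\<close>, the trace being the pairing with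
    \<open>mat 1\<close>.\<close>
  define D where "D \<theta> = (\<Sum>i=1..n. outer (A *v Xs i \<theta>) (A *v Xs i \<theta>) - mat 1)" for \<theta>
  have [measurable]: "(\<lambda>v :: real^('p \<times> 'q). outer (B *v v) (B *v v)) \<in> borel_measurable borel" for B :: "real^('p \<times> 'q)^('p \<times> 'q)"
    by (intro borel_measurable_continuous_onI continuous_on_outer linear_continuous_on) simp_all
  have D_meas: "D \<in> borel_measurable M" unfolding D_def by measurable
  define \<Sigma>h where "\<Sigma>h \<theta> = sample_cov n (\<lambda>i. Xs i \<theta>)" for \<theta>
  have \<Sigma>h_meas: "\<Sigma>h \<in> borel_measurable M"
  proof -
    have "(\<lambda>\<theta>. (1 / real n) *\<^sub>R (\<Sum>i=1..n. outer (mat 1 *v Xs i \<theta>) (mat 1 *v Xs i \<theta>))) \<in> borel_measurable M"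
      by measurable
    then show ?thesis by (simp add: \<Sigma>h_def[abs_def] sample_cov_def)
  qed
  have \<Sigma>h_sym: "transpose (\<Sigma>h \<theta> - \<Sigma>) = \<Sigma>h \<theta> - \<Sigma>" for \<theta>
    using kc.transpose_Sg
    by (simp add: transpose_diff \<Sigma>h_def sample_cov_def) (simp add: vec_eq_iff transpose_def sum_component outer_def mult.commute)

  have mg: "(\<integral>\<^sup>+\<theta>. ennreal (exp (V \<bullet> D \<theta>)) \<partial>M) \<le> ennreal (exp (real n * \<omega>\<^sup>2 * (norm V)\<^sup>2))"
    if V: "norm V \<le> 1 / \<omega>" for V
  proof -
    define g where "g v = (A *v v) \<bullet> (V *v (A *v v)) - trace V" for v
    have g: "g v = V \<bullet> (outer (A *v v) (A *v v) - mat 1)" for v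
      using inner_outer_left[of "A *v v" "A *v v" V] inner_commute[of V "outer (A *v v) (A *v v)"]
      by (simp add: g_def inner_diff_right trace_eq_inner)
    have [measurable]: "g \<in> borel_measurable borel" unfolding g by measurable
    have int: "integrable M (\<lambda>\<theta>. exp (g (X \<theta>)))" and ln: "ln (\<integral>\<theta>. exp (g (X \<theta>)) \<partial>M) \<le> \<omega>\<^sup>2 * (norm V)\<^sup>2"
      using mgf[rule_format, of V] V by (auto simp: g_def A_def frobenius_norm_eq_norm)
    have "(\<integral>\<theta>. exp (g (X \<theta>)) \<partial>M) \<le> exp (\<omega>\<^sup>2 * (norm V)\<^sup>2)"
    \<comment> \<open>A bound on \<open>ln\<close> of the integral can be exponentiated only if the
      integral is positive; otherwise the claim is immediate.\<close>
    proof (cases "0 < (\<integral>\<theta>. exp (g (X \<theta>)) \<partial>M)")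
      case True
      then show ?thesis using ln by (metis exp_le_cancel_iff exp_ln)
    next
      case False
      then show ?thesis by (meson exp_gt_zero less_le_not_le linorder_not_le order_trans)
    qed
    then have "(\<integral>\<^sup>+\<theta>. ennreal (exp (g (X \<theta>))) \<partial>M) \<le> ennreal (exp (\<omega>\<^sup>2 * (norm V)\<^sup>2))"
      using int by (subst nn_integral_eq_integral) (auto intro: ennreal_leI)
    from nn_integral_exp_sum_iid_le[OF ind _ X_meas _ this] ident
    have "(\<integral>\<^sup>+\<theta>. ennreal (exp (\<Sum>i=1..n. g (Xs i \<theta>))) \<partial>M) \<le> ennreal (exp (real n * (\<omega>\<^sup>2 * (norm V)\<^sup>2)))"
      by simp
    moreover have "V \<bullet> D \<theta> = (\<Sum>i=1..n. g (Xs i \<theta>))" for \<theta> by (simp add: D_def g inner_sum_right)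
    ultimately show ?thesis by (simp add: mult.assoc)
  qed

  \<comment> \<open>\<open>\<kappa> \<le> 1\<close> makes \<open>l\<close> admissible for
    \<open>mg\<close>, and the normalising exponent \<open>n * \<omega>^2 * l^2\<close> becomes
    exactly \<open>T\<close>.\<close>
  define l where "l = \<kappa> / \<omega>"
  have l: "0 < l" "l \<le> 1 / \<omega>" "real n * \<omega>\<^sup>2 * l\<^sup>2 = T"
    using \<kappa> \<open>\<omega> > 0\<close> by (auto simp: l_def power_divide divide_right_mono)
  \<comment> \<open>Moving the two factors \<open>S\<close> across the inner product cancels the
    whitening.\<close>
  have tensD: "kc.tens W \<bullet> D \<theta> = real n * (W \<bullet> (\<Sigma>h \<theta> - \<Sigma>))" for W \<theta>
  proof -
    have "kc.tens W \<bullet> D \<theta> = W \<bullet> (S ** D \<theta> ** S)"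
      unfolding kc.tens_def inner_matrix_mul_right[of "S ** W" S] inner_matrix_mul_left[of S W]
      by (simp add: St matrix_mul_assoc)
    also have "S ** D \<theta> ** S = (\<Sum>i=1..n. outer (Xs i \<theta>) (Xs i \<theta>) - \<Sigma>)"
      unfolding D_def sum_matrix_mul_right sum_matrix_mul_left
      by (simp add: matrix_mul_diff_left matrix_mul_diff_right sandwich_outer[OF St] SA S(2))
    also have "\<dots> = real n *\<^sub>R (\<Sigma>h \<theta> - \<Sigma>)"
    proof -
      have "(\<Sum>i=1..n. \<Sigma>) = real n *\<^sub>R \<Sigma>" by (simp add: sum_constant_scaleR del: sum_constant)
      then show ?thesis using n0 by (simp add: \<Sigma>h_def sample_cov_def sum_subtractf scaleR_diff_right del: sum_constant)
    qed
    finally show ?thesis by simp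
  qed

  \<comment> \<open>One event serves all \<open>U\<close> and \<open>V\<close> at once: it concerns
    only the average over the centred Gaussian, and the two matrices enter afterwards as
    shifts.\<close>
  have "\<exists>E\<in>sets M. 1 - \<delta> \<le> prob E \<and> (\<forall>\<theta>\<in>E. \<forall>U V. norm U = 1 \<longrightarrow> norm V = 1 \<longrightarrow>
      l * (real n * (kronecker U V \<bullet> (\<Sigma>h \<theta> - \<Sigma>))) \<le> kc.s * (sqrt 13 * T))"
  proof (cases "(1 + 1 / sqrt x) * (1 + 1 / sqrt y) \<le> 9 / 4")
    case True
    let ?Y = "\<lambda>\<theta>. kc.symk (fst \<theta>) (snd \<theta>)"
    have "bounded_bilinear kc.symk" using kc.bilinear_symk by (simp add: bilinear_conv_bounded_bilinear)
    then have Y: "?Y \<in> borel_measurable borel"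
      by (intro borel_measurable_continuous_onI bounded_bilinear.continuous_on[of kc.symk] continuous_intros)
    note E = normalised_exp_event[OF D_meas Y mg less_imp_le[OF l(1)] l(2) _ \<open>0 < \<delta>\<close>]
    let ?E = "{x \<in> space M. (\<integral>\<^sup>+\<theta>. ennreal (exp (l * (sgn (?Y \<theta>) \<bullet> D x) - real n * \<omega>\<^sup>2 * l\<^sup>2)) \<partial>gauss) \<le> ennreal (1 / \<delta>)}"
    have bound: "l * (real n * (kronecker U V \<bullet> (\<Sigma>h \<theta> - \<Sigma>))) \<le> kc.s * (sqrt 13 * T)"
      if \<theta>: "\<theta> \<in> ?E" and U: "norm U = 1" and V: "norm V = 1" for \<theta> U V
    proof -
      have "kc.symk U V \<bullet> D \<theta> = real n * (((1/2) *\<^sub>R (kronecker U V + transpose (kronecker U V))) \<bullet> (\<Sigma>h \<theta> - \<Sigma>))"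
        unfolding kc.symk_def by (rule tensD)
      \<comment> \<open>The error is symmetric, so it pairs equally with a matrix and with its
        transpose.\<close>
      also have "\<dots> = real n * (kronecker U V \<bullet> (\<Sigma>h \<theta> - \<Sigma>))"
        using inner_transpose[of "kronecker U V" "\<Sigma>h \<theta> - \<Sigma>"] by (simp add: \<Sigma>h_sym inner_add_left)
      finally have "l * (real n * (kronecker U V \<bullet> (\<Sigma>h \<theta> - \<Sigma>))) = l * (kc.symk U V \<bullet> D \<theta>)" by simp
      also have "\<dots> \<le> kc.s * (sqrt (25/8) * (T + (x + y) / 2 + L)
          + (sqrt (3/2 + 1 / sqrt y / 2) + sqrt (3/2 + 1 / sqrt x / 2)))"
        using \<theta> by (intro kc.symk_deviation_bound[OF _ s U V T2 L(1) True]) (simp add: l(3) L(2))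
      also have "\<dots> \<le> kc.s * (sqrt 13 * T)"
        using s unfolding T_def by (intro mult_left_mono symk_constant_le kc.x kc.y L True) auto
      finally show ?thesis .
    qed
    show ?thesis by (intro bexI[of _ ?E] conjI ballI allI impI E bound) simp_all
  next
    case False
    have Y: "kc.tens \<in> borel_measurable borel"
      using kc.linear_tens by (intro borel_measurable_continuous_onI linear_continuous_on) (simp add: linear_conv_bounded_linear)
    note E = normalised_exp_event[OF D_meas Y mg less_imp_le[OF l(1)] l(2) _ \<open>0 < \<delta>\<close>]
    let ?E = "{x \<in> space M. (\<integral>\<^sup>+\<theta>. ennreal (exp (l * (sgn (kc.tens \<theta>) \<bullet> D x) - real n * \<omega>\<^sup>2 * l\<^sup>2)) \<partial>gauss) \<le> ennreal (1 / \<delta>)}"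
    have bound: "l * (real n * (kronecker U V \<bullet> (\<Sigma>h \<theta> - \<Sigma>))) \<le> kc.s * (sqrt 13 * T)"
      if \<theta>: "\<theta> \<in> ?E" and U: "norm U = 1" and V: "norm V = 1" for \<theta> U V
    proof -
      have "l * (real n * (kronecker U V \<bullet> (\<Sigma>h \<theta> - \<Sigma>))) = l * (kc.tens (kronecker U V) \<bullet> D \<theta>)"
        by (simp add: tensD)
      also have "\<dots> \<le> kc.s * (sqrt 3 * (T + x * y / 4 + L) + 1)"
        using \<theta> by (intro kc.tens_deviation_bound[OF _ s U V T2 L(1)]) (simp add: l(3) L(2))
      also have "\<dots> \<le> kc.s * (sqrt 13 * T)"
        using s False unfolding T_def by (intro mult_left_mono tens_constant_le kc.x kc.y L) auto
      finally show ?thesis .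
    qed
    show ?thesis by (intro bexI[of _ ?E] conjI ballI allI impI E bound) simp_all
  qed
  then obtain E where E: "E \<in> sets M" "1 - \<delta> \<le> prob E"
    and dev: "\<And>\<theta> U V. \<theta> \<in> E \<Longrightarrow> norm U = 1 \<Longrightarrow> norm V = 1 \<Longrightarrow>
      l * (real n * (kronecker U V \<bullet> (\<Sigma>h \<theta> - \<Sigma>))) \<le> kc.s * (sqrt 13 * T)" by blast

  have \<Sigma>t: "frobenius_norm (\<Sigma>\<^sub>t \<theta> - \<Sigma>) = norm (R\<^sub>t \<theta> - rearrange \<Sigma>)" if "\<theta> \<in> space M" for \<theta>
  proof -
    have "rearrange (\<Sigma>\<^sub>t \<theta>) = R\<^sub>t \<theta>"
      using Sigma_t that bij_rearrange by (metis bij_inv_eq_iff)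
    then show ?thesis
      using frobenius_norm_rearrange[of "\<Sigma>\<^sub>t \<theta> - \<Sigma>"] by (simp add: rearrange_diff frobenius_norm_eq_norm)
  qed
  have amin: "is_arg_min (\<lambda>R. (norm (R - rearrange (\<Sigma>h \<theta>)))\<^sup>2 + lam * nuclear_norm R) (\<lambda>_. True) (R\<^sub>t \<theta>)"
    if "\<theta> \<in> space M" for \<theta>
    using argmin that by (simp add: frobenius_norm_eq_norm \<Sigma>h_def)
  let ?G = "{\<theta> \<in> space M. (frobenius_norm (\<Sigma>\<^sub>t \<theta> - \<Sigma>))\<^sup>2 < 3 * lam\<^sup>2 * real K / 2}"
  have "E \<subseteq> ?G"
  proof
    fix \<theta> assume \<theta>: "\<theta> \<in> E"
    then have sp: "\<theta> \<in> space M" using E(1) sets.sets_into_space by blast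
    have "op_norm (rearrange (\<Sigma>h \<theta> - \<Sigma>)) \<le> \<omega> * kc.s * sqrt 13 * \<kappa>"
    proof (rule op_norm_rearrange_le)
      fix U :: "real^'p^'p" and V :: "real^'q^'q" assume "norm U = 1" "norm V = 1"
      \<comment> \<open>Substituting \<open>l = \<kappa> / \<omega>\<close> and
        \<open>T = n * \<kappa>^2\<close> leaves a common factor \<open>\<kappa> * n\<close> to
        cancel.\<close>
      from dev[OF \<theta> this] have "\<kappa> * (real n * (kronecker U V \<bullet> (\<Sigma>h \<theta> - \<Sigma>))) \<le> \<omega> * kc.s * sqrt 13 * (real n * \<kappa>\<^sup>2)"
        using \<open>\<omega> > 0\<close> unfolding \<kappa>(3) by (simp add: l_def field_simps)
      then have "(\<kappa> * real n) * (kronecker U V \<bullet> (\<Sigma>h \<theta> - \<Sigma>)) \<le> (\<kappa> * real n) * (\<omega> * kc.s * sqrt 13 * \<kappa>)"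
        by (simp add: power2_eq_square mult_ac)
      then show "kronecker U V \<bullet> (\<Sigma>h \<theta> - \<Sigma>) \<le> \<omega> * kc.s * sqrt 13 * \<kappa>"
        using \<kappa>(1) n0 by (simp add: mult_le_cancel_left_pos)
    qed (use \<kappa> s \<open>\<omega> > 0\<close> in auto)
    also have "\<dots> \<le> lam / 2" using lam' by simp
    finally have op: "op_norm (rearrange (\<Sigma>h \<theta>) - rearrange \<Sigma>) \<le> lam / 2" by (simp add: rearrange_diff)
    have "norm (R\<^sub>t \<theta> - rearrange \<Sigma>) \<le> (1 + sqrt 2) / 2 * lam * sqrt (real K)"
      by (rule nuclear_prox_low_rank_bound[OF amin[OF sp] less_imp_le[OF lam_pos] _ op])
        (simp add: kron rearrange_kronecker_sum)
    then have "(norm (R\<^sub>t \<theta> - rearrange \<Sigma>))\<^sup>2 \<le> ((1 + sqrt 2) / 2 * lam * sqrt (real K))\<^sup>2"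
      by (intro power_mono) auto
    also have "\<dots> = ((1 + sqrt 2) / 2)\<^sup>2 * (lam\<^sup>2 * real K)"
      by (simp only: power_mult_distrib mult.assoc real_sqrt_pow2[OF of_nat_0_le_iff])
    also have "\<dots> < 3 / 2 * (lam\<^sup>2 * real K)"
    proof (rule mult_strict_right_mono)
      \<comment> \<open>The square of \<open>(1 + sqrt 2) / 2\<close> is
        \<open>(3 + 2 * sqrt 2) / 4\<close>, so being below \<open>3 / 2\<close> amounts to this.
        Strictness of the conclusion comes from here and from \<open>lam > 0\<close>.\<close>
      have "sqrt 2 < 3 / 2" by (rule real_less_lsqrt) (auto simp: power2_eq_square)
      then show "((1 + sqrt 2) / 2)\<^sup>2 < 3 / 2" by (simp add: power_divide power2_sum)
    qed (use lam_pos \<open>K \<ge> 1\<close> in auto)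
    finally show "\<theta> \<in> ?G" using sp by (simp add: \<Sigma>t)
  qed
  \<comment> \<open>\<open>measure\<close> is 0 on sets outside \<open>sets M\<close>, so the
    inclusion of \<open>E\<close> gives a lower bound only for measurable \<open>?G\<close>.\<close>
  moreover have "?G \<in> sets M"
  proof -
    have sq: "a\<^sup>2 < c \<longleftrightarrow> a < sqrt c" if "0 \<le> a" for a c :: real
      using real_sqrt_less_iff[of "a\<^sup>2" c] that by simp
    have "?G = {\<theta> \<in> space M. dist (R\<^sub>t \<theta>) (rearrange \<Sigma>) < sqrt (3 * lam\<^sup>2 * real K / 2)}"
      by (intro Collect_cong conj_cong refl) (simp only: \<Sigma>t dist_norm sq[OF norm_ge_zero])
    also have "\<dots> \<in> sets M"
    proof (rule nonexpansive_ball_measurable)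
      show "(\<lambda>\<theta>. rearrange (\<Sigma>h \<theta>)) \<in> borel_measurable M"
        using measurable_compose[OF \<Sigma>h_meas borel_measurable_continuous_onI[of rearrange]]
          linear_continuous_on linear_rearrange by (metis linear_conv_bounded_linear)
      fix \<theta> \<theta>' assume "\<theta> \<in> space M" "\<theta>' \<in> space M"
      then show "dist (R\<^sub>t \<theta>) (R\<^sub>t \<theta>') \<le> dist (rearrange (\<Sigma>h \<theta>)) (rearrange (\<Sigma>h \<theta>'))"
        unfolding dist_norm by (intro nuclear_prox_nonexpansive[OF amin amin less_imp_le[OF lam_pos]])
    qed
    finally show ?thesis .
  qed
  ultimately have "prob E \<le> measure M ?G" by (intro finite_measure_mono)
  then show ?thesis using E(2) by linarith
qed

end
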